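(* Consider a discrete memoryless channel with transition probability matrix $P_{Y|X}$ and capacity $C$, and, for each blocklength $n$, the random coding ensemble $\mathcal{C}$ of codes of size $M$ and rate $R=\frac1n\log M$ in which the $M$ messages are assigned independent codewords, each drawn with i.i.d. components of per-letter distribution $P_X$, where $I(P_X,P_{Y|X})>0$. Let $\mathbb{E}_{\mathcal{C}}[H_\alpha(X^n|Y^n)]$ be the Arimoto-R\'enyi conditional entropy of the transmitted codeword $X^n$ given the channel output $Y^n$, averaged over the ensemble. Then: 1) For all $\alpha>0$, and rates $R$ below the channel capacity $C$, $$\limsup_{n\to\infty}-\frac1n\log\mathbb{E}_{\mathcal{C}}\bigl[H_\alpha(X^n|Y^n)\bigr]\le E_{\mathrm{sp}}(R),$$ where $E_{\mathrm{sp}}$ denotes the sphere-packing error exponent $$E_{\mathrm{sp}}(R)=\sup_{\rho\ge0}\rho\Bigl(\max_{Q_X}I_{\frac1{1+\rho}}(Q_X,P_{Y|X})-R\Bigr),$$ the maximum being over all single-letter distributions $Q_X$ on the input alphabet. 2) For all $\alpha\in(0,1)$, $$\liminf_{n\to\infty}-\frac1n\log\mathbb{E}_{\mathcal{C}}\bigl[H_\alpha(X^n|Y^n)\bigr]\ge\alpha E_{\mathrm{r}}(R,P_X)-(1-\alpha)R,$$ provided that $R<R_\alpha(P_X,P_{Y|X})$, where $R_\alpha(P_X,P_{Y|X})$ is the unique solution $r\in(0,I(P_X,P_{Y|X}))$ to $$E_{\mathrm{r}}(r,P_X)=\Bigl(\frac1\alpha-1\Bigr)r.$$ 3) The rate $R_\alpha(P_X,P_{Y|X})$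 is monotonically increasing and continuous in $\alpha\in(0,1)$, and $$\lim_{\alpha\downarrow0}R_\alpha(P_X,P_{Y|X})=0,\qquad\lim_{\alpha\uparrow1}R_\alpha(P_X,P_{Y|X})=I(P_X,P_{Y|X}).$$
   Context: Logarithms have an arbitrary fixed base larger than 1 and $\exp$ is the inverse of $\log$. Channel: input and output alphabets $\mathcal{X},\mathcal{Y}$ are discrete, and $P_{Y^n|X^n}(y^n|x^n)=\prod_{i=1}^nP_{Y|X}(y_i|x_i)$. The capacity is $C=\max_{Q_X}I(Q_X,P_{Y|X})$, where $I(P_X,P_{Y|X})=I(X;Y)$ is the mutual information. Code ensemble: for each $n$, the $M=\exp(nR)$ messages, which are equiprobable, are assigned codewords drawn independently from $P_{X^n}(x^n)=\prod_{i=1}^nP_X(x_i)$. For each realization of the code, $X^n$ is the transmitted codeword (the channel input), $Y^n$ is the resulting channel output, and $H_\alpha(X^n|Y^n)$ is the Arimoto-R\'enyi conditional entropy of $X^n$ given $Y^n$; $\mathbb{E}_{\mathcal{C}}$ averages over the random choice of the code. The Arimoto-R\'enyi conditional entropy of order $\alpha\in(0,1)\cup(1,\infty)$ of a discrete $U$ given $V$ is $H_\alpha(U|V)=\frac{\alpha}{1-\alpha}\log\mathbb{E}\bigl[(\sum_uP_{U|V}^\alpha(u|V))^{1/\alpha}\bigr]$, and $H_1(U|V)$ is the Shannon conditional entropy. The $\alpha$-mutual information is given by $I_1(P_X,P_{Y|X})=I(P_X,P_{Y|X})$ and, for $\rho>0$, $$\rho\,I_{\frac1{1+\rho}}(P_X,P_{Y|X})=E_0(\rho,P_X)=-\log\sum_{y\in\mathcal{Y}}\Bigl(\sum_{x\in\mathcal{X}}P_X(x)P_{Y|X}^{\frac1{1+\rho}}(y|x)\Bigr)^{1+\rho}.$$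 The random-coding error exponent is $E_{\mathrm{r}}(R,P_X)=\max_{\rho\in[0,1]}\rho\bigl(I_{\frac1{1+\rho}}(P_X,P_{Y|X})-R\bigr)$.
   Formalization: Item 1 is stated only when the averaged conditional entropy is nonzero for all large n, so that its logarithm is defined; this excludes R = 0 and those P_X for which the output determines every input letter in the support of P_X, where the printed bound can fail. *)

theory Defs
  imports "HOL-Probability.Probability"
begin

text \<open>
  A single-letter distribution is a pmf \<open>P\<close>, a channel \<open>P\<^sub>Y\<^sub>|\<^sub>X\<close> is a map \<open>W\<close> sending an input
  letter to a pmf on output letters, and \<open>b > 1\<close> is the base of all logarithms.  Alphabets are
  countable, so maxima over input distributions are written as suprema in the extended reals; for
  finite alphabets these suprema are attained.
\<close>

text \<open>The logarithm on \<open>[0,\<infinity>)\<close> with \<open>log 0 = -\<infinity>\<close> (the library has \<open>log b 0 = 0\<close>).\<close>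

definition elog :: "real \<Rightarrow> real \<Rightarrow> ereal" where
  "elog b x = (if x = 0 then -\<infinity> else ereal (log b x))"


subsection \<open>Information measures\<close>

definition joint_pmf :: "'a pmf \<Rightarrow> ('a \<Rightarrow> 'b pmf) \<Rightarrow> ('a \<times> 'b) pmf" where
  "joint_pmf P W = bind_pmf P (\<lambda>x. map_pmf (Pair x) (W x))"

definition output_pmf :: "'a pmf \<Rightarrow> ('a \<Rightarrow> 'b pmf) \<Rightarrow> 'b pmf" where
  "output_pmf P W = bind_pmf P W"

definition info_density :: "real \<Rightarrow> 'a pmf \<Rightarrow> ('a \<Rightarrow> 'b pmf) \<Rightarrow> 'a \<times> 'b \<Rightarrow> real" where
  "info_density b P W = (\<lambda>(x, y). log b (pmf (W x) y / pmf (output_pmf P W) y))"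

text \<open>
  The expected information density, split into positive and negative part because it may be
  infinite on infinite alphabets, where the real-valued library notion would return \<open>0\<close>.
  The negative part always has a finite expectation.
\<close>

definition mutual_info :: "real \<Rightarrow> 'a pmf \<Rightarrow> ('a \<Rightarrow> 'b pmf) \<Rightarrow> ereal" where
  "mutual_info b P W =
     enn2ereal (\<integral>\<^sup>+ z. ennreal (info_density b P W z) \<partial>measure_pmf (joint_pmf P W)) -
     enn2ereal (\<integral>\<^sup>+ z. ennreal (- info_density b P W z) \<partial>measure_pmf (joint_pmf P W))"

definition capacity :: "real \<Rightarrow> ('a \<Rightarrow> 'b pmf) \<Rightarrow> ereal" where
  "capacity b W = (SUP Q. mutual_info b Q W)"

definition gallager_E0 :: "real \<Rightarrow> real \<Rightarrow> 'a pmf \<Rightarrow> ('a \<Rightarrow> 'b pmf) \<Rightarrow> real" where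
  "gallager_E0 b \<rho> P W =
     - log b (\<Sum>\<^sub>\<infinity>y. (\<Sum>\<^sub>\<infinity>x. pmf P x * pmf (W x) y powr (1 / (1 + \<rho>))) powr (1 + \<rho>))"

text \<open>Used for \<open>0 < \<alpha> \<le> 1\<close> only; \<open>\<rho> = 1 / \<alpha> - 1\<close> is the inverse of \<open>\<alpha> = 1 / (1 + \<rho>)\<close>.\<close>

definition alpha_mutual_info :: "real \<Rightarrow> real \<Rightarrow> 'a pmf \<Rightarrow> ('a \<Rightarrow> 'b pmf) \<Rightarrow> ereal" where
  "alpha_mutual_info b \<alpha> P W =
     (if \<alpha> = 1 then mutual_info b P W
      else ereal (gallager_E0 b (1 / \<alpha> - 1) P W / (1 / \<alpha> - 1)))"

definition cond_prob_fst :: "('u \<times> 'v) pmf \<Rightarrow> 'u \<Rightarrow> 'v \<Rightarrow> real" where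
  "cond_prob_fst J u v = pmf J (u, v) / pmf (map_pmf snd J) v"

text \<open>
  The conditional entropy \<open>H\<^sub>\<alpha>(U|V)\<close> for \<open>(U, V)\<close> distributed according to \<open>J\<close>.  It is applied
  only where \<open>U\<close> takes finitely many values, so that all sums and expectations exist.
\<close>

definition arimoto_renyi :: "real \<Rightarrow> real \<Rightarrow> ('u \<times> 'v) pmf \<Rightarrow> real" where
  "arimoto_renyi b \<alpha> J =
     (if \<alpha> = 1 then
        measure_pmf.expectation (map_pmf snd J)
          (\<lambda>v. - (\<Sum>\<^sub>\<infinity>u. cond_prob_fst J u v * log b (cond_prob_fst J u v)))
      else
        \<alpha> / (1 - \<alpha>) * log b (measure_pmf.expectation (map_pmf snd J)
          (\<lambda>v. (\<Sum>\<^sub>\<infinity>u. cond_prob_fst J u v powr \<alpha>) powr (1 / \<alpha>))))"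


subsection \<open>The random coding ensemble\<close>

text \<open>Words of length \<open>n\<close> are functions on \<open>{..<n}\<close>, constantly \<open>undefined\<close> elsewhere.\<close>

definition iid_pmf :: "nat \<Rightarrow> 'a pmf \<Rightarrow> (nat \<Rightarrow> 'a) pmf" where
  "iid_pmf n P = Pi_pmf {..<n} undefined (\<lambda>_. P)"

definition memoryless :: "nat \<Rightarrow> ('a \<Rightarrow> 'b pmf) \<Rightarrow> (nat \<Rightarrow> 'a) \<Rightarrow> (nat \<Rightarrow> 'b) pmf" where
  "memoryless n W x = Pi_pmf {..<n} undefined (\<lambda>i. W (x i))"

text \<open>\<open>exp (nR)\<close> rounded up to an integer.\<close>

definition code_size :: "real \<Rightarrow> real \<Rightarrow> nat \<Rightarrow> nat" where
  "code_size b R n = nat \<lceil>b powr (real n * R)\<rceil>"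

definition codebook_pmf :: "nat \<Rightarrow> nat \<Rightarrow> 'a pmf \<Rightarrow> (nat \<Rightarrow> nat \<Rightarrow> 'a) pmf" where
  "codebook_pmf n M P = Pi_pmf {..<M} undefined (\<lambda>_. iid_pmf n P)"

text \<open>
  The law of \<open>(X\<^sup>n, Y\<^sup>n)\<close> for a fixed codebook \<open>c\<close>.  The first component is the transmitted word
  itself and not the message: messages with identical codewords are merged.
\<close>

definition code_joint_pmf ::
    "nat \<Rightarrow> nat \<Rightarrow> ('a \<Rightarrow> 'b pmf) \<Rightarrow> (nat \<Rightarrow> nat \<Rightarrow> 'a) \<Rightarrow> ((nat \<Rightarrow> 'a) \<times> (nat \<Rightarrow> 'b)) pmf" where
  "code_joint_pmf n M W c = joint_pmf (map_pmf c (pmf_of_set {..<M})) (memoryless n W)"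

definition ensemble_entropy ::
    "real \<Rightarrow> real \<Rightarrow> real \<Rightarrow> 'a pmf \<Rightarrow> ('a \<Rightarrow> 'b pmf) \<Rightarrow> nat \<Rightarrow> real" where
  "ensemble_entropy b \<alpha> R P W n =
     measure_pmf.expectation (codebook_pmf n (code_size b R n) P)
       (\<lambda>c. arimoto_renyi b \<alpha> (code_joint_pmf n (code_size b R n) W c))"

text \<open>
  This is \<open>\<infinity>\<close> when the expectation vanishes, which happens for \<open>n, R > 0\<close> exactly when distinct
  letters in the support of \<open>P\<close> have disjoint sets of possible outputs, so that every \<open>Y\<^sup>n\<close>
  determines \<open>X\<^sup>n\<close>.
\<close>

definition entropy_exponent ::
    "real \<Rightarrow> real \<Rightarrow> real \<Rightarrow> 'a pmf \<Rightarrow> ('a \<Rightarrow> 'b pmf) \<Rightarrow> nat \<Rightarrow> ereal" where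
  "entropy_exponent b \<alpha> R P W n =
     - (ereal (1 / real n) * elog b (ensemble_entropy b \<alpha> R P W n))"


subsection \<open>Error exponents\<close>

definition random_coding_exponent :: "real \<Rightarrow> real \<Rightarrow> 'a pmf \<Rightarrow> ('a \<Rightarrow> 'b pmf) \<Rightarrow> ereal" where
  "random_coding_exponent b R P W =
     (SUP \<rho>\<in>{0..1}. ereal \<rho> * (alpha_mutual_info b (1 / (1 + \<rho>)) P W - ereal R))"

definition sphere_packing_exponent :: "real \<Rightarrow> real \<Rightarrow> ('a \<Rightarrow> 'b pmf) \<Rightarrow> ereal" where
  "sphere_packing_exponent b R W =
     (SUP \<rho>\<in>{0..}. ereal \<rho> * ((SUP Q. alpha_mutual_info b (1 / (1 + \<rho>)) Q W) - ereal R))"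

definition is_critical_rate ::
    "real \<Rightarrow> real \<Rightarrow> 'a pmf \<Rightarrow> ('a \<Rightarrow> 'b pmf) \<Rightarrow> real \<Rightarrow> bool" where
  "is_critical_rate b \<alpha> P W r \<longleftrightarrow>
     0 < r \<and> ereal r < mutual_info b P W \<and>
     random_coding_exponent b r P W = ereal ((1 / \<alpha> - 1) * r)"

definition critical_rate :: "real \<Rightarrow> real \<Rightarrow> 'a pmf \<Rightarrow> ('a \<Rightarrow> 'b pmf) \<Rightarrow> real" where
  "critical_rate b \<alpha> P W = (THE r. is_critical_rate b \<alpha> P W r)"

end

theory Submission
  imports Defs
begin

text \<open>
  Everything passes through the posterior loss \<open>E[1 - P(u|v)]\<close>: the conditional entropy of every
  order is at least a constant times the loss, and for \<open>\<alpha> < 1\<close> it is at most a constant times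
  \<open>T\<^sup>\<alpha> + T\<close>, where \<open>T\<close> is the loss times \<open>M\<^sup>(\<^sup>1\<^sup>-\<^sup>\<alpha>\<^sup>)\<^sup>/\<^sup>\<alpha>\<close>.  Gallager's argument bounds the average loss of
  the random code from above by \<open>M\<^sup>\<rho> b powr (- n E\<^sub>0(\<rho>))\<close>, which gives the second part of the theorem.

  The first part holds even with \<open>E\<^sub>r(R, P)\<close> in place of \<open>E\<^sub>s\<^sub>p(R)\<close>, because the random coding bound is tight
  for the average code.  A fresh codeword that differs from the transmitted one and is at least as
  likely is found with the required probability after a change of measure, on finite subalphabets,
  to a tilted law under which the transmitted and the competing word are exchangeable; the law of
  large numbers controls the densities.  The nonvanishing entropy provides \<open>R > 0\<close> and two letters
  with a common output.

  Finally \<open>E\<^sub>r(\<cdot>, P)\<close> is continuous, decreasing, and positive exactly below \<open>I(P, P\<^sub>Y\<^sub>|\<^sub>X)\<close>, so it crosses the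
  line \<open>(1/\<alpha> - 1) r\<close> once, and the crossing point moves monotonically and continuously with \<open>\<alpha>\<close>.
\<close>

subsection \<open>Posterior loss and conditional entropy\<close>

text \<open>The loss is a plain average of likelihood fractions, so over a random code it can be
  computed by drawing the transmitted word, then the output, then the remaining words; a power of it
  cannot be averaged that way. Nonlinear expressions are therefore replaced by tangents, which are
  affine. With the point of contact at the mean, or at a bound for it, they give what Jensen's
  inequality would give. The lower bound is a second moment estimate in which 1 / (1 + number of
  competitors) is also bounded by a tangent. There \<rho> comes from the intermediate value theorem,
  applied to the tilted rate on a finite subalphabet. The subalphabet is thus fixed before \<rho>,
  and has to approximate the Gallager sum for all \<rho> in [0, 1] at once. Countable alphabets also
  admit I = \<infinity>, so the slope of E_0 at 0 is bounded below through sums over finitely many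
  output letters.\<close>

lemma powr_le_tangent:
  fixes x r :: real
  assumes "0 \<le> r" "r \<le> 1" "0 \<le> x"
  shows "x powr r \<le> 1 + r * (x - 1)"
proof (cases "x = 0")
  case False
  then show ?thesis
    using Youngs_inequality_0[of r "1 - r" x 1] assms by (simp add: algebra_simps)
qed (use assms in auto)

lemma powr_ge_tangent:
  fixes x r :: real
  assumes "1 \<le> r" "0 \<le> x"
  shows "1 + r * (x - 1) \<le> x powr r"
proof -
  have "(x powr r) powr (1 / r) \<le> 1 + 1 / r * (x powr r - 1)"
    by (rule powr_le_tangent) (use assms in auto)
  moreover have "(x powr r) powr (1 / r) = x"
    using assms by (simp add: powr_powr)
  ultimately have "r * x \<le> r * (1 + 1 / r * (x powr r - 1))"
    using assms by (intro mult_left_mono) auto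
  then show ?thesis using assms by (simp add: algebra_simps)
qed

lemma powr_neg_ge_tangent:
  fixes x r :: real
  assumes "r \<le> 0" "0 < x"
  shows "1 + r * (x - 1) \<le> x powr r"
proof -
  have "ln x \<le> x - 1" by (rule ln_le_minus_one[OF assms(2)])
  then have "1 + r * (x - 1) \<le> 1 + r * ln x"
    using assms by (simp add: mult_left_mono_neg)
  also have "\<dots> \<le> exp (r * ln x)" by (rule exp_ge_add_one_self)
  finally show ?thesis using assms by (simp add: powr_def)
qed

text \<open>The right-hand side is the tangent of t powr r at T. Averaged over x with mean T it
  collapses to T powr r, which is how concavity is used below.\<close>

lemma powr_le_scaled_tangent:
  fixes x r T :: real
  assumes "0 \<le> r" "r \<le> 1" "0 \<le> x" "0 < T"
  shows "x powr r \<le> (1 - r) * T powr r + r * T powr (r - 1) * x"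
proof -
  have "(x / T) powr r \<le> 1 + r * (x / T - 1)"
    by (rule powr_le_tangent) (use assms in auto)
  then have "(x / T) powr r * T powr r \<le> (1 + r * (x / T - 1)) * T powr r"
    by (rule mult_right_mono) simp
  also have "(x / T) powr r * T powr r = x powr r"
    using assms by (simp add: powr_divide)
  also have "(1 + r * (x / T - 1)) * T powr r = (1 - r) * T powr r + r * (T powr r / T) * x"
    using assms by (simp add: algebra_simps)
  also have "T powr r / T = T powr (r - 1)"
    using assms by (simp add: powr_diff)
  finally show ?thesis .
qed

text \<open>This is the error probability of a decoder that draws its guess from the posterior law.
  No maximum over codewords occurs in it, and it is linear in the posterior once the pair is
  averaged.\<close>

definition posterior_loss :: "('u \<times> 'v) pmf \<Rightarrow> real" where
  "posterior_loss J = measure_pmf.expectation J (\<lambda>(u, v). 1 - cond_prob_fst J u v)"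

lemma cond_prob_fst_nonneg [simp]: "0 \<le> cond_prob_fst J u v"
  by (simp add: cond_prob_fst_def)

lemma pmf_le_pmf_snd: "pmf J (u, v) \<le> pmf (map_pmf snd J) v"
  by (simp add: pmf_map measure_pmf_single[symmetric] measure_pmf.finite_measure_mono)

lemma cond_prob_fst_le_1 [simp]: "cond_prob_fst J u v \<le> 1"
  using pmf_le_pmf_snd[of J u v]
  by (simp add: cond_prob_fst_def divide_le_eq_1 less_le)

lemma cond_prob_fst_eq_0:
  assumes "u \<notin> fst ` set_pmf J"
  shows "cond_prob_fst J u v = 0"
proof -
  have "pmf J (u, v) = 0" using assms by (force simp: set_pmf_iff)
  then show ?thesis by (simp add: cond_prob_fst_def)
qed

lemma pmf_snd_eq_sum:
  assumes "finite A" "fst ` set_pmf J \<subseteq> A"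
  shows "pmf (map_pmf snd J) v = (\<Sum>u\<in>A. pmf J (u, v))"
proof -
  have "pmf (map_pmf snd J) v = measure J (snd -` {v})" by (simp add: pmf_map)
  also have "\<dots> = measure J ((\<lambda>u. (u, v)) ` A)"
    by (rule measure_prob_cong_0) (use assms in \<open>force simp: set_pmf_iff image_iff\<close>)+
  also have "\<dots> = (\<Sum>z\<in>(\<lambda>u. (u, v)) ` A. pmf J z)"
    using assms by (simp add: measure_measure_pmf_finite)
  also have "\<dots> = (\<Sum>u\<in>A. pmf J (u, v))"
    by (subst sum.reindex) (auto simp: inj_on_def)
  finally show ?thesis .
qed

lemma sum_cond_prob_fst:
  assumes "finite A" "fst ` set_pmf J \<subseteq> A" "v \<in> set_pmf (map_pmf snd J)"
  shows "(\<Sum>u\<in>A. cond_prob_fst J u v) = 1"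
  using assms(3)[unfolded set_pmf_iff]
  by (simp add: cond_prob_fst_def flip: sum_divide_distrib pmf_snd_eq_sum[OF assms(1,2)])

lemma infsum_cond_prob_fst:
  fixes h :: "real \<Rightarrow> real"
  assumes "finite A" "fst ` set_pmf J \<subseteq> A" "h 0 = 0"
  shows "(\<Sum>\<^sub>\<infinity>u. h (cond_prob_fst J u v)) = (\<Sum>u\<in>A. h (cond_prob_fst J u v))"
proof -
  have z: "cond_prob_fst J u v = 0" if "u \<notin> A" for u
    using that assms by (intro cond_prob_fst_eq_0) auto
  have "(\<Sum>\<^sub>\<infinity>u. h (cond_prob_fst J u v)) = (\<Sum>\<^sub>\<infinity>u\<in>A. h (cond_prob_fst J u v))"
    by (rule infsum_cong_neutral) (use assms z in auto)
  then show ?thesis using assms by simp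
qed

lemma integrable_pmf_bounded:
  fixes f :: "'x \<Rightarrow> real"
  assumes "\<And>x. x \<in> set_pmf p \<Longrightarrow> \<bar>f x\<bar> \<le> B"
  shows "integrable (measure_pmf p) f"
  by (rule measure_pmf.integrable_const_bound[where B = B]) (use assms in \<open>auto intro!: AE_pmfI\<close>)

lemma expectation_pmf_mono:
  fixes f g :: "'x \<Rightarrow> real"
  assumes "integrable (measure_pmf p) f" "integrable (measure_pmf p) g"
    and "\<And>x. x \<in> set_pmf p \<Longrightarrow> f x \<le> g x"
  shows "measure_pmf.expectation p f \<le> measure_pmf.expectation p g"
  by (rule integral_mono_AE) (use assms in \<open>auto intro!: AE_pmfI\<close>)

lemma expectation_pmf_cong:
  fixes f g :: "'x \<Rightarrow> real"
  assumes "\<And>x. x \<in> set_pmf p \<Longrightarrow> f x = g x"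
  shows "measure_pmf.expectation p f = measure_pmf.expectation p g"
  by (rule integral_cong_AE) (use assms in \<open>auto intro!: AE_pmfI\<close>)

text \<open>The joint weight is the output weight times the posterior, so summing over u first
  produces the sum of p (1 - p), and posteriors add up to 1. The computation is done with
  nonnegative extended integrals, where the order of summation is free.\<close>

lemma posterior_loss_eq:
  assumes "finite A" "fst ` set_pmf J \<subseteq> A"
  shows "posterior_loss J =
    measure_pmf.expectation (map_pmf snd J) (\<lambda>v. 1 - (\<Sum>u\<in>A. (cond_prob_fst J u v)\<^sup>2))"
proof -
  let ?c = "cond_prob_fst J" and ?V = "map_pmf snd J"
  \<comment> \<open>If the output weight is 0, the posterior is 0 by the convention for division,
    and the joint weight vanishes as well.\<close>
  have c_mult: "pmf ?V v * ?c u v = pmf J (u, v)" for u v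
    using pmf_le_pmf_snd[of J u v] by (auto simp: cond_prob_fst_def dest: antisym)
  have sq: "(\<Sum>u\<in>A. ?c u v * (1 - ?c u v)) = 1 - (\<Sum>u\<in>A. (?c u v)\<^sup>2)" if "v \<in> set_pmf ?V" for v
    using sum_cond_prob_fst[OF assms that]
    by (simp add: algebra_simps sum_subtractf power2_eq_square)
  have "(\<integral>\<^sup>+ z. ennreal (case z of (u, v) \<Rightarrow> 1 - ?c u v) \<partial>measure_pmf J)
      = (\<integral>\<^sup>+ z. ennreal (pmf J z * (case z of (u, v) \<Rightarrow> 1 - ?c u v)) \<partial>count_space UNIV)"
    by (subst nn_integral_measure_pmf) (auto simp: ennreal_mult' split: prod.splits)
  also have "\<dots> = (\<integral>\<^sup>+ v. \<integral>\<^sup>+ u. ennreal (pmf J (u, v) * (1 - ?c u v)) \<partial>count_space UNIV \<partial>count_space UNIV)"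
    by (subst nn_integral_snd_count_space[symmetric]) auto
  also have "\<dots> = (\<integral>\<^sup>+ v. \<integral>\<^sup>+ u. ennreal (pmf J (u, v) * (1 - ?c u v)) * indicator A u \<partial>count_space UNIV \<partial>count_space UNIV)"
  proof (intro nn_integral_cong)
    fix u v
    show "ennreal (pmf J (u, v) * (1 - ?c u v)) = ennreal (pmf J (u, v) * (1 - ?c u v)) * indicator A u"
      using assms by (auto simp: indicator_def set_pmf_iff) (metis fst_conv imageI set_pmf_iff subsetD)
  qed
  also have "\<dots> = (\<integral>\<^sup>+ v. ennreal (pmf ?V v) * ennreal (\<Sum>u\<in>A. ?c u v * (1 - ?c u v)) \<partial>count_space UNIV)"
  proof (intro nn_integral_cong)
    fix v
    have "(\<integral>\<^sup>+ u. ennreal (pmf J (u, v) * (1 - ?c u v)) * indicator A u \<partial>count_space UNIV)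
        = (\<Sum>u\<in>A. ennreal (pmf J (u, v) * (1 - ?c u v)))"
      using assms by (simp add: nn_integral_count_space_indicator[symmetric] nn_integral_count_space_finite)
    also have "\<dots> = ennreal (\<Sum>u\<in>A. pmf ?V v * (?c u v * (1 - ?c u v)))"
      by (subst sum_ennreal) (auto simp: c_mult mult.assoc[symmetric] intro!: sum.cong)
    also have "\<dots> = ennreal (pmf ?V v) * ennreal (\<Sum>u\<in>A. ?c u v * (1 - ?c u v))"
      by (simp add: sum_distrib_left[symmetric] ennreal_mult' sum_nonneg)
    finally show "(\<integral>\<^sup>+ u. ennreal (pmf J (u, v) * (1 - ?c u v)) * indicator A u \<partial>count_space UNIV) = \<dots>" .
  qed
  also have "\<dots> = (\<integral>\<^sup>+ v. ennreal (\<Sum>u\<in>A. ?c u v * (1 - ?c u v)) \<partial>measure_pmf ?V)"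
    by (rule nn_integral_measure_pmf[symmetric])
  also have "\<dots> = (\<integral>\<^sup>+ v. ennreal (1 - (\<Sum>u\<in>A. (?c u v)\<^sup>2)) \<partial>measure_pmf ?V)"
    by (rule nn_integral_cong_AE) (auto intro!: AE_pmfI simp: sq)
  finally have eq: "(\<integral>\<^sup>+ z. ennreal (case z of (u, v) \<Rightarrow> 1 - ?c u v) \<partial>measure_pmf J) =
      (\<integral>\<^sup>+ v. ennreal (1 - (\<Sum>u\<in>A. (?c u v)\<^sup>2)) \<partial>measure_pmf ?V)" .
  have le1: "(\<Sum>u\<in>A. (?c u v)\<^sup>2) \<le> 1" if "v \<in> set_pmf ?V" for v
  proof -
    have "0 \<le> (\<Sum>u\<in>A. ?c u v * (1 - ?c u v))" by (intro sum_nonneg) simp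
    then show ?thesis using sq[OF that] by simp
  qed
  show ?thesis
    unfolding posterior_loss_def
    by (subst (1 2) integral_eq_nn_integral)
       (use eq in \<open>auto intro!: AE_pmfI le1 split: prod.splits\<close>)
qed

lemma posterior_loss_nonneg: "0 \<le> posterior_loss J"
  unfolding posterior_loss_def by (rule Bochner_Integration.integral_nonneg) (auto split: prod.splits)

lemma posterior_loss_le_1: "posterior_loss J \<le> 1"
proof -
  have "posterior_loss J \<le> measure_pmf.expectation J (\<lambda>_. 1)"
    unfolding posterior_loss_def
    by (rule expectation_pmf_mono) (auto intro!: integrable_pmf_bounded[where B = 1] split: prod.splits)
  then show ?thesis by simp
qed


section \<open>Power sums of a single posterior compared with 1 - sum of squares\<close>

text \<open>Write p powr \<alpha> as p times p powr (\<alpha> - 1) and use the tangent at p = 1 of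
  the second factor, whose exponent is negative. The outer exponent 1 / \<alpha> exceeds 1 and can
  only increase a number that is at least 1.\<close>

lemma sum_powr_root_ge:
  fixes p :: "'u \<Rightarrow> real"
  assumes "0 < \<alpha>" "\<alpha> < 1" "\<And>u. u \<in> A \<Longrightarrow> 0 \<le> p u" "(\<Sum>u\<in>A. p u) = 1"
  shows "1 + (1 - \<alpha>) * (1 - (\<Sum>u\<in>A. (p u)\<^sup>2)) \<le> (\<Sum>u\<in>A. p u powr \<alpha>) powr (1 / \<alpha>)"
proof -
  let ?d = "1 - (\<Sum>u\<in>A. (p u)\<^sup>2)"
  have fin: "finite A" using assms(4) by (metis sum.infinite zero_neq_one)
  have le1: "p u \<le> 1" if "u \<in> A" for u
    using member_le_sum[of u A p] that assms fin by auto
  have d0: "0 \<le> ?d"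
  proof -
    have "(\<Sum>u\<in>A. (p u)\<^sup>2) \<le> (\<Sum>u\<in>A. p u)"
      using assms le1 by (intro sum_mono) (auto simp: power2_eq_square mult_left_le)
    then show ?thesis using assms by simp
  qed
  have "p u + (1 - \<alpha>) * (p u - (p u)\<^sup>2) \<le> p u powr \<alpha>" if "u \<in> A" for u
  proof (cases "p u = 0")
    case False
    then have pos: "0 < p u" using assms(3)[OF that] by simp
    have "1 + (\<alpha> - 1) * (p u - 1) \<le> p u powr (\<alpha> - 1)"
      by (rule powr_neg_ge_tangent) (use assms pos in auto)
    then have "p u * (1 + (\<alpha> - 1) * (p u - 1)) \<le> p u * p u powr (\<alpha> - 1)"
      using pos by (intro mult_left_mono) auto
    also have "p u * p u powr (\<alpha> - 1) = p u powr \<alpha>"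
      using pos by (simp add: powr_diff)
    finally show ?thesis by (simp add: algebra_simps power2_eq_square)
  qed auto
  then have "(\<Sum>u\<in>A. p u + (1 - \<alpha>) * (p u - (p u)\<^sup>2)) \<le> (\<Sum>u\<in>A. p u powr \<alpha>)"
    by (rule sum_mono)
  then have 1: "1 + (1 - \<alpha>) * ?d \<le> (\<Sum>u\<in>A. p u powr \<alpha>)"
    using assms(4) by (simp add: sum.distrib sum_subtractf flip: sum_distrib_left)
  have ge1: "1 \<le> 1 + (1 - \<alpha>) * ?d" using d0 assms by simp
  have "(1 + (1 - \<alpha>) * ?d) powr 1 \<le> (1 + (1 - \<alpha>) * ?d) powr (1 / \<alpha>)"
    using ge1 assms by (intro powr_mono) auto
  also have "\<dots> \<le> (\<Sum>u\<in>A. p u powr \<alpha>) powr (1 / \<alpha>)"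
    using 1 ge1 assms by (intro powr_mono2) auto
  finally show ?thesis using ge1 by simp
qed

text \<open>Here the tangent of p powr (\<alpha> - 1) at 1 has to lie above, which requires an
  exponent in [0, 1]. As p \<le> 1, the exponent may first be lowered to min 1 (\<alpha> - 1); this
  is where the minimum comes from.\<close>

lemma sum_powr_root_le:
  fixes p :: "'u \<Rightarrow> real"
  assumes "1 < \<alpha>" "\<And>u. u \<in> A \<Longrightarrow> 0 \<le> p u" "(\<Sum>u\<in>A. p u) = 1"
  shows "(\<Sum>u\<in>A. p u powr \<alpha>) powr (1 / \<alpha>) \<le> 1 - min 1 (\<alpha> - 1) / \<alpha> * (1 - (\<Sum>u\<in>A. (p u)\<^sup>2))"
proof -
  let ?d = "1 - (\<Sum>u\<in>A. (p u)\<^sup>2)" and ?c = "min 1 (\<alpha> - 1)"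
  have fin: "finite A" using assms(3) by (metis sum.infinite zero_neq_one)
  have le1: "p u \<le> 1" if "u \<in> A" for u
    using member_le_sum[of u A p] that assms fin by auto
  have "p u powr \<alpha> \<le> p u - ?c * (p u - (p u)\<^sup>2)" if "u \<in> A" for u
  proof (cases "p u = 0")
    case False
    then have pos: "0 < p u" using assms(2)[OF that] by simp
    have "p u powr (\<alpha> - 1) \<le> p u powr ?c"
      using pos le1[OF that] by (intro powr_mono') auto
    also have "\<dots> \<le> 1 + ?c * (p u - 1)"
      by (rule powr_le_tangent) (use assms pos in auto)
    finally have "p u * p u powr (\<alpha> - 1) \<le> p u * (1 + ?c * (p u - 1))"
      using pos by (intro mult_left_mono) auto
    moreover have "p u * p u powr (\<alpha> - 1) = p u powr \<alpha>"
      using pos by (simp add: powr_diff)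
    ultimately show ?thesis by (simp add: algebra_simps power2_eq_square)
  qed auto
  then have "(\<Sum>u\<in>A. p u powr \<alpha>) \<le> (\<Sum>u\<in>A. p u - ?c * (p u - (p u)\<^sup>2))"
    by (rule sum_mono)
  then have 1: "(\<Sum>u\<in>A. p u powr \<alpha>) \<le> 1 - ?c * ?d"
    using assms(3) by (simp add: sum.distrib sum_subtractf flip: sum_distrib_left)
  have 2: "0 \<le> (\<Sum>u\<in>A. p u powr \<alpha>)" by (intro sum_nonneg) simp
  have "(\<Sum>u\<in>A. p u powr \<alpha>) powr (1 / \<alpha>) \<le> (1 - ?c * ?d) powr (1 / \<alpha>)"
    using 1 2 assms by (intro powr_mono2) auto
  also have "\<dots> \<le> 1 + 1 / \<alpha> * (1 - ?c * ?d - 1)"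
    by (rule powr_le_tangent) (use 1 2 assms in auto)
  finally show ?thesis by (simp add: algebra_simps)
qed

lemma shannon_ge:
  fixes p :: "'u \<Rightarrow> real"
  assumes "1 < b" "\<And>u. u \<in> A \<Longrightarrow> 0 \<le> p u" "(\<Sum>u\<in>A. p u) = 1"
  shows "(1 - (\<Sum>u\<in>A. (p u)\<^sup>2)) / ln b \<le> - (\<Sum>u\<in>A. p u * log b (p u))"
proof -
  have "p u * ln (p u) \<le> (p u)\<^sup>2 - p u" if "u \<in> A" for u
  proof (cases "p u = 0")
    case False
    then have pos: "0 < p u" using assms(2)[OF that] by simp
    have "p u * ln (p u) \<le> p u * (p u - 1)"
      using pos ln_le_minus_one[OF pos] by (intro mult_left_mono) auto
    then show ?thesis by (simp add: power2_eq_square algebra_simps)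
  qed auto
  then have "(\<Sum>u\<in>A. p u * ln (p u)) \<le> (\<Sum>u\<in>A. (p u)\<^sup>2 - p u)" by (rule sum_mono)
  then have "1 - (\<Sum>u\<in>A. (p u)\<^sup>2) \<le> - (\<Sum>u\<in>A. p u * ln (p u))"
    using assms(3) by (simp add: sum_subtractf)
  then have "(1 - (\<Sum>u\<in>A. (p u)\<^sup>2)) / ln b \<le> - (\<Sum>u\<in>A. p u * ln (p u)) / ln b"
    using assms(1) by (intro divide_right_mono) auto
  then show ?thesis by (simp add: log_def sum_divide_distrib)
qed

text \<open>Split off a most likely letter m. The remaining mass S is at most the loss, and at most
  M letters of total mass S have power sum at most M powr (1 - \<alpha>) * S powr \<alpha>. The
  scaling in t is chosen so that this quantity is at most t powr \<alpha>; it remains to expand (1 +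
  t powr \<alpha>) powr (1 / \<alpha>).\<close>

lemma sum_powr_root_le_loss:
  fixes p :: "'u \<Rightarrow> real" and M :: real
  assumes "0 < \<alpha>" "\<alpha> < 1" "\<And>u. u \<in> A \<Longrightarrow> 0 \<le> p u" "(\<Sum>u\<in>A. p u) = 1" "card A \<le> M"
  defines "t \<equiv> M powr ((1 - \<alpha>) / \<alpha>) * (1 - (\<Sum>u\<in>A. (p u)\<^sup>2))"
  shows "(\<Sum>u\<in>A. p u powr \<alpha>) powr (1 / \<alpha>) \<le> 1 + 2 powr (1 / \<alpha>) / \<alpha> * (t powr \<alpha> + t)"
proof -
  have fin: "finite A" using assms(4) by (metis sum.infinite zero_neq_one)
  have ne: "A \<noteq> {}" using assms(4) by auto
  have Mpos: "0 < M" using ne fin assms(5) card_gt_0_iff[of A] by linarith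
  let ?d = "1 - (\<Sum>u\<in>A. (p u)\<^sup>2)"
  obtain m where m: "m \<in> A" "\<And>u. u \<in> A \<Longrightarrow> p u \<le> p m"
  proof -
    have "Max (p ` A) \<in> p ` A" using fin ne by (intro Max_in) auto
    then obtain m where "m \<in> A" "Max (p ` A) = p m" by auto
    then show ?thesis using that[of m] Max_ge[of "p ` A"] fin by auto
  qed
  define S where "S = 1 - p m"
  have S_eq: "(\<Sum>u\<in>A - {m}. p u) = S"
    using assms(4) fin m(1) by (simp add: S_def sum_diff1)
  have S0: "0 \<le> S" unfolding S_eq[symmetric] by (intro sum_nonneg) (use assms in auto)
  \<comment> \<open>The sum of squares is at most the largest probability, hence S is bounded by the
    loss.\<close>
  have "(\<Sum>u\<in>A. (p u)\<^sup>2) \<le> (\<Sum>u\<in>A. p m * p u)"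
    using assms m by (intro sum_mono) (auto simp: power2_eq_square intro: mult_right_mono)
  then have Sd: "S \<le> ?d" using assms(4) by (simp add: S_def flip: sum_distrib_left)
  have t0: "0 \<le> t" using Sd S0 by (simp add: t_def)
  have rest: "(\<Sum>u\<in>A - {m}. p u powr \<alpha>) \<le> M powr (1 - \<alpha>) * S powr \<alpha>"
  proof (cases "S = 0")
    case True
    then have "\<forall>u\<in>A - {m}. p u = 0"
      using S_eq assms(3) fin by (subst sum_nonneg_eq_0_iff[symmetric]) auto
    then show ?thesis using True by simp
  next
    case False
    then have Spos: "0 < S" using S0 by simp
    \<comment> \<open>The power sum is largest when S is spread evenly over M letters, so the
      tangent is taken at the common value S / M.\<close>
    define T where "T = S / M"
    have Tpos: "0 < T" using Spos Mpos by (simp add: T_def)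
    have "(\<Sum>u\<in>A - {m}. p u powr \<alpha>) \<le> (\<Sum>u\<in>A - {m}. (1 - \<alpha>) * T powr \<alpha> + \<alpha> * T powr (\<alpha> - 1) * p u)"
      by (intro sum_mono powr_le_scaled_tangent) (use assms Tpos in auto)
    also have "\<dots> = card (A - {m}) * ((1 - \<alpha>) * T powr \<alpha>) + \<alpha> * T powr (\<alpha> - 1) * S"
      by (simp add: sum.distrib S_eq flip: sum_distrib_left)
    also have "\<dots> \<le> M * ((1 - \<alpha>) * T powr \<alpha>) + \<alpha> * T powr (\<alpha> - 1) * S"
      using assms card_Diff1_le[of A m] by (intro add_right_mono mult_right_mono) auto
    also have "T powr (\<alpha> - 1) * S = M * T powr \<alpha>"
      using Spos Mpos by (simp add: T_def powr_diff)
    then have "M * ((1 - \<alpha>) * T powr \<alpha>) + \<alpha> * T powr (\<alpha> - 1) * S = M * T powr \<alpha>"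
      by (simp add: algebra_simps)
    also have "\<dots> = M powr (1 - \<alpha>) * S powr \<alpha>"
      using Mpos Spos by (simp add: T_def powr_divide powr_diff)
    finally show ?thesis .
  qed
  have "(\<Sum>u\<in>A. p u powr \<alpha>) = p m powr \<alpha> + (\<Sum>u\<in>A - {m}. p u powr \<alpha>)"
    using fin m(1) by (rule sum.remove)
  also have "\<dots> \<le> 1 + M powr (1 - \<alpha>) * S powr \<alpha>"
    using rest assms m(1) S0 by (intro add_mono) (auto simp: S_def intro!: powr_le1)
  also have "\<dots> \<le> 1 + M powr (1 - \<alpha>) * ?d powr \<alpha>"
    using Sd S0 assms by (intro add_left_mono mult_left_mono powr_mono2) auto
  also have "M powr (1 - \<alpha>) * ?d powr \<alpha> = t powr \<alpha>"
    using assms Sd S0 Mpos by (simp add: t_def powr_mult powr_powr)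
  finally have X: "(\<Sum>u\<in>A. p u powr \<alpha>) \<le> 1 + t powr \<alpha>" .
  define \<beta> where "\<beta> = 1 / \<alpha>"
  have \<beta>: "1 \<le> \<beta>" using assms by (simp add: \<beta>_def)
  have "(\<Sum>u\<in>A. p u powr \<alpha>) powr \<beta> \<le> (1 + t powr \<alpha>) powr \<beta>"
    using X \<beta> by (intro powr_mono2) (auto intro: sum_nonneg)
  also have "\<dots> \<le> 1 + 2 powr \<beta> * \<beta> * (t powr \<alpha> + t)"
  proof (cases "t \<le> 1")
    case True
    let ?y = "1 + t powr \<alpha>"
    have y: "1 \<le> ?y" "?y \<le> 2" using True t0 assms by (auto intro!: powr_le1)
    \<comment> \<open>Applying the tangent to 1 / y instead of y reverses it: after multiplication
      by y powr \<beta> it bounds y powr \<beta> - 1 from above.\<close>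
    have "1 + \<beta> * (1 / ?y - 1) \<le> (1 / ?y) powr \<beta>"
      by (rule powr_ge_tangent) (use \<beta> y in auto)
    then have "(1 + \<beta> * (1 / ?y - 1)) * ?y powr \<beta> \<le> (1 / ?y) powr \<beta> * ?y powr \<beta>"
      by (rule mult_right_mono) simp
    also have "(1 / ?y) powr \<beta> * ?y powr \<beta> = 1"
    proof -
      have "?y \<noteq> 0" using y by linarith
      moreover have "1 / z * z = 1" if "z \<noteq> 0" for z :: real using that by simp
      ultimately have "1 / ?y * ?y = 1" by blast
      then show ?thesis by (simp only: powr_mult[symmetric] powr_one_eq_one)
    qed
    finally have "?y powr \<beta> \<le> 1 + \<beta> * (1 - 1 / ?y) * ?y powr \<beta>"
      by (simp add: algebra_simps)
    also have "\<dots> \<le> 1 + \<beta> * (t powr \<alpha>) * 2 powr \<beta>"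
    proof -
      have "1 - 1 / ?y \<le> ?y - 1"
      proof -
        have "1 - 1 / z \<le> z - 1" if "1 \<le> z" for z :: real
          using divide_left_mono[of 1 z "z - 1"] that by (simp add: diff_divide_distrib)
        then show ?thesis using y by blast
      qed
      then have "1 - 1 / ?y \<le> t powr \<alpha>" by simp
      moreover have "0 \<le> 1 - 1 / ?y"
      proof -
        have "0 \<le> 1 - 1 / z" if "1 \<le> z" for z :: real using that by simp
        then show ?thesis using y by blast
      qed
      moreover have "?y powr \<beta> \<le> 2 powr \<beta>" using y \<beta> by (intro powr_mono2) auto
      ultimately show ?thesis using \<beta> y
        by (intro add_left_mono mult_mono mult_left_mono) (auto simp only: powr_ge_zero mult_nonneg_nonneg)
    qed
    also have "\<dots> \<le> 1 + 2 powr \<beta> * \<beta> * (t powr \<alpha> + t)"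
      using \<beta> t0 by (simp add: algebra_simps)
    finally show ?thesis .
  next
    case False
    \<comment> \<open>For t > 1 a crude doubling is enough, and the power 1 / \<alpha> turns t powr
      \<alpha> back into t. This case is the reason for the linear term in the bound.\<close>
    then have "1 \<le> t powr \<alpha>" using assms by (intro ge_one_powr_ge_zero) auto
    then have "(1 + t powr \<alpha>) powr \<beta> \<le> (2 * t powr \<alpha>) powr \<beta>"
      using \<beta> by (intro powr_mono2) auto
    also have "\<dots> = 2 powr \<beta> * t"
    proof -
      have "(t powr \<alpha>) powr \<beta> = t" using assms(1) t0 by (simp add: powr_powr \<beta>_def)
      then show ?thesis by (simp only: powr_mult)
    qed
    also have "\<dots> \<le> 2 powr \<beta> * \<beta> * (t powr \<alpha> + t)"
      using \<beta> t0 mult_mono[of 1 \<beta> t "t powr \<alpha> + t"] by (simp add: mult.assoc)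
    finally show ?thesis by simp
  qed
  finally show ?thesis by (simp add: \<beta>_def)
qed


lemma abs_loss_le: "\<bar>1 - (\<Sum>u\<in>A. (cond_prob_fst J u v)\<^sup>2)\<bar> \<le> 1 + card A"
proof -
  have "(\<Sum>u\<in>A. (cond_prob_fst J u v)\<^sup>2) \<le> of_nat (card A) * 1"
    by (intro sum_bounded_above) (simp add: power_le_one)
  moreover have "0 \<le> (\<Sum>u\<in>A. (cond_prob_fst J u v)\<^sup>2)" by (intro sum_nonneg) simp
  ultimately show ?thesis by simp
qed

lemma abs_sum_cond_prob_powr_le:
  assumes "0 < \<alpha>"
  shows "\<bar>(\<Sum>u\<in>A. cond_prob_fst J u v powr \<alpha>) powr (1 / \<alpha>)\<bar> \<le> card A powr (1 / \<alpha>)"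
proof -
  have "(\<Sum>u\<in>A. cond_prob_fst J u v powr \<alpha>) \<le> of_nat (card A) * 1"
    using assms by (intro sum_bounded_above powr_le1) auto
  then show ?thesis using assms by (auto intro!: powr_mono2 sum_nonneg)
qed

section \<open>Conditional entropy bounded below and above by the posterior loss\<close>

text \<open>The constant must be the same for all J, since the inequality is later averaged over the
  codebook. In each range of \<alpha> the corresponding pointwise inequality is averaged over the
  output first; the outer logarithm is linearised afterwards.\<close>

lemma posterior_loss_le_arimoto_renyi:
  assumes "1 < b" "0 < \<alpha>"
  obtains c where "0 < c"
    "\<And>J :: ('u \<times> 'v) pmf. finite (fst ` set_pmf J) \<Longrightarrow> c * posterior_loss J \<le> arimoto_renyi b \<alpha> J"
proof -
  have lnb: "0 < ln b" using assms by simp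
  consider "\<alpha> = 1" | "\<alpha> < 1" | "1 < \<alpha>" by linarith
  then show ?thesis
  proof cases
    case 1
    have "1 / ln b * posterior_loss J \<le> arimoto_renyi b \<alpha> J" if fin: "finite (fst ` set_pmf J)"
      for J :: "('u \<times> 'v) pmf"
    proof -
      let ?A = "fst ` set_pmf J"
      have ub: "- (\<Sum>u\<in>?A. cond_prob_fst J u v * log b (cond_prob_fst J u v)) \<le> card ?A / ln b"
        and lb: "0 \<le> - (\<Sum>u\<in>?A. cond_prob_fst J u v * log b (cond_prob_fst J u v))" for v
      proof -
        have *: "0 \<le> - (x * log b x) \<and> - (x * log b x) \<le> 1 / ln b" if "0 \<le> x" "x \<le> 1" for x :: real
        proof (cases "x = 0")
          case False
          then have x: "0 < x" using that by simp
          have "ln (1 / x) \<le> 1 / x - 1" using x by (intro ln_le_minus_one) auto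
          then have "x * (- ln x) \<le> x * (1 / x)" using x
            by (intro mult_left_mono) (auto simp: ln_div)
          moreover have "0 \<le> x * (- ln x)" using x that by (intro mult_nonneg_nonneg) auto
          ultimately show ?thesis using lnb x by (auto simp: log_def divide_le_cancel field_simps)
        qed (use lnb in auto)
        show "0 \<le> - (\<Sum>u\<in>?A. cond_prob_fst J u v * log b (cond_prob_fst J u v))"
          unfolding sum_negf[symmetric] by (intro sum_nonneg) (use * in auto)
        show "- (\<Sum>u\<in>?A. cond_prob_fst J u v * log b (cond_prob_fst J u v)) \<le> card ?A / ln b"
          unfolding sum_negf[symmetric]
          by (rule order_trans[OF sum_bounded_above[where K = "1 / ln b"]]) (use * in auto)
      qed
      have "1 / ln b * posterior_loss J = measure_pmf.expectation (map_pmf snd J)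
          (\<lambda>v. 1 / ln b * (1 - (\<Sum>u\<in>?A. (cond_prob_fst J u v)\<^sup>2)))"
        by (subst posterior_loss_eq[OF fin]) simp_all
      also have "\<dots> \<le> measure_pmf.expectation (map_pmf snd J)
          (\<lambda>v. - (\<Sum>u\<in>?A. cond_prob_fst J u v * log b (cond_prob_fst J u v)))"
      proof (rule expectation_pmf_mono)
        show "integrable (measure_pmf (map_pmf snd J)) (\<lambda>v. 1 / ln b * (1 - (\<Sum>u\<in>?A. (cond_prob_fst J u v)\<^sup>2)))"
          by (intro integrable_mult_right integrable_pmf_bounded[OF abs_loss_le])
        show "integrable (measure_pmf (map_pmf snd J)) (\<lambda>v. - (\<Sum>u\<in>?A. cond_prob_fst J u v * log b (cond_prob_fst J u v)))"
          using ub lb by (intro integrable_pmf_bounded[where B = "card ?A / ln b"]) (simp only: abs_of_nonneg)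
        show "1 / ln b * (1 - (\<Sum>u\<in>?A. (cond_prob_fst J u v)\<^sup>2)) \<le>
            - (\<Sum>u\<in>?A. cond_prob_fst J u v * log b (cond_prob_fst J u v))"
          if "v \<in> set_pmf (map_pmf snd J)" for v
          using shannon_ge[OF assms(1), of ?A "\<lambda>u. cond_prob_fst J u v"]
            sum_cond_prob_fst[OF fin order_refl that] by simp
      qed
      also have "\<dots> = arimoto_renyi b \<alpha> J"
        unfolding arimoto_renyi_def using 1
        by (simp add: infsum_cond_prob_fst[OF fin order_refl, where h = "\<lambda>x. x * log b x"])
      finally show ?thesis .
    qed
    then show ?thesis using that[of "1 / ln b"] lnb by simp
  next
    case 2
    have "\<alpha> / (2 * ln b) * posterior_loss J \<le> arimoto_renyi b \<alpha> J" if fin: "finite (fst ` set_pmf J)"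
      for J :: "('u \<times> 'v) pmf"
    proof -
      let ?A = "fst ` set_pmf J" and ?l = "posterior_loss J"
      let ?X = "\<lambda>v. (\<Sum>u\<in>?A. cond_prob_fst J u v powr \<alpha>) powr (1 / \<alpha>)"
      let ?Z = "measure_pmf.expectation (map_pmf snd J) ?X"
      have X: "\<bar>?X v\<bar> \<le> card ?A powr (1 / \<alpha>)" for v
        by (rule abs_sum_cond_prob_powr_le) (use assms in simp)
      have d: "\<bar>1 - (\<Sum>u\<in>?A. (cond_prob_fst J u v)\<^sup>2)\<bar> \<le> 1 + card ?A" for v
    by (rule abs_loss_le)
      have "1 + (1 - \<alpha>) * ?l = measure_pmf.expectation (map_pmf snd J)
          (\<lambda>v. 1 + (1 - \<alpha>) * (1 - (\<Sum>u\<in>?A. (cond_prob_fst J u v)\<^sup>2)))"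
        by (subst posterior_loss_eq[OF fin])
           (simp, subst Bochner_Integration.integral_add, auto intro!: integrable_mult_right integrable_pmf_bounded d)
      also have "\<dots> \<le> ?Z"
      proof (rule expectation_pmf_mono)
        show "1 + (1 - \<alpha>) * (1 - (\<Sum>u\<in>?A. (cond_prob_fst J u v)\<^sup>2)) \<le> ?X v"
          if "v \<in> set_pmf (map_pmf snd J)" for v
          using sum_powr_root_ge[OF assms(2) 2, of ?A "\<lambda>u. cond_prob_fst J u v"]
            sum_cond_prob_fst[OF fin order_refl that] by simp
      qed (intro Bochner_Integration.integrable_add Bochner_Integration.integrable_diff integrable_mult_right
          measure_pmf.integrable_const integrable_pmf_bounded[OF X] integrable_pmf_bounded[OF d])+
      finally have Z: "1 + (1 - \<alpha>) * ?l \<le> ?Z" .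
      let ?x = "(1 - \<alpha>) * ?l"
      have x: "0 \<le> ?x" "?x \<le> 1"
        using 2 assms posterior_loss_nonneg[of J] posterior_loss_le_1[of J] by (auto intro: mult_le_one)
      \<comment> \<open>As x \<le> 1, ln (1 + x) \<ge> x / (1 + x) \<ge> x / 2; this costs the
        factor 2 in the constant.\<close>
      have "?x / 2 \<le> ?x / (1 + ?x)" using x by (intro divide_left_mono) auto
      also have "\<dots> = 1 - 1 / (1 + ?x)" using x by (simp add: field_simps)
      also have "\<dots> \<le> ln (1 + ?x)"
        using ln_le_minus_one[of "1 / (1 + ?x)"] x by (simp add: ln_div)
      also have "\<dots> \<le> ln ?Z" using Z x by (intro ln_mono) auto
      finally have "\<alpha> / (1 - \<alpha>) / ln b * (?x / 2) \<le> \<alpha> / (1 - \<alpha>) / ln b * ln ?Z"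
        using assms 2 lnb by (intro mult_left_mono) auto
      moreover have "\<alpha> / (1 - \<alpha>) / ln b * (?x / 2) = \<alpha> / (2 * ln b) * ?l"
      proof -
        have "x / e / l * (e * L / 2) = x / (2 * l) * L" if "e \<noteq> 0" for x e l L :: real
          using that by (simp add: field_simps)
        then show ?thesis using 2 by simp
      qed
      moreover have "\<alpha> / (1 - \<alpha>) / ln b * ln ?Z = arimoto_renyi b \<alpha> J"
        unfolding arimoto_renyi_def using 2 assms
        by (simp add: log_def infsum_cond_prob_fst[OF fin order_refl, where h = "\<lambda>x. x powr \<alpha>"])
      ultimately show ?thesis by (simp only:)
    qed
    then show ?thesis using that[of "\<alpha> / (2 * ln b)"] lnb assms by simp
  next
    case 3
    let ?c = "min 1 (\<alpha> - 1) / \<alpha>"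
    have c: "0 < ?c" "?c < 1" using 3 by (auto simp: min_def)
    have "\<alpha> / (\<alpha> - 1) / ln b * ?c * posterior_loss J \<le> arimoto_renyi b \<alpha> J" if fin: "finite (fst ` set_pmf J)"
      for J :: "('u \<times> 'v) pmf"
    proof -
      let ?A = "fst ` set_pmf J" and ?l = "posterior_loss J"
      let ?X = "\<lambda>v. (\<Sum>u\<in>?A. cond_prob_fst J u v powr \<alpha>) powr (1 / \<alpha>)"
      let ?Z = "measure_pmf.expectation (map_pmf snd J) ?X"
      have X: "\<bar>?X v\<bar> \<le> card ?A powr (1 / \<alpha>)" for v
        by (rule abs_sum_cond_prob_powr_le) (use assms in simp)
      have d: "\<bar>1 - (\<Sum>u\<in>?A. (cond_prob_fst J u v)\<^sup>2)\<bar> \<le> 1 + card ?A" for v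
    by (rule abs_loss_le)
      have "?Z \<le> measure_pmf.expectation (map_pmf snd J)
          (\<lambda>v. 1 - ?c * (1 - (\<Sum>u\<in>?A. (cond_prob_fst J u v)\<^sup>2)))"
      proof (rule expectation_pmf_mono)
        show "?X v \<le> 1 - ?c * (1 - (\<Sum>u\<in>?A. (cond_prob_fst J u v)\<^sup>2))"
          if "v \<in> set_pmf (map_pmf snd J)" for v
          using sum_powr_root_le[OF 3, of ?A "\<lambda>u. cond_prob_fst J u v"]
            sum_cond_prob_fst[OF fin order_refl that] by simp
      qed (intro Bochner_Integration.integrable_add Bochner_Integration.integrable_diff integrable_mult_right
          measure_pmf.integrable_const integrable_pmf_bounded[OF X] integrable_pmf_bounded[OF d])+
      also have "\<dots> = 1 - ?c * ?l"
      proof -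
        have "measure_pmf.expectation (map_pmf snd J) (\<lambda>v. 1 - x * (1 - (\<Sum>u\<in>?A. (cond_prob_fst J u v)\<^sup>2))) =
            1 - x * measure_pmf.expectation (map_pmf snd J) (\<lambda>v. 1 - (\<Sum>u\<in>?A. (cond_prob_fst J u v)\<^sup>2))" for x
          using integrable_pmf_bounded[of "map_pmf snd J" "\<lambda>v. 1 - (\<Sum>u\<in>?A. (cond_prob_fst J u v)\<^sup>2)", OF d]
          by (subst Bochner_Integration.integral_diff)
            (intro integrable_mult_right measure_pmf.integrable_const | assumption | simp del: integral_map_pmf)+
        then show ?thesis unfolding posterior_loss_eq[OF fin order_refl] .
      qed
      finally have Z: "?Z \<le> 1 - ?c * ?l" .
      have "?c * ?l \<le> ?c * 1" using c posterior_loss_le_1[of J] by (intro mult_left_mono) auto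
      \<comment> \<open>For \<alpha> > 1 the factor \<alpha> / (1 - \<alpha>) is negative, so an
        upper bound on ln Z is wanted, and ln Z \<le> Z - 1 presupposes Z > 0. A single atom of the
        output law already keeps Z away from 0.\<close>
      have Z0: "0 < ?Z"
      proof -
        obtain v where v: "v \<in> set_pmf (map_pmf snd J)" using set_pmf_not_empty[of "map_pmf snd J"] by blast
        have "?X v \<noteq> 0"
        proof
          assume "?X v = 0"
          then have "\<forall>u\<in>?A. cond_prob_fst J u v powr \<alpha> = 0"
            using fin by (simp add: sum_nonneg_eq_0_iff)
          then have "(\<Sum>u\<in>?A. cond_prob_fst J u v) = 0" by (intro sum.neutral) auto
          then show False using sum_cond_prob_fst[OF fin order_refl v] by simp
        qed
        then have "0 < pmf (map_pmf snd J) v * ?X v" using pmf_positive[OF v] by (intro mult_pos_pos) (auto simp: less_le)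
        also have "\<dots> = measure_pmf.expectation (map_pmf snd J) (\<lambda>w. ?X w * indicator {v} w)"
        proof -
          have "measure_pmf.expectation (map_pmf snd J) (\<lambda>w. ?X w * indicator {v} w) =
              measure_pmf.expectation (map_pmf snd J) (\<lambda>w. ?X v * indicator {v} w)"
            by (rule expectation_pmf_cong) (auto simp: indicator_def)
          then show ?thesis by (simp add: measure_pmf_single del: integral_map_pmf)
        qed
        also have "\<dots> \<le> ?Z"
          by (rule expectation_pmf_mono)
            (use X in \<open>auto intro!: integrable_pmf_bounded simp: indicator_def simp del: integrable_map_pmf_eq\<close>)
        finally show ?thesis .
      qed
      have "ln ?Z \<le> - (?c * ?l)" using ln_le_minus_one[OF Z0] Z by simp
      then have "\<alpha> / (\<alpha> - 1) / ln b * (?c * ?l) \<le> \<alpha> / (\<alpha> - 1) / ln b * (- ln ?Z)"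
        using 3 lnb by (intro mult_left_mono) auto
      moreover have "\<alpha> / (\<alpha> - 1) / ln b * (- ln ?Z) = arimoto_renyi b \<alpha> J"
      proof -
        have "x / e / l * (- z) = x / (- e) / l * z" for x e l z :: real by simp
        from this[of \<alpha> "\<alpha> - 1" "ln b" "ln ?Z"] show ?thesis
          using 3 by (simp add: arimoto_renyi_def log_def infsum_cond_prob_fst[OF fin order_refl, where h = "\<lambda>x. x powr \<alpha>"])
      qed
      ultimately show ?thesis by (simp only: mult.assoc)
    qed
    then show ?thesis using that[of "\<alpha> / (\<alpha> - 1) / ln b * ?c"] lnb 3 c by simp
  qed
qed

text \<open>The term t powr \<alpha> is replaced by its tangent at a free point T, which makes the
  bound affine in the loss. The point T is later set to a bound on the average of t over all
  codebooks, so it cannot depend on J.\<close>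

lemma arimoto_renyi_le_posterior_loss:
  fixes J :: "('u \<times> 'v) pmf" and M T :: real
  assumes b: "1 < b" and \<alpha>: "0 < \<alpha>" "\<alpha> < 1" and fin: "finite (fst ` set_pmf J)"
    and M: "card (fst ` set_pmf J) \<le> M" and T: "0 < T"
  shows "arimoto_renyi b \<alpha> J \<le> 2 powr (1 / \<alpha>) / ((1 - \<alpha>) * ln b) *
    ((1 - \<alpha>) * T powr \<alpha> + (\<alpha> * T powr (\<alpha> - 1) + 1) * (M powr ((1 - \<alpha>) / \<alpha>) * posterior_loss J))"
proof -
  let ?A = "fst ` set_pmf J" and ?l = "posterior_loss J"
  let ?X = "\<lambda>v. (\<Sum>u\<in>?A. cond_prob_fst J u v powr \<alpha>) powr (1 / \<alpha>)"
  let ?Z = "measure_pmf.expectation (map_pmf snd J) ?X"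
  let ?d = "\<lambda>v. 1 - (\<Sum>u\<in>?A. (cond_prob_fst J u v)\<^sup>2)"
  let ?M = "M powr ((1 - \<alpha>) / \<alpha>)" and ?C = "2 powr (1 / \<alpha>) / \<alpha>"
  let ?U = "\<lambda>v. (1 + ?C * ((1 - \<alpha>) * T powr \<alpha>)) + ?C * ((\<alpha> * T powr (\<alpha> - 1) + 1) * (?M * ?d v))"
  have lnb: "0 < ln b" using b by simp
  have X: "\<bar>?X v\<bar> \<le> card ?A powr (1 / \<alpha>)" for v
    by (rule abs_sum_cond_prob_powr_le) (use assms in simp)
  have d: "\<bar>?d v\<bar> \<le> 1 + card ?A" for v
    by (rule abs_loss_le)
  have XU: "1 \<le> ?X v \<and> ?X v \<le> ?U v" if v: "v \<in> set_pmf (map_pmf snd J)" for v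
  proof -
    let ?p = "\<lambda>u. cond_prob_fst J u v" and ?t = "?M * ?d v"
    note sum1 = sum_cond_prob_fst[OF fin order_refl v]
    have d0: "0 \<le> ?d v"
    proof -
      have "(\<Sum>u\<in>?A. (?p u)\<^sup>2) \<le> (\<Sum>u\<in>?A. ?p u)"
        by (intro sum_mono) (auto simp: power2_eq_square mult_left_le)
      then show ?thesis using sum1 by simp
    qed
    have "1 + (1 - \<alpha>) * ?d v \<le> ?X v"
      by (rule sum_powr_root_ge[OF \<alpha>]) (use sum1 in auto)
    then have 1: "1 \<le> ?X v" using d0 \<alpha> by (smt (verit) mult_nonneg_nonneg)
    have "?X v \<le> 1 + ?C * (?t powr \<alpha> + ?t)"
      by (rule sum_powr_root_le_loss[OF \<alpha>]) (use sum1 M in auto)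
    also have "\<dots> \<le> 1 + ?C * (((1 - \<alpha>) * T powr \<alpha> + \<alpha> * T powr (\<alpha> - 1) * ?t) + ?t)"
      using d0 \<alpha> T by (intro add_left_mono mult_left_mono add_right_mono powr_le_scaled_tangent) auto
    also have "\<dots> = ?U v"
    proof -
      have "1 + x * ((y + z * t) + t) = (1 + x * y) + x * ((z + 1) * t)" for x y z t :: real
        by (simp add: algebra_simps)
      then show ?thesis .
    qed
    finally show ?thesis using 1 by simp
  qed
  have intX: "integrable (measure_pmf (map_pmf snd J)) ?X"
    using X by (rule integrable_pmf_bounded)
  have intd: "integrable (measure_pmf (map_pmf snd J)) ?d"
    using d by (rule integrable_pmf_bounded)
  have lin: "measure_pmf.expectation (map_pmf snd J) (\<lambda>v. x + y * (z * (w * ?d v))) =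
      x + y * (z * (w * measure_pmf.expectation (map_pmf snd J) ?d))" for x y z w
    using intd by simp
  have "?Z \<le> measure_pmf.expectation (map_pmf snd J) ?U"
    using XU intX intd
    by (intro expectation_pmf_mono Bochner_Integration.integrable_add integrable_mult_right) auto
  also have "\<dots> = (1 + ?C * ((1 - \<alpha>) * T powr \<alpha>)) + ?C * ((\<alpha> * T powr (\<alpha> - 1) + 1) * (?M * ?l))"
    unfolding posterior_loss_eq[OF fin order_refl]
    by (rule lin)
  also have "\<dots> = 1 + ?C * ((1 - \<alpha>) * T powr \<alpha> + (\<alpha> * T powr (\<alpha> - 1) + 1) * (?M * ?l))"
    by (simp only: distrib_left add.assoc)
  finally have Z: "?Z - 1 \<le> ?C * ((1 - \<alpha>) * T powr \<alpha> + (\<alpha> * T powr (\<alpha> - 1) + 1) * (?M * ?l))"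
    by simp
  have "measure_pmf.expectation (map_pmf snd J) (\<lambda>_. 1) \<le> ?Z"
    using XU intX by (intro expectation_pmf_mono) auto
  then have Z1: "1 \<le> ?Z" by simp
  have "arimoto_renyi b \<alpha> J = \<alpha> / (1 - \<alpha>) / ln b * ln ?Z"
    unfolding arimoto_renyi_def using \<alpha>
    by (simp add: log_def infsum_cond_prob_fst[OF fin order_refl, where h = "\<lambda>x. x powr \<alpha>"])
  also have "\<dots> \<le> \<alpha> / (1 - \<alpha>) / ln b * (?C * ((1 - \<alpha>) * T powr \<alpha> + (\<alpha> * T powr (\<alpha> - 1) + 1) * (?M * ?l)))"
    using order_trans[OF ln_le_minus_one Z] Z1 \<alpha> lnb by (intro mult_left_mono) auto
  also have "\<dots> = \<alpha> / (1 - \<alpha>) / ln b * ?C * ((1 - \<alpha>) * T powr \<alpha> + (\<alpha> * T powr (\<alpha> - 1) + 1) * (?M * ?l))"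
    by (simp only: mult.assoc)
  also have "\<alpha> / (1 - \<alpha>) / ln b * ?C = 2 powr (1 / \<alpha>) / ((1 - \<alpha>) * ln b)"
    using \<alpha> by simp
  finally show ?thesis .
qed

subsection \<open>Expected loss of a random code\<close>

lemma expectation_bind_pmf:
  fixes f :: "'y \<Rightarrow> real"
  assumes "\<And>y. \<bar>f y\<bar> \<le> B"
  shows "measure_pmf.expectation (bind_pmf M N) f =
    measure_pmf.expectation M (\<lambda>x. measure_pmf.expectation (N x) f)"
  unfolding measure_pmf_bind
  by (rule integral_bind[where K = "count_space UNIV" and B = B and B' = 1])
     (use assms measurable_measure_pmf[of N] in \<open>auto intro!: AE_pmfI simp: measure_pmf.emeasure_space_1 measure_pmf.finite_measure_axioms\<close>)

lemma expectation_sum_indicator: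
  "measure_pmf.expectation p (\<lambda>y. \<Sum>t\<in>G. f t * indicator {h t} y) = (\<Sum>t\<in>G. f t * pmf p (h t) :: real)"
proof -
  have "measure_pmf.expectation p (\<lambda>y. \<Sum>t\<in>G. f t * indicator {h t} y) =
      (\<Sum>t\<in>G. measure_pmf.expectation p (\<lambda>y. f t * indicator {h t} y))"
    by (rule Bochner_Integration.integral_sum)
      (auto intro!: integrable_mult_right integrable_pmf_bounded[where B = 1] simp del: integrable_mult_right_iff)
  then show ?thesis by (simp add: measure_pmf_single)
qed

lemma pmf_joint_pmf: "pmf (joint_pmf P W) (u, v) = pmf P u * pmf (W u) v"
proof -
  have "pmf (map_pmf (Pair x) (W x)) (u, v) = indicator {u} x * pmf (W u) v" for x
  proof (cases "x = u")
    case True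
    then show ?thesis using pmf_map_inj'[of "Pair x" "W x" v] by (simp add: inj_on_def)
  next
    case False
    then show ?thesis by (subst pmf_map_outside) auto
  qed
  then show ?thesis
    unfolding joint_pmf_def by (simp add: pmf_bind measure_pmf_single)
qed

lemma map_snd_joint_pmf: "map_pmf snd (joint_pmf P W) = output_pmf P W"
  by (simp add: joint_pmf_def output_pmf_def map_bind_pmf pmf.map_comp o_def)

text \<open>Given y, the posterior of a word is its likelihood counted with multiplicity, divided by
  the total likelihood. What is left to other words is the sum over those messages whose codeword
  differs from the transmitted one; the prior 1 / M cancels.\<close>

lemma posterior_loss_code:
  fixes M :: nat
  assumes "0 < M"
  shows "posterior_loss (joint_pmf (map_pmf c (pmf_of_set {..<M})) K) =
    (\<Sum>m<M. measure_pmf.expectation (K (c m)) (\<lambda>y.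
      (\<Sum>j\<in>{j\<in>{..<M}. c j \<noteq> c m}. pmf (K (c j)) y) / (\<Sum>j<M. pmf (K (c j)) y))) / M"
proof -
  let ?U = "pmf_of_set {..<M}" and ?J = "joint_pmf (map_pmf c (pmf_of_set {..<M})) K"
  have M: "{..<M} \<noteq> {}" "finite {..<M}" using assms by auto
  have pu: "pmf (map_pmf c ?U) u = card {j\<in>{..<M}. c j = u} / M" for u
    using M assms by (simp add: pmf_map measure_pmf_of_set vimage_def Int_def)
  have pv: "pmf (map_pmf snd ?J) y = (\<Sum>j<M. pmf (K (c j)) y) / M" for y
    by (simp only: map_snd_joint_pmf output_pmf_def pmf_bind integral_map_pmf integral_pmf_of_set[OF M] card_lessThan)
  have cond: "1 - cond_prob_fst ?J (c m) y =
      (\<Sum>j\<in>{j\<in>{..<M}. c j \<noteq> c m}. pmf (K (c j)) y) / (\<Sum>j<M. pmf (K (c j)) y)"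
    if "m < M" "y \<in> set_pmf (K (c m))" for m y
  proof -
    let ?S = "\<Sum>j<M. pmf (K (c j)) y"
    have "pmf (K (c m)) y \<le> ?S" using that by (intro member_le_sum) auto
    then have S: "0 < ?S" using that by (meson less_le_trans pmf_positive)
    \<comment> \<open>Messages sharing the transmitted codeword all contribute its likelihood, and
      their number is exactly the multiplicity in the codeword law.\<close>
    have "?S = (\<Sum>j\<in>{j\<in>{..<M}. c j = c m}. pmf (K (c j)) y) + (\<Sum>j\<in>{j\<in>{..<M}. c j \<noteq> c m}. pmf (K (c j)) y)"
      by (subst sum.union_disjoint[symmetric]) (auto intro!: sum.cong)
    also have "(\<Sum>j\<in>{j\<in>{..<M}. c j = c m}. pmf (K (c j)) y) = card {j\<in>{..<M}. c j = c m} * pmf (K (c m)) y"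
      by simp
    finally have *: "?S = card {j\<in>{..<M}. c j = c m} * pmf (K (c m)) y + (\<Sum>j\<in>{j\<in>{..<M}. c j \<noteq> c m}. pmf (K (c j)) y)" .
    have "cond_prob_fst ?J (c m) y = card {j\<in>{..<M}. c j = c m} * pmf (K (c m)) y / ?S"
      unfolding cond_prob_fst_def pmf_joint_pmf pu pv using assms by simp
    then show ?thesis using S * by (simp add: field_simps)
  qed
  have "posterior_loss ?J = measure_pmf.expectation (map_pmf c ?U)
      (\<lambda>x. measure_pmf.expectation (K x) (\<lambda>y. 1 - cond_prob_fst ?J x y))"
    unfolding posterior_loss_def
    by (subst (1) joint_pmf_def, subst expectation_bind_pmf[where B = 1]) (auto split: prod.splits)
  also have "\<dots> = (\<Sum>m<M. measure_pmf.expectation (K (c m)) (\<lambda>y. 1 - cond_prob_fst ?J (c m) y)) / M"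
    using M by (simp add: integral_pmf_of_set)
  also have "(\<Sum>m<M. measure_pmf.expectation (K (c m)) (\<lambda>y. 1 - cond_prob_fst ?J (c m) y)) =
      (\<Sum>m<M. measure_pmf.expectation (K (c m)) (\<lambda>y.
      (\<Sum>j\<in>{j\<in>{..<M}. c j \<noteq> c m}. pmf (K (c j)) y) / (\<Sum>j<M. pmf (K (c j)) y)))"
    by (intro sum.cong refl expectation_pmf_cong cond) auto
  finally show ?thesis .
qed

text \<open>The posterior probability, given the output \<open>y\<close>, that the transmitted word differs from \<open>x\<close>, when
  \<open>x\<close> was sent and the words of the other messages are \<open>c j\<close> for \<open>j \<in> I\<close>.\<close>

definition confusion :: "('u \<Rightarrow> 'v pmf) \<Rightarrow> 'i set \<Rightarrow> 'u \<Rightarrow> 'v \<Rightarrow> ('i \<Rightarrow> 'u) \<Rightarrow> real" where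
  "confusion K I x y c = (\<Sum>j\<in>{j\<in>I. c j \<noteq> x}. pmf (K (c j)) y) / (pmf (K x) y + (\<Sum>j\<in>I. pmf (K (c j)) y))"

lemma confusion_bounds:
  assumes "finite I"
  shows "0 \<le> confusion K I x y c" "confusion K I x y c \<le> 1"
proof -
  have "(\<Sum>j\<in>{j\<in>I. c j \<noteq> x}. pmf (K (c j)) y) \<le> (\<Sum>j\<in>I. pmf (K (c j)) y)"
    using assms by (intro sum_mono2) auto
  also have "\<dots> \<le> pmf (K x) y + (\<Sum>j\<in>I. pmf (K (c j)) y)" by simp
  finally show "0 \<le> confusion K I x y c" "confusion K I x y c \<le> 1"
    by (auto simp: confusion_def sum_nonneg divide_le_eq_1 less_le)
qed

text \<open>The codeword of the sent message is independent of all others, and the channel output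
  depends on that codeword only. Hence the codebook can be revealed in the order transmitted word,
  output, other words, and the innermost average concerns fresh words alone.\<close>

lemma expected_loss_random_code:
  fixes M :: nat
  assumes "0 < M"
  shows "measure_pmf.expectation (Pi_pmf {..<M} d (\<lambda>_. Q))
      (\<lambda>c. posterior_loss (joint_pmf (map_pmf c (pmf_of_set {..<M})) K)) =
    (\<Sum>m<M. measure_pmf.expectation Q (\<lambda>x. measure_pmf.expectation (K x) (\<lambda>y.
      measure_pmf.expectation (Pi_pmf ({..<M} - {m}) d (\<lambda>_. Q)) (confusion K ({..<M} - {m}) x y)))) / M"
proof -
  let ?C = "Pi_pmf {..<M} d (\<lambda>_. Q)"
  let ?\<phi> = "\<lambda>m c y. (\<Sum>j\<in>{j\<in>{..<M}. c j \<noteq> c m}. pmf (K (c j)) y) / (\<Sum>j<M. pmf (K (c j)) y)"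
  let ?D = "\<lambda>m. Pi_pmf ({..<M} - {m}) d (\<lambda>_. Q)"
  have \<phi>_eq: "?\<phi> m (c(m := x)) y = confusion K ({..<M} - {m}) x y c" if "m < M" for m c x y
  proof -
    have "(\<Sum>j<M. pmf (K ((c(m := x)) j)) y) = pmf (K x) y + (\<Sum>j\<in>{..<M} - {m}. pmf (K (c j)) y)"
      using that by (subst sum.remove[of _ m]) auto
    moreover have "(\<Sum>j\<in>{j\<in>{..<M}. (c(m := x)) j \<noteq> (c(m := x)) m}. pmf (K ((c(m := x)) j)) y) =
        (\<Sum>j\<in>{j\<in>{..<M} - {m}. c j \<noteq> x}. pmf (K (c j)) y)"
      by (intro sum.cong) auto
    ultimately show ?thesis by (simp only: confusion_def)
  qed
  have \<phi>_bound: "\<bar>?\<phi> m c y\<bar> \<le> 1" if "m < M" for m c y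
    using \<phi>_eq[OF that, of c "c m" y] confusion_bounds[of "{..<M} - {m}" K "c m" y c]
    by (simp del: fun_upd_apply)
  have one: "measure_pmf.expectation ?C (\<lambda>c. measure_pmf.expectation (K (c m)) (?\<phi> m c)) =
      measure_pmf.expectation Q (\<lambda>x. measure_pmf.expectation (K x) (\<lambda>y.
        measure_pmf.expectation (?D m) (confusion K ({..<M} - {m}) x y)))" if m: "m < M" for m
  proof -
    have split: "{..<M} = insert m ({..<M} - {m})" using m by auto
    let ?f = "\<lambda>(c, y). ?\<phi> m c y"
    have f: "\<bar>?f z\<bar> \<le> 1" for z using \<phi>_bound[OF m] by (cases z) simp
    have C: "?C = bind_pmf Q (\<lambda>x. map_pmf (\<lambda>c. c(m := x)) (?D m))"
      by (subst split, subst Pi_pmf_insert') (auto simp: map_pmf_def)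
    have "measure_pmf.expectation ?C (\<lambda>c. measure_pmf.expectation (K (c m)) (?\<phi> m c)) =
        measure_pmf.expectation (bind_pmf ?C (\<lambda>c. map_pmf (Pair c) (K (c m)))) ?f"
      by (subst expectation_bind_pmf[where B = 1]) (use f in auto)
    \<comment> \<open>Given the transmitted word, the output and the other codewords are
      independent, so the two draws commute.\<close>
    also have "bind_pmf ?C (\<lambda>c. map_pmf (Pair c) (K (c m))) =
        bind_pmf Q (\<lambda>x. bind_pmf (K x) (\<lambda>y. map_pmf (\<lambda>c. (c(m := x), y)) (?D m)))"
      unfolding C by (simp add: bind_assoc_pmf map_pmf_def bind_return_pmf) (subst bind_commute_pmf, simp)
    also have "measure_pmf.expectation \<dots> ?f = measure_pmf.expectation Q (\<lambda>x.
        measure_pmf.expectation (K x) (\<lambda>y. measure_pmf.expectation (?D m) (\<lambda>c. ?\<phi> m (c(m := x)) y)))"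
      by (subst expectation_bind_pmf[where B = 1], use f in simp)
         (subst expectation_bind_pmf[where B = 1], use f in simp, simp del: fun_upd_apply)
    finally show ?thesis using \<phi>_eq[OF m] by (simp del: fun_upd_apply)
  qed
  have "measure_pmf.expectation ?C (\<lambda>c. posterior_loss (joint_pmf (map_pmf c (pmf_of_set {..<M})) K)) =
      measure_pmf.expectation ?C (\<lambda>c. (\<Sum>m<M. measure_pmf.expectation (K (c m)) (?\<phi> m c)) / M)"
    by (simp only: posterior_loss_code[OF assms])
  also have "\<dots> = (\<Sum>m<M. measure_pmf.expectation ?C (\<lambda>c. measure_pmf.expectation (K (c m)) (?\<phi> m c))) / M"
  proof -
    have "integrable (measure_pmf ?C) (\<lambda>c. measure_pmf.expectation (K (c m)) (?\<phi> m c))" if "m < M" for m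
    proof (rule integrable_pmf_bounded[where B = 1])
      fix c
      have "\<bar>measure_pmf.expectation (K (c m)) (?\<phi> m c)\<bar> \<le> measure_pmf.expectation (K (c m)) (\<lambda>_. 1)"
        by (rule order_trans[OF integral_abs_bound], rule expectation_pmf_mono)
           (use \<phi>_bound[OF that] in \<open>auto intro!: integrable_pmf_bounded[where B = 1]\<close>)
      then show "\<bar>measure_pmf.expectation (K (c m)) (?\<phi> m c)\<bar> \<le> 1" by simp
    qed
    then show ?thesis by (simp add: Bochner_Integration.integral_sum)
  qed
  also have "(\<Sum>m<M. measure_pmf.expectation ?C (\<lambda>c. measure_pmf.expectation (K (c m)) (?\<phi> m c))) =
      (\<Sum>m<M. measure_pmf.expectation Q (\<lambda>x. measure_pmf.expectation (K x) (\<lambda>y.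
        measure_pmf.expectation (?D m) (confusion K ({..<M} - {m}) x y))))"
    by (intro sum.cong refl one) auto
  finally show ?thesis .
qed

lemma expectation_Pi_pmf_component:
  fixes f :: "'a \<Rightarrow> real"
  assumes "finite I" "j \<in> I"
  shows "measure_pmf.expectation (Pi_pmf I d (\<lambda>_. Q)) (\<lambda>c. f (c j)) = measure_pmf.expectation Q f"
  using integral_map_pmf[of "\<lambda>c. c j" "Pi_pmf I d (\<lambda>_. Q)" f] Pi_pmf_component[OF assms(1), of j d "\<lambda>_. Q"] assms(2)
  by simp

lemma expectation_Pi_pmf_two_components:
  fixes f g :: "'a \<Rightarrow> real"
  assumes "finite I" "j \<in> I" "k \<in> I" "j \<noteq> k"
    and "\<And>x. 0 \<le> f x" "\<And>x. f x \<le> 1" "\<And>x. 0 \<le> g x" "\<And>x. g x \<le> 1"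
  shows "measure_pmf.expectation (Pi_pmf I d (\<lambda>_. Q)) (\<lambda>c. f (c j) * g (c k)) =
    measure_pmf.expectation Q f * measure_pmf.expectation Q g"
proof -
  let ?F = "\<lambda>i. if i = j then f else if i = k then g else (\<lambda>_. 1)"
  have "(\<Prod>i\<in>I. ?F i (z i)) = f (z j) * g (z k)" for z
    using assms(1-4) by (subst prod.remove[of _ j], simp, simp, subst prod.remove[of _ k]) auto
  moreover have "(\<Prod>i\<in>I. measure_pmf.expectation Q (?F i)) = measure_pmf.expectation Q f * measure_pmf.expectation Q g"
    using assms(1-4) by (subst prod.remove[of _ j], simp, simp, subst prod.remove[of _ k]) auto
  moreover have "measure_pmf.expectation (Pi_pmf I d (\<lambda>_. Q)) (\<lambda>y. \<Prod>i\<in>I. ?F i (y i)) =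
      (\<Prod>i\<in>I. measure_pmf.expectation Q (?F i))"
    by (rule expectation_prod_Pi_pmf) (use assms in \<open>auto intro!: integrable_pmf_bounded[where B = 1]\<close>)
  ultimately show ?thesis by simp
qed


section \<open>Gallager's upper bound\<close>

text \<open>This is the sharpened union bound: a quantity below both 1 and the sum of the r j. If
  the sum of the r j powr s is at least 1, so is its power. Otherwise every r j is at most 1, so
  both lowering the exponent to s and taking the power \<rho> increase the value.\<close>

lemma min_1_sum_le:
  fixes r :: "'i \<Rightarrow> real"
  assumes "finite I" "\<And>j. j \<in> I \<Longrightarrow> 0 \<le> r j" "0 < s" "s \<le> 1" "0 \<le> \<rho>" "\<rho> \<le> 1"
    "x \<le> 1" "x \<le> (\<Sum>j\<in>I. r j)"
  shows "x \<le> (\<Sum>j\<in>I. r j powr s) powr \<rho>"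
proof (cases "x \<le> 0")
  case True
  then show ?thesis by (rule order_trans) simp
next
  case False
  let ?S = "\<Sum>j\<in>I. r j powr s"
  have S0: "0 \<le> ?S" by (simp add: sum_nonneg)
  show ?thesis
  proof (cases "1 \<le> ?S")
    case True
    then have "1 \<le> ?S powr \<rho>" using assms by (intro ge_one_powr_ge_zero) auto
    then show ?thesis using assms by linarith
  next
    case S: False
    have "r j \<le> r j powr s" if "j \<in> I" for j
    proof -
      have "r j powr s \<le> ?S" using that assms by (intro member_le_sum) auto
      then have "r j powr s < 1" using S by linarith
      then have "r j \<le> 1" using assms ge_one_powr_ge_zero[of "r j" s] by force
      then show ?thesis using assms(2)[OF that] assms by (intro powr_mono'[of s 1 "r j", simplified]) auto
    qed
    then have "(\<Sum>j\<in>I. r j) \<le> ?S" by (rule sum_mono)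
    also have "?S \<le> ?S powr \<rho>"
    proof -
      have "?S powr 1 \<le> ?S powr \<rho>" using S S0 assms by (intro powr_mono') auto
      then show ?thesis using S0 by simp
    qed
    finally show ?thesis using assms by linarith
  qed
qed

text \<open>The sharpened union bound is applied to the likelihood ratios against the transmitted
  word, with s = 1 / (1 + \<rho>). The power \<rho> of the resulting random sum is bounded by its
  tangent at the mean T, so only the mean of a single codeword enters.\<close>

lemma expected_confusion_le:
  fixes K :: "'u \<Rightarrow> 'v pmf"
  assumes I: "finite I" and \<rho>: "0 \<le> \<rho>" "\<rho> \<le> 1" and xy: "x \<in> set_pmf Q" "y \<in> set_pmf (K x)"
  defines "s \<equiv> 1 / (1 + \<rho>)"
  shows "measure_pmf.expectation (Pi_pmf I d (\<lambda>_. Q)) (confusion K I x y) \<le>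
    (card I * measure_pmf.expectation Q (\<lambda>x. pmf (K x) y powr s) / pmf (K x) y powr s) powr \<rho>"
proof (cases "I = {}")
  case True
  then have "confusion K I x y = (\<lambda>_. 0)" by (auto simp: confusion_def)
  then show ?thesis by simp
next
  case False
  let ?C = "Pi_pmf I d (\<lambda>_. Q)" and ?\<mu> = "measure_pmf.expectation Q (\<lambda>x. pmf (K x) y powr s)"
  let ?w = "pmf (K x) y"
  have s: "0 < s" "s \<le> 1" using \<rho> by (auto simp: s_def)
  have w: "0 < ?w" using xy(2) by (rule pmf_positive)
  have b1: "\<bar>pmf (K x) y powr s\<bar> \<le> 1" for x using s by (auto intro!: powr_le1 simp: pmf_le_1)
  have int: "integrable (measure_pmf Q) (\<lambda>x. pmf (K x) y powr s)"
    using b1 by (rule integrable_pmf_bounded)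
  \<comment> \<open>The tangent needs a positive point of contact. The word x itself has positive
    weight under Q and positive likelihood, which keeps \<mu> positive.\<close>
  have "0 < pmf Q x * ?w powr s" using pmf_positive[OF xy(1)] w by (intro mult_pos_pos) (auto simp: less_le)
  also have "\<dots> = measure_pmf.expectation Q (\<lambda>x'. ?w powr s * indicator {x} x')"
    by (simp add: measure_pmf_single)
  also have "\<dots> \<le> ?\<mu>"
    by (rule expectation_pmf_mono[OF _ int]) (use b1 in \<open>auto simp: indicator_def intro!: integrable_pmf_bounded[where B = 1]\<close>)
  finally have \<mu>: "0 < ?\<mu>" .
  define T where "T = card I * ?\<mu> / ?w powr s"
  have T: "0 < T" unfolding T_def using \<mu> w False I by (intro divide_pos_pos mult_pos_pos) (auto simp: card_gt_0_iff)
  let ?g = "\<lambda>c. \<Sum>j\<in>I. pmf (K (c j)) y powr s / ?w powr s"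
  have intg: "integrable (measure_pmf ?C) ?g"
  proof (intro Bochner_Integration.integrable_sum integrable_pmf_bounded[where B = "1 / ?w powr s"])
    fix j c
    show "\<bar>pmf (K (c j)) y powr s / ?w powr s\<bar> \<le> 1 / ?w powr s"
      using b1[of "c j"] by (simp add: divide_right_mono)
  qed
  have Eg: "measure_pmf.expectation ?C ?g = T"
  proof -
    have "measure_pmf.expectation ?C ?g = (\<Sum>j\<in>I. measure_pmf.expectation ?C (\<lambda>c. pmf (K (c j)) y powr s / ?w powr s))"
      by (rule Bochner_Integration.integral_sum)
         (intro integrable_pmf_bounded[where B = "1 / ?w powr s"], use b1 in \<open>simp add: divide_right_mono\<close>)
    also have "\<dots> = (\<Sum>j\<in>I. ?\<mu> / ?w powr s)"
      by (intro sum.cong refl) (subst expectation_Pi_pmf_component[OF I, where f = "\<lambda>u. pmf (K u) y powr s / ?w powr s"], auto)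
    finally show ?thesis by (simp add: T_def)
  qed
  have "confusion K I x y c \<le> (1 - \<rho>) * T powr \<rho> + \<rho> * T powr (\<rho> - 1) * ?g c" for c
  proof -
    let ?r = "\<lambda>j. pmf (K (c j)) y / ?w"
    have "confusion K I x y c \<le> (\<Sum>j\<in>{j\<in>I. c j \<noteq> x}. pmf (K (c j)) y) / ?w"
      unfolding confusion_def using w by (intro divide_left_mono) (auto intro!: sum_nonneg mult_pos_pos add_pos_nonneg)
    also have "\<dots> \<le> (\<Sum>j\<in>I. pmf (K (c j)) y) / ?w"
      using I by (intro divide_right_mono sum_mono2) auto
    finally have "confusion K I x y c \<le> (\<Sum>j\<in>I. ?r j)" by (simp add: sum_divide_distrib)
    then have "confusion K I x y c \<le> (\<Sum>j\<in>I. ?r j powr s) powr \<rho>"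
      by (intro min_1_sum_le) (use I s \<rho> confusion_bounds[OF I] in auto)
    also have "(\<Sum>j\<in>I. ?r j powr s) = ?g c" by (intro sum.cong refl) (simp add: powr_divide)
    also have "?g c powr \<rho> \<le> (1 - \<rho>) * T powr \<rho> + \<rho> * T powr (\<rho> - 1) * ?g c"
      by (intro powr_le_scaled_tangent) (use \<rho> T in \<open>auto intro!: sum_nonneg\<close>)
    finally show ?thesis .
  qed
  moreover have "integrable (measure_pmf ?C) (confusion K I x y)"
    using confusion_bounds[OF I, of K x y] by (intro integrable_pmf_bounded[where B = 1]) auto
  moreover have "integrable (measure_pmf ?C) (\<lambda>c. (1 - \<rho>) * T powr \<rho> + \<rho> * T powr (\<rho> - 1) * ?g c)"
    by (intro Bochner_Integration.integrable_add integrable_mult_right intg measure_pmf.integrable_const)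
  ultimately have "measure_pmf.expectation ?C (confusion K I x y) \<le>
      measure_pmf.expectation ?C (\<lambda>c. (1 - \<rho>) * T powr \<rho> + \<rho> * T powr (\<rho> - 1) * ?g c)"
    by (intro expectation_pmf_mono)
  also have "\<dots> = (1 - \<rho>) * T powr \<rho> + \<rho> * T powr (\<rho> - 1) * T"
    using intg Eg by (subst Bochner_Integration.integral_add) (auto intro!: integrable_mult_right)
  also have "\<dots> = T powr \<rho>"
    using T by (simp add: powr_diff algebra_simps)
  finally show ?thesis by (simp add: T_def)
qed

text \<open>Summing over the transmitted word turns the likelihood into one more factor \<mu>, so
  that \<mu> powr \<rho> becomes \<mu> powr (1 + \<rho>). Stating the bound with extended
  nonnegative integrals allows the sums over x and y to be exchanged before any summability is
  known.\<close>

lemma expected_loss_le: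
  fixes K :: "'u \<Rightarrow> 'v pmf" and M :: nat
  assumes M: "0 < M" and \<rho>: "0 \<le> \<rho>" "\<rho> \<le> 1"
  defines "s \<equiv> 1 / (1 + \<rho>)"
  shows "ennreal (measure_pmf.expectation (Pi_pmf {..<M} d (\<lambda>_. Q))
      (\<lambda>c. posterior_loss (joint_pmf (map_pmf c (pmf_of_set {..<M})) K))) \<le>
    ennreal (M powr \<rho>) * (\<integral>\<^sup>+ y. ennreal (measure_pmf.expectation Q (\<lambda>x. pmf (K x) y powr s) powr (1 + \<rho>)) \<partial>count_space UNIV)"
proof -
  let ?\<mu> = "\<lambda>y. measure_pmf.expectation Q (\<lambda>x. pmf (K x) y powr s)"
  let ?E = "\<lambda>m x y. measure_pmf.expectation (Pi_pmf ({..<M} - {m}) d (\<lambda>_. Q)) (confusion K ({..<M} - {m}) x y)"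
  let ?R = "ennreal (M powr \<rho>) * (\<integral>\<^sup>+ y. ennreal (?\<mu> y powr (1 + \<rho>)) \<partial>count_space UNIV)"
  have s: "0 < s" "s \<le> 1" using \<rho> by (auto simp: s_def)
  have \<mu>0: "0 \<le> ?\<mu> y" for y by (intro Bochner_Integration.integral_nonneg) simp
  have E01: "0 \<le> ?E m x y" "?E m x y \<le> 1" for m x y
  proof -
    show "0 \<le> ?E m x y" by (intro Bochner_Integration.integral_nonneg confusion_bounds) simp
    have "?E m x y \<le> measure_pmf.expectation (Pi_pmf ({..<M} - {m}) d (\<lambda>_. Q)) (\<lambda>_. 1)"
      by (rule expectation_pmf_mono)
         (use confusion_bounds[of "{..<M} - {m}" K x y] in \<open>auto intro!: integrable_pmf_bounded[where B = 1]\<close>)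
    then show "?E m x y \<le> 1" by simp
  qed
  have EE: "0 \<le> measure_pmf.expectation (K x) (?E m x)" "measure_pmf.expectation (K x) (?E m x) \<le> 1" for m x
  proof -
    show "0 \<le> measure_pmf.expectation (K x) (?E m x)" by (intro Bochner_Integration.integral_nonneg E01)
    have "measure_pmf.expectation (K x) (?E m x) \<le> measure_pmf.expectation (K x) (\<lambda>_. 1)"
      by (rule expectation_pmf_mono) (use E01 in \<open>auto intro!: integrable_pmf_bounded[where B = 1]\<close>)
    then show "measure_pmf.expectation (K x) (?E m x) \<le> 1" by simp
  qed
  have one: "ennreal (measure_pmf.expectation Q (\<lambda>x. measure_pmf.expectation (K x) (?E m x))) \<le> ?R" if m: "m < M" for m
  proof -
    have "ennreal (measure_pmf.expectation Q (\<lambda>x. measure_pmf.expectation (K x) (?E m x))) =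
        (\<integral>\<^sup>+ x. ennreal (measure_pmf.expectation (K x) (?E m x)) \<partial>measure_pmf Q)"
      by (rule nn_integral_eq_integral[symmetric])
         (use EE in \<open>auto intro!: integrable_pmf_bounded[where B = 1]\<close>)
    also have "\<dots> = (\<integral>\<^sup>+ x. \<integral>\<^sup>+ y. ennreal (?E m x y) \<partial>measure_pmf (K x) \<partial>measure_pmf Q)"
      by (intro nn_integral_cong nn_integral_eq_integral[symmetric])
         (use E01 in \<open>auto intro!: integrable_pmf_bounded[where B = 1]\<close>)
    also have "\<dots> \<le> (\<integral>\<^sup>+ x. \<integral>\<^sup>+ y. ennreal ((M * ?\<mu> y / pmf (K x) y powr s) powr \<rho>) \<partial>measure_pmf (K x) \<partial>measure_pmf Q)"
    proof (rule nn_integral_mono_AE, rule AE_pmfI, rule nn_integral_mono_AE, rule AE_pmfI, rule ennreal_leI)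
      fix x y assume xy: "x \<in> set_pmf Q" "y \<in> set_pmf (K x)"
      have "?E m x y \<le> (card ({..<M} - {m}) * ?\<mu> y / pmf (K x) y powr s) powr \<rho>"
        unfolding s_def by (rule expected_confusion_le) (use \<rho> xy in auto)
      also have "\<dots> \<le> (M * ?\<mu> y / pmf (K x) y powr s) powr \<rho>"
        using \<rho> \<mu>0 m by (intro powr_mono2 divide_right_mono mult_right_mono) auto
      finally show "?E m x y \<le> (M * ?\<mu> y / pmf (K x) y powr s) powr \<rho>" .
    qed
    also have "\<dots> = (\<integral>\<^sup>+ x. \<integral>\<^sup>+ y. ennreal (M powr \<rho>) * (ennreal (pmf Q x) * ennreal (pmf (K x) y powr s * ?\<mu> y powr \<rho>)) \<partial>count_space UNIV \<partial>count_space UNIV)"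
    proof -
      have *: "pmf (K x) y * (M * ?\<mu> y / pmf (K x) y powr s) powr \<rho> = M powr \<rho> * (pmf (K x) y powr s * ?\<mu> y powr \<rho>)" for x y
      proof (cases "pmf (K x) y = 0")
        case False
        \<comment> \<open>This identity is what singles out s = 1 / (1 + \<rho>): the transmitted
          word then carries the same power of the likelihood as its competitors.\<close>
        have "1 - s * \<rho> = s" using \<rho> by (simp add: s_def field_simps)
        then have "pmf (K x) y powr s = pmf (K x) y powr (1 - s * \<rho>)" by simp
        also have "\<dots> = pmf (K x) y / (pmf (K x) y powr s) powr \<rho>"
          using False by (simp add: powr_diff powr_powr)
        finally have q: "pmf (K x) y / (pmf (K x) y powr s) powr \<rho> = pmf (K x) y powr s" by simp
        have "pmf (K x) y * (M * ?\<mu> y / pmf (K x) y powr s) powr \<rho> =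
            pmf (K x) y / (pmf (K x) y powr s) powr \<rho> * (M powr \<rho> * ?\<mu> y powr \<rho>)"
          using \<mu>0 by (simp add: powr_divide powr_mult)
        then show ?thesis unfolding q by (rule trans[OF _ mult.left_commute])
      qed auto
      have "(\<integral>\<^sup>+ x. \<integral>\<^sup>+ y. ennreal ((M * ?\<mu> y / pmf (K x) y powr s) powr \<rho>) \<partial>measure_pmf (K x) \<partial>measure_pmf Q) =
          (\<integral>\<^sup>+ x. ennreal (pmf Q x) * (\<integral>\<^sup>+ y. ennreal (pmf (K x) y) * ennreal ((M * ?\<mu> y / pmf (K x) y powr s) powr \<rho>) \<partial>count_space UNIV) \<partial>count_space UNIV)"
        by (simp add: nn_integral_measure_pmf)
      also have "\<dots> = (\<integral>\<^sup>+ x. ennreal (pmf Q x) * (\<integral>\<^sup>+ y. ennreal (M powr \<rho> * (pmf (K x) y powr s * ?\<mu> y powr \<rho>)) \<partial>count_space UNIV) \<partial>count_space UNIV)"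
        by (simp add: *[symmetric] ennreal_mult')
      also have "\<dots> = (\<integral>\<^sup>+ x. \<integral>\<^sup>+ y. ennreal (pmf Q x) * ennreal (M powr \<rho> * (pmf (K x) y powr s * ?\<mu> y powr \<rho>)) \<partial>count_space UNIV \<partial>count_space UNIV)"
        by (simp add: nn_integral_cmult)
      finally show ?thesis by (simp add: ennreal_mult' mult_ac)
    qed
    also have "\<dots> = (\<integral>\<^sup>+ y. \<integral>\<^sup>+ x. ennreal (M powr \<rho>) * (ennreal (pmf Q x) * ennreal (pmf (K x) y powr s * ?\<mu> y powr \<rho>)) \<partial>count_space UNIV \<partial>count_space UNIV)"
      by (rule trans[OF nn_integral_fst_count_space[where f = "\<lambda>(x, y). ennreal (M powr \<rho>) * (ennreal (pmf Q x) * ennreal (pmf (K x) y powr s * ?\<mu> y powr \<rho>))", simplified]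
          nn_integral_snd_count_space[where f = "\<lambda>(x, y). ennreal (M powr \<rho>) * (ennreal (pmf Q x) * ennreal (pmf (K x) y powr s * ?\<mu> y powr \<rho>))", simplified, symmetric]])
    also have "\<dots> = ennreal (M powr \<rho>) * (\<integral>\<^sup>+ y. \<integral>\<^sup>+ x. ennreal (pmf (K x) y powr s * ?\<mu> y powr \<rho>) \<partial>measure_pmf Q \<partial>count_space UNIV)"
      by (simp add: nn_integral_measure_pmf nn_integral_cmult)
    also have "(\<lambda>y. \<integral>\<^sup>+ x. ennreal (pmf (K x) y powr s * ?\<mu> y powr \<rho>) \<partial>measure_pmf Q) = (\<lambda>y. ennreal (?\<mu> y powr (1 + \<rho>)))"
    proof
      fix y
      have "(\<integral>\<^sup>+ x. ennreal (pmf (K x) y powr s * ?\<mu> y powr \<rho>) \<partial>measure_pmf Q) =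
          ennreal (measure_pmf.expectation Q (\<lambda>x. pmf (K x) y powr s * ?\<mu> y powr \<rho>))"
      proof (rule nn_integral_eq_integral)
        show "integrable (measure_pmf Q) (\<lambda>x. pmf (K x) y powr s * ?\<mu> y powr \<rho>)"
          using s by (intro integrable_mult_left integrable_pmf_bounded[where B = 1]) (auto intro!: powr_le1 simp: pmf_le_1)
      qed auto
      also have "measure_pmf.expectation Q (\<lambda>x. pmf (K x) y powr s * ?\<mu> y powr \<rho>) = ?\<mu> y powr (1 + \<rho>)"
        using \<mu>0[of y] by (simp add: powr_mult_base)
      finally show "(\<integral>\<^sup>+ x. ennreal (pmf (K x) y powr s * ?\<mu> y powr \<rho>) \<partial>measure_pmf Q) = ennreal (?\<mu> y powr (1 + \<rho>))" .
    qed
    finally show ?thesis .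
  qed
  have "ennreal (measure_pmf.expectation (Pi_pmf {..<M} d (\<lambda>_. Q))
      (\<lambda>c. posterior_loss (joint_pmf (map_pmf c (pmf_of_set {..<M})) K))) =
    (\<Sum>m<M. ennreal (measure_pmf.expectation Q (\<lambda>x. measure_pmf.expectation (K x) (?E m x)))) / ennreal M"
    unfolding expected_loss_random_code[OF M]
    using M by (subst sum_ennreal, simp add: EE Bochner_Integration.integral_nonneg)
      (rule divide_ennreal[symmetric], auto intro!: sum_nonneg Bochner_Integration.integral_nonneg EE)
  also have "\<dots> \<le> (\<Sum>m<M. ?R) / ennreal M"
    by (intro divide_right_mono_ennreal sum_mono one) auto
  also have "\<dots> = ennreal M * ?R / ennreal M" by (simp add: ennreal_of_nat_eq_real_of_nat)
  also have "\<dots> = ?R" using M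
    by (subst mult.commute, intro ennreal_mult_divide_eq) auto
  finally show ?thesis .
qed

section \<open>Second moment lower bound\<close>

text \<open>Let g count the fresh words that compete with x according to G, and let e also count
  copies of x. Competitors are at least as likely as x, so the confusion is at least g / (1 + e).
  The tangent of 1 / t at z gives a bound with first and second moments only, and independence makes
  the mixed moments at most \<pi> h off the diagonal and \<pi> on it.\<close>

lemma expected_confusion_ge:
  fixes K :: "'u \<Rightarrow> 'v pmf" and G :: "('u \<times> 'u \<times> 'v) set" and h :: real
  assumes I: "finite I"
    and G: "\<And>x x' y. (x, x', y) \<in> G \<Longrightarrow> x \<noteq> x' \<and> 0 < pmf (K x) y \<and> pmf (K x) y \<le> pmf (K x') y"
    and h: "\<And>x x' y. (x, x', y) \<in> G \<Longrightarrow> pmf Q x + measure_pmf.prob Q {x'. (x, x', y) \<in> G} \<le> h"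
    and h0: "0 \<le> h"
  shows "card I / (2 + card I * h) * measure_pmf.prob Q {x'. (x, x', y) \<in> G} \<le>
    measure_pmf.expectation (Pi_pmf I d (\<lambda>_. Q)) (confusion K I x y)"
proof (cases "\<exists>x'. (x, x', y) \<in> G")
  case False
  then show ?thesis using confusion_bounds[OF I]
    by (auto intro!: Bochner_Integration.integral_nonneg)
next
  case True
  let ?C = "Pi_pmf I d (\<lambda>_. Q)"
  define w where "w = pmf (K x) y"
  have w: "0 < w" using True G unfolding w_def by blast
  define g :: "'u \<Rightarrow> real" where "g = indicator {x'. (x, x', y) \<in> G}"
  \<comment> \<open>Copies of x enlarge the total likelihood without counting as confusion, hence
    they must appear in the denominator but not in g.\<close>
  define e :: "'u \<Rightarrow> real" where "e = indicator ({x'. (x, x', y) \<in> G} \<union> {x})"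
  define \<pi> where "\<pi> = measure_pmf.prob Q {x'. (x, x', y) \<in> G}"
  \<comment> \<open>With N = \<open>card I\<close>, the mean of g (1 + e) is at most N \<pi> z: one
    unit comes from the constant 1, one from the diagonal, N h from the other pairs. Contact at this
    z makes 2 / z - z / z^2 equal to 1 / z.\<close>
  define z where "z = 2 + card I * h"
  have z: "2 \<le> z" using h0 by (simp add: z_def)
  have g01: "0 \<le> g u" "g u \<le> 1" and e01: "0 \<le> e u" "e u \<le> 1" and ge: "g u * e u = g u" for u
    by (auto simp: g_def e_def indicator_def)
  have Eg: "measure_pmf.expectation Q g = \<pi>" by (simp add: g_def \<pi>_def)
  have Ee: "measure_pmf.expectation Q e \<le> h"
  proof -
    have "measure_pmf.expectation Q e = measure_pmf.prob Q ({x'. (x, x', y) \<in> G} \<union> {x})"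
      by (simp add: e_def del: Un_insert_right)
    also have "\<dots> \<le> \<pi> + pmf Q x"
      unfolding \<pi>_def by (rule order_trans[OF measure_Un_le]) (auto simp: measure_pmf_single)
    finally show ?thesis using True h unfolding \<pi>_def by force
  qed
  have \<pi>0: "0 \<le> \<pi>" by (simp add: \<pi>_def)
  have bound: "(\<Sum>j\<in>I. g (c j)) * (2 / z - 1 / z\<^sup>2) - (\<Sum>j\<in>I. \<Sum>k\<in>I. g (c j) * e (c k)) / z\<^sup>2
      \<le> confusion K I x y c" for c
  proof -
    let ?g = "\<Sum>j\<in>I. g (c j)" and ?e = "\<Sum>j\<in>I. e (c j)" and ?x = "\<Sum>j\<in>I. indicator {x} (c j) :: real"
    let ?B = "\<Sum>j\<in>{j\<in>I. c j \<noteq> x}. pmf (K (c j)) y"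
    have e_split: "?e = ?g + ?x"
      unfolding sum.distrib[symmetric] by (intro sum.cong refl) (use G in \<open>auto simp: e_def g_def indicator_def\<close>)
    have g0: "0 \<le> ?g" by (intro sum_nonneg g01)
    have x0: "0 \<le> ?x" by (intro sum_nonneg) (simp add: indicator_def)
    have B: "w * ?g \<le> ?B"
    proof -
      have "w * ?g = (\<Sum>j\<in>{j\<in>I. c j \<noteq> x}. w * g (c j))"
        unfolding sum_distrib_left using I G by (intro sum.mono_neutral_right) (auto simp: g_def indicator_def)
      also have "\<dots> \<le> ?B"
        using G by (intro sum_mono) (auto simp: g_def indicator_def w_def)
      finally show ?thesis .
    qed
    have S: "pmf (K x) y + (\<Sum>j\<in>I. pmf (K (c j)) y) = w * (1 + ?x) + ?B"
    proof -
      have "(\<Sum>j\<in>I. pmf (K (c j)) y) = (\<Sum>j\<in>{j\<in>I. c j = x}. pmf (K (c j)) y) + ?B"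
        using I by (subst sum.union_disjoint[symmetric]) (auto intro!: sum.cong)
      also have "(\<Sum>j\<in>{j\<in>I. c j = x}. pmf (K (c j)) y) = (\<Sum>j\<in>I. w * indicator {x} (c j))"
        using I by (intro sum.mono_neutral_cong_left) (auto simp: indicator_def w_def)
      finally show ?thesis by (simp add: w_def sum_distrib_left algebra_simps)
    qed
    have "?g * (2 / z - (1 + ?e) / z\<^sup>2) \<le> ?g * (1 / (1 + ?e))"
    proof (intro mult_left_mono g0)
      \<comment> \<open>Convexity of 1 / t in explicit form: the gap between 1 / t and its tangent
        at z is (z - t)^2 / (z^2 t).\<close>
      have "0 \<le> (z - (1 + ?e))\<^sup>2 / (z\<^sup>2 * (1 + ?e))" using g0 x0 e_split by auto
      also have "(z - (1 + ?e))\<^sup>2 / (z\<^sup>2 * (1 + ?e)) = 1 / (1 + ?e) - (2 / z - (1 + ?e) / z\<^sup>2)"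
      proof -
        have "(z - t)\<^sup>2 / (z\<^sup>2 * t) = 1 / t - (2 / z - t / z\<^sup>2)" if "t > 0" for t
          using z that by (simp add: power2_eq_square field_simps)
        then show ?thesis using g0 x0 e_split by simp
      qed
      finally show "2 / z - (1 + ?e) / z\<^sup>2 \<le> 1 / (1 + ?e)" by simp
    qed
    also have "?g * (1 / (1 + ?e)) = w * ?g / (w * (1 + ?x) + w * ?g)"
      using w by (simp add: e_split flip: distrib_left)
    also have "\<dots> \<le> ?B / (w * (1 + ?x) + ?B)"
    proof -
      have "t / (a + t) \<le> u / (a + u)" if "0 < a" "0 \<le> t" "t \<le> u" for a t u :: real
        using that by (simp add: field_simps)
      then show ?thesis using w B g0 x0 by simp
    qed
    also have "\<dots> = confusion K I x y c" by (simp add: confusion_def S)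
    finally have "?g * (2 / z - (1 + ?e) / z\<^sup>2) \<le> confusion K I x y c" .
    moreover have "(\<Sum>j\<in>I. \<Sum>k\<in>I. g (c j) * e (c k)) = ?g * ?e" by (simp add: sum_product)
    ultimately show ?thesis by (simp add: algebra_simps add_divide_distrib)
  qed
  have int1: "integrable (measure_pmf ?C) (\<lambda>c. g (c j))" for j
    using g01 by (intro integrable_pmf_bounded[where B = 1]) auto
  have int2: "integrable (measure_pmf ?C) (\<lambda>c. g (c j) * e (c k))" for j k
    using g01 e01 by (intro integrable_pmf_bounded[where B = 1]) (auto simp: abs_mult intro!: mult_le_one)
  have double: "(\<Sum>j\<in>I. \<Sum>k\<in>I. measure_pmf.expectation ?C (\<lambda>c. g (c j) * e (c k))) \<le> card I * \<pi> * (1 + card I * h)"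
  proof -
    have "(\<Sum>k\<in>I. measure_pmf.expectation ?C (\<lambda>c. g (c j) * e (c k))) \<le> \<pi> * (1 + card I * h)" if j: "j \<in> I" for j
    proof -
      have "measure_pmf.expectation ?C (\<lambda>c. g (c j) * e (c j)) = \<pi>"
        using expectation_Pi_pmf_component[OF I j, where f = g] by (simp add: ge Eg)
      moreover have "measure_pmf.expectation ?C (\<lambda>c. g (c j) * e (c k)) \<le> \<pi> * h" if "k \<in> I - {j}" for k
        using expectation_Pi_pmf_two_components[OF I j, of k g e d Q] that g01 e01 Ee \<pi>0
        by (auto simp: Eg intro: mult_left_mono)
      then have "(\<Sum>k\<in>I - {j}. measure_pmf.expectation ?C (\<lambda>c. g (c j) * e (c k))) \<le> (\<Sum>k\<in>I - {j}. \<pi> * h)"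
        by (rule sum_mono)
      moreover have "(\<Sum>k\<in>I - {j}. \<pi> * h) \<le> card I * (\<pi> * h)"
        using \<pi>0 h0 card_Diff1_le[of I j] by (auto intro!: mult_right_mono)
      ultimately show ?thesis using I j by (subst sum.remove[of _ j]) (auto simp: algebra_simps)
    qed
    then have "(\<Sum>j\<in>I. \<Sum>k\<in>I. measure_pmf.expectation ?C (\<lambda>c. g (c j) * e (c k))) \<le> (\<Sum>j\<in>I. \<pi> * (1 + card I * h))"
      by (rule sum_mono)
    then show ?thesis by (simp add: mult.assoc)
  qed
  have "card I / z * \<pi> = card I * \<pi> * (2 / z - 1 / z\<^sup>2) - card I * \<pi> * (1 + card I * h) / z\<^sup>2"
  proof -
    have "card I * \<pi> * (2 / z - 1 / z\<^sup>2) - card I * \<pi> * (1 + card I * h) / z\<^sup>2 =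
        card I * \<pi> * (2 / z - (2 + card I * h) / z\<^sup>2)"
      using z by (simp add: field_simps)
    also have "2 / z - (2 + card I * h) / z\<^sup>2 = 2 / z - z / z\<^sup>2" by (simp add: z_def)
    also have "\<dots> = 1 / z" using z by (simp add: power2_eq_square field_simps)
    finally show ?thesis by simp
  qed
  also have "\<dots> \<le> card I * \<pi> * (2 / z - 1 / z\<^sup>2) -
      (\<Sum>j\<in>I. \<Sum>k\<in>I. measure_pmf.expectation ?C (\<lambda>c. g (c j) * e (c k))) / z\<^sup>2"
    using double z by (intro diff_left_mono divide_right_mono) auto
  also have "\<dots> = measure_pmf.expectation ?C (\<lambda>c. (\<Sum>j\<in>I. g (c j)) * (2 / z - 1 / z\<^sup>2) -
      (\<Sum>j\<in>I. \<Sum>k\<in>I. g (c j) * e (c k)) / z\<^sup>2)"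
    using int1 int2 I expectation_Pi_pmf_component[OF I, where f = g]
    by (subst Bochner_Integration.integral_diff)
       (auto simp: Bochner_Integration.integral_sum Eg)
  also have "\<dots> \<le> measure_pmf.expectation ?C (confusion K I x y)"
    using bound confusion_bounds[OF I, of K x y] int1 int2
    by (intro expectation_pmf_mono) (auto intro!: integrable_pmf_bounded[where B = 1])
  finally show ?thesis by (simp add: z_def \<pi>_def)
qed

text \<open>The preceding bound is averaged over the transmitted word and the output. Its only
  dependence on them is the Q-probability of a slice of G, and since G is finite the average becomes
  a sum over triples. The number of fresh words is M - 1.\<close>

lemma expected_loss_ge:
  fixes K :: "'u \<Rightarrow> 'v pmf" and G :: "('u \<times> 'u \<times> 'v) set" and h :: real and M :: nat
  assumes M: "0 < M" and fin: "finite G"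
    and G: "\<And>x x' y. (x, x', y) \<in> G \<Longrightarrow> x \<noteq> x' \<and> 0 < pmf (K x) y \<and> pmf (K x) y \<le> pmf (K x') y"
    and h: "\<And>x x' y. (x, x', y) \<in> G \<Longrightarrow> pmf Q x + measure_pmf.prob Q {x'. (x, x', y) \<in> G} \<le> h"
    and h0: "0 \<le> h"
  shows "(real M - 1) / (2 + (real M - 1) * h) * (\<Sum>(x, x', y)\<in>G. pmf Q x * pmf Q x' * pmf (K x) y) \<le>
    measure_pmf.expectation (Pi_pmf {..<M} d (\<lambda>_. Q))
      (\<lambda>c. posterior_loss (joint_pmf (map_pmf c (pmf_of_set {..<M})) K))"
proof -
  let ?E = "\<lambda>m x y. measure_pmf.expectation (Pi_pmf ({..<M} - {m}) d (\<lambda>_. Q)) (confusion K ({..<M} - {m}) x y)"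
  let ?a = "(real M - 1) / (2 + (real M - 1) * h)"
  let ?p = "\<lambda>x y. measure_pmf.prob Q {x'. (x, x', y) \<in> G}"
  have E01: "0 \<le> ?E m x y" "?E m x y \<le> 1" for m x y
  proof -
    show "0 \<le> ?E m x y" by (intro Bochner_Integration.integral_nonneg confusion_bounds) simp
    have "?E m x y \<le> measure_pmf.expectation (Pi_pmf ({..<M} - {m}) d (\<lambda>_. Q)) (\<lambda>_. 1)"
      by (rule expectation_pmf_mono)
         (use confusion_bounds[of "{..<M} - {m}" K x y] in \<open>auto intro!: integrable_pmf_bounded[where B = 1]\<close>)
    then show "?E m x y \<le> 1" by simp
  qed
  have bdd: "\<bar>measure_pmf.expectation (K x) f\<bar> \<le> 1" if "\<And>y. 0 \<le> f y \<and> f y \<le> 1" for x and f :: "'v \<Rightarrow> real"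
  proof -
    have "measure_pmf.expectation (K x) f \<le> measure_pmf.expectation (K x) (\<lambda>_. 1)"
      by (rule expectation_pmf_mono) (use that in \<open>auto intro!: integrable_pmf_bounded[where B = 1]\<close>)
    moreover have "0 \<le> measure_pmf.expectation (K x) f"
      by (intro Bochner_Integration.integral_nonneg) (use that in auto)
    ultimately show ?thesis by simp
  qed
  have p_eq: "?p x y = (\<Sum>t\<in>G. indicator {x} (fst t) * (indicator {y} (snd (snd t)) * pmf Q (fst (snd t))))" for x y
  proof -
    have "{x'. (x, x', y) \<in> G} = (fst \<circ> snd) ` {t\<in>G. fst t = x \<and> snd (snd t) = y}" by force
    then have "?p x y = measure_pmf.prob Q ((fst \<circ> snd) ` {t\<in>G. fst t = x \<and> snd (snd t) = y})" by simp
    also have "\<dots> = (\<Sum>t\<in>{t\<in>G. fst t = x \<and> snd (snd t) = y}. pmf Q (fst (snd t)))"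
      using fin by (subst measure_measure_pmf_finite, simp, subst sum.reindex) (auto simp: inj_on_def)
    also have "\<dots> = (\<Sum>t\<in>G. indicator {x} (fst t) * (indicator {y} (snd (snd t)) * pmf Q (fst (snd t))))"
      using fin by (intro sum.mono_neutral_cong_left) (auto simp: indicator_def)
    finally show ?thesis .
  qed
  have sum_eq: "measure_pmf.expectation Q (\<lambda>x. measure_pmf.expectation (K x) (?p x)) =
      (\<Sum>(x, x', y)\<in>G. pmf Q x * pmf Q x' * pmf (K x) y)"
  proof -
    have "measure_pmf.expectation (K x) (?p x) =
        (\<Sum>t\<in>G. pmf (K (fst t)) (snd (snd t)) * pmf Q (fst (snd t)) * indicator {fst t} x)" for x
    proof -
      have "?p x = (\<lambda>y. \<Sum>t\<in>G. indicator {x} (fst t) * pmf Q (fst (snd t)) * indicator {snd (snd t)} y)"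
        unfolding p_eq by (auto simp: indicator_def intro!: sum.cong)
      then have "measure_pmf.expectation (K x) (?p x) =
          (\<Sum>t\<in>G. indicator {x} (fst t) * pmf Q (fst (snd t)) * pmf (K x) (snd (snd t)))"
        by (simp only: expectation_sum_indicator)
      then show ?thesis by (auto simp: indicator_def intro!: sum.cong)
    qed
    then show ?thesis
      by (simp only: expectation_sum_indicator) (auto simp: split_beta mult_ac intro!: sum.cong)
  qed
  have "?a * measure_pmf.expectation Q (\<lambda>x. measure_pmf.expectation (K x) (?p x)) \<le>
      measure_pmf.expectation Q (\<lambda>x. measure_pmf.expectation (K x) (?E m x))" if m: "m < M" for m
  proof -
    have card: "real (card ({..<M} - {m})) = real M - 1" using m by (simp add: of_nat_diff)
    have "?a * measure_pmf.expectation Q (\<lambda>x. measure_pmf.expectation (K x) (?p x)) =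
        measure_pmf.expectation Q (\<lambda>x. measure_pmf.expectation (K x) (\<lambda>y. ?a * ?p x y))" by simp
    also have "\<dots> \<le> measure_pmf.expectation Q (\<lambda>x. measure_pmf.expectation (K x) (?E m x))"
    proof (rule expectation_pmf_mono)
      show "integrable (measure_pmf Q) (\<lambda>x. measure_pmf.expectation (K x) (\<lambda>y. ?a * ?p x y))"
        unfolding integral_mult_right_zero by (intro integrable_mult_right integrable_pmf_bounded[where B = 1] bdd) simp
      show "integrable (measure_pmf Q) (\<lambda>x. measure_pmf.expectation (K x) (?E m x))"
        by (intro integrable_pmf_bounded[where B = 1] bdd conjI E01)
      fix x
      show "measure_pmf.expectation (K x) (\<lambda>y. ?a * ?p x y) \<le> measure_pmf.expectation (K x) (?E m x)"
      proof (rule expectation_pmf_mono)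
        show "integrable (measure_pmf (K x)) (\<lambda>y. ?a * ?p x y)"
          by (intro integrable_mult_right integrable_pmf_bounded[where B = 1]) simp
        show "integrable (measure_pmf (K x)) (?E m x)"
          using E01 by (intro integrable_pmf_bounded[where B = 1]) auto
        fix y
        show "?a * ?p x y \<le> ?E m x y"
          using expected_confusion_ge[of "{..<M} - {m}" G K Q h x y d, OF _ G h h0] by (simp add: card)
      qed
    qed
    finally show ?thesis .
  qed
  then have "(\<Sum>m<M. ?a * (\<Sum>(x, x', y)\<in>G. pmf Q x * pmf Q x' * pmf (K x) y)) \<le>
      (\<Sum>m<M. measure_pmf.expectation Q (\<lambda>x. measure_pmf.expectation (K x) (?E m x)))"
    unfolding sum_eq by (intro sum_mono) auto
  then have "M * (?a * (\<Sum>(x, x', y)\<in>G. pmf Q x * pmf Q x' * pmf (K x) y)) / M \<le>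
      (\<Sum>m<M. measure_pmf.expectation Q (\<lambda>x. measure_pmf.expectation (K x) (?E m x))) / M"
    by (intro divide_right_mono) auto
  then show ?thesis unfolding expected_loss_random_code[OF M] using M by simp
qed

subsection \<open>The Gallager function and mutual information\<close>

lemma powr_ge_scaled_tangent:
  fixes x r T :: real
  assumes "1 \<le> r" "0 \<le> x" "0 < T"
  shows "(1 - r) * T powr r + r * T powr (r - 1) * x \<le> x powr r"
proof -
  have "1 + r * (x / T - 1) \<le> (x / T) powr r"
    by (rule powr_ge_tangent) (use assms in auto)
  then have "(1 + r * (x / T - 1)) * T powr r \<le> (x / T) powr r * T powr r"
    by (rule mult_right_mono) simp
  also have "(x / T) powr r * T powr r = x powr r"
    using assms by (simp add: powr_divide)
  also have "(1 + r * (x / T - 1)) * T powr r = (1 - r) * T powr r + r * (T powr r / T) * x"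
    using assms by (simp add: algebra_simps)
  also have "T powr r / T = T powr (r - 1)"
    using assms by (simp add: powr_diff)
  finally show ?thesis .
qed

lemma powr_expectation_le:
  fixes f :: "'x \<Rightarrow> real"
  assumes "1 \<le> r" "\<And>x. 0 \<le> f x" "\<And>x. f x \<le> 1"
  shows "measure_pmf.expectation p f powr r \<le> measure_pmf.expectation p (\<lambda>x. f x powr r)"
proof -
  define T where "T = measure_pmf.expectation p f"
  have T0: "0 \<le> T" unfolding T_def by (intro Bochner_Integration.integral_nonneg assms)
  have int: "integrable (measure_pmf p) f" "integrable (measure_pmf p) (\<lambda>x. f x powr r)"
    using assms by (auto intro!: integrable_pmf_bounded[where B = 1] powr_le1)
  show ?thesis
  proof (cases "T = 0")
    case True
    then show ?thesis by (auto simp: T_def intro!: Bochner_Integration.integral_nonneg)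
  next
    case False
    then have T: "0 < T" using T0 by simp
    have "T powr r = (1 - r) * T powr r + r * T powr (r - 1) * T"
      using T by (simp add: powr_diff algebra_simps)
    also have "\<dots> = measure_pmf.expectation p (\<lambda>x. (1 - r) * T powr r + r * T powr (r - 1) * f x)"
      using int by (subst Bochner_Integration.integral_add) (auto simp: T_def[symmetric] intro!: integrable_mult_right)
    also have "\<dots> \<le> measure_pmf.expectation p (\<lambda>x. f x powr r)"
      using int T assms by (intro expectation_pmf_mono powr_ge_scaled_tangent Bochner_Integration.integrable_add
          integrable_mult_right measure_pmf.integrable_const) auto
    finally show ?thesis by (simp add: T_def)
  qed
qed

text \<open>Links expectations, used in all estimates, with the unordered infinite sums in which E_0
  is written.\<close>

lemma infsum_pmf_mult:
  fixes f :: "'x \<Rightarrow> real"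
  assumes "integrable (measure_pmf p) f"
  shows "(\<lambda>x. pmf p x * f x) summable_on UNIV"
    and "(\<Sum>\<^sub>\<infinity>x. pmf p x * f x) = measure_pmf.expectation p f"
proof -
  have "integrable (count_space UNIV) (\<lambda>x. pmf p x * f x)"
    using assms unfolding measure_pmf_eq_density by (subst (asm) integrable_density) auto
  then have *: "Infinite_Set_Sum.abs_summable_on (\<lambda>x. pmf p x * f x) UNIV"
    by (simp add: Infinite_Set_Sum.abs_summable_on_def)
  then have "Infinite_Sum.abs_summable_on (\<lambda>x. pmf p x * f x) UNIV"
    by (rule abs_summable_equivalent[THEN iffD2])
  then show "(\<lambda>x. pmf p x * f x) summable_on UNIV"
    by (rule abs_summable_summable)
  show "(\<Sum>\<^sub>\<infinity>x. pmf p x * f x) = measure_pmf.expectation p f"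
    using infsetsum_infsum[OF *] by (simp add: pmf_expectation_eq_infsetsum)
qed

lemma nn_integral_count_space_infsum:
  fixes f :: "'x \<Rightarrow> real"
  assumes "f summable_on UNIV" "\<And>x. 0 \<le> f x"
  shows "(\<integral>\<^sup>+ x. ennreal (f x) \<partial>count_space UNIV) = ennreal (infsum f UNIV)"
proof -
  have *: "Infinite_Set_Sum.abs_summable_on f UNIV"
    by (rule abs_summable_equivalent[THEN iffD1]) (use assms in simp)
  show ?thesis
    using nn_integral_conv_infsetsum[OF * assms(2)] infsetsum_infsum[OF *] by simp
qed

section \<open>Tilted means and the Gallager sum\<close>

text \<open>For A = UNIV this is the inner sum of E_0. The indicator restricts the inputs to a
  subalphabet without renormalising P, so the mean is monotone in A and the full mean is its limit
  along finite sets.\<close>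

definition tilted_mean :: "'a pmf \<Rightarrow> ('a \<Rightarrow> 'b pmf) \<Rightarrow> 'a set \<Rightarrow> real \<Rightarrow> 'b \<Rightarrow> real" where
  "tilted_mean P W A \<rho> y = measure_pmf.expectation P (\<lambda>x. indicator A x * pmf (W x) y powr (1 / (1 + \<rho>)))"

definition gallager_sum :: "'a pmf \<Rightarrow> ('a \<Rightarrow> 'b pmf) \<Rightarrow> real \<Rightarrow> real" where
  "gallager_sum P W \<rho> = (\<Sum>\<^sub>\<infinity>y. tilted_mean P W UNIV \<rho> y powr (1 + \<rho>))"

lemma tilted_mean_integrand:
  assumes "0 \<le> \<rho>"
  shows "0 \<le> indicator A x * pmf (W x) y powr (1 / (1 + \<rho>))"
    "indicator A x * pmf (W x) y powr (1 / (1 + \<rho>)) \<le> 1"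
    "integrable (measure_pmf P) (\<lambda>x. indicator A x * pmf (W x) y powr (1 / (1 + \<rho>)))"
proof -
  show 1: "0 \<le> indicator A x * pmf (W x) y powr (1 / (1 + \<rho>))"
    "indicator A x * pmf (W x) y powr (1 / (1 + \<rho>)) \<le> 1" for x
    using assms by (auto simp: indicator_def intro!: powr_le1 pmf_le_1)
  show "integrable (measure_pmf P) (\<lambda>x. indicator A x * pmf (W x) y powr (1 / (1 + \<rho>)))"
    using 1 by (intro integrable_pmf_bounded[where B = 1]) (simp only: abs_of_nonneg)
qed

lemma gallager_E0_eq:
  assumes "0 \<le> \<rho>"
  shows "gallager_E0 b \<rho> P W = - log b (gallager_sum P W \<rho>)"
proof -
  have "(\<Sum>\<^sub>\<infinity>x. pmf P x * pmf (W x) y powr (1 / (1 + \<rho>))) = tilted_mean P W UNIV \<rho> y" for y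
    using infsum_pmf_mult(2)[of P "\<lambda>x. pmf (W x) y powr (1 / (1 + \<rho>))"]
      tilted_mean_integrand(3)[OF assms, of P UNIV W y] by (simp add: tilted_mean_def)
  then show ?thesis by (simp add: gallager_E0_def gallager_sum_def)
qed

lemma tilted_mean_nonneg: "0 \<le> tilted_mean P W A \<rho> y"
  unfolding tilted_mean_def by (intro Bochner_Integration.integral_nonneg) simp

lemma tilted_mean_mono:
  assumes "0 \<le> \<rho>" "A \<subseteq> A'"
  shows "tilted_mean P W A \<rho> y \<le> tilted_mean P W A' \<rho> y"
  unfolding tilted_mean_def
  by (intro expectation_pmf_mono tilted_mean_integrand assms mult_right_mono) (use assms in \<open>auto simp: indicator_def\<close>)

lemma tilted_mean_finite:
  assumes "finite A"
  shows "tilted_mean P W A \<rho> y = (\<Sum>x\<in>A. pmf P x * pmf (W x) y powr (1 / (1 + \<rho>)))"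
  unfolding tilted_mean_def
  using assms by (subst integral_measure_pmf_real[where A = A]) (auto simp: indicator_def mult_ac split: if_splits)

text \<open>The power mean \<open>(E W\<^sup>s)\<^sup>1\<^sup>/\<^sup>s\<close> is increasing in \<open>s\<close>.\<close>

lemma tilted_mean_powr_antimono:
  assumes "0 \<le> \<rho>" "\<rho> \<le> \<rho>'"
  shows "tilted_mean P W A \<rho>' y powr (1 + \<rho>') \<le> tilted_mean P W A \<rho> y powr (1 + \<rho>)"
proof -
  let ?r = "(1 + \<rho>') / (1 + \<rho>)"
  have r: "1 \<le> ?r" using assms by simp
  have "tilted_mean P W A \<rho>' y powr ?r \<le>
      measure_pmf.expectation P (\<lambda>x. (indicator A x * pmf (W x) y powr (1 / (1 + \<rho>'))) powr ?r)"
    unfolding tilted_mean_def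
    by (rule powr_expectation_le) (use r assms tilted_mean_integrand[of \<rho>'] in auto)
  also have "(\<lambda>x. (indicator A x * pmf (W x) y powr (1 / (1 + \<rho>'))) powr ?r) =
      (\<lambda>x. indicator A x * pmf (W x) y powr (1 / (1 + \<rho>)))"
    using assms by (auto simp: indicator_def powr_powr fun_eq_iff)
  finally have "tilted_mean P W A \<rho>' y powr ?r \<le> tilted_mean P W A \<rho> y"
    unfolding tilted_mean_def .
  then have "(tilted_mean P W A \<rho>' y powr ?r) powr (1 + \<rho>) \<le> tilted_mean P W A \<rho> y powr (1 + \<rho>)"
    using assms by (intro powr_mono2) auto
  then show ?thesis using assms by (simp add: powr_powr)
qed

lemma tilted_mean_0: "tilted_mean P W UNIV 0 y = pmf (output_pmf P W) y"
  by (simp add: tilted_mean_def output_pmf_def pmf_bind)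

text \<open>At \<rho> = 0 the tilted mean is the output probability, and the summand decreases in
  \<rho>. The output law therefore dominates the summands for every \<rho> and yields summability
  and value at most 1 of the Gallager sum.\<close>

lemma tilted_mean_powr_le:
  assumes "0 \<le> \<rho>"
  shows "tilted_mean P W A \<rho> y powr (1 + \<rho>) \<le> pmf (output_pmf P W) y"
proof -
  have "tilted_mean P W A \<rho> y powr (1 + \<rho>) \<le> tilted_mean P W A 0 y powr (1 + 0)"
    using assms by (intro tilted_mean_powr_antimono) auto
  also have "\<dots> = tilted_mean P W A 0 y" by (simp add: tilted_mean_nonneg)
  also have "\<dots> \<le> tilted_mean P W UNIV 0 y" by (rule tilted_mean_mono) auto
  finally show ?thesis by (simp add: tilted_mean_0)
qed

lemma pmf_summable_infsum: "(pmf p) summable_on UNIV" "(\<Sum>\<^sub>\<infinity>x. pmf p x) = 1"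
  using infsum_pmf_mult[of p "\<lambda>_. 1"] by auto

lemma gallager_sum_summable:
  assumes "0 \<le> \<rho>"
  shows "(\<lambda>y. tilted_mean P W UNIV \<rho> y powr (1 + \<rho>)) summable_on UNIV"
  by (rule summable_on_comparison_test[OF pmf_summable_infsum(1)[of "output_pmf P W"]])
     (use tilted_mean_powr_le[OF assms] in auto)

lemma gallager_sum_antimono:
  assumes "0 \<le> \<rho>" "\<rho> \<le> \<rho>'"
  shows "gallager_sum P W \<rho>' \<le> gallager_sum P W \<rho>"
  unfolding gallager_sum_def
  by (rule infsum_mono) (use assms in \<open>auto intro!: gallager_sum_summable tilted_mean_powr_antimono\<close>)

lemma gallager_sum_0: "gallager_sum P W 0 = 1"
  by (simp add: gallager_sum_def tilted_mean_0 pmf_summable_infsum)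

lemma tilted_mean_pos:
  assumes "0 \<le> \<rho>" "x \<in> A" "x \<in> set_pmf P" "y \<in> set_pmf (W x)"
  shows "0 < tilted_mean P W A \<rho> y"
proof -
  have "0 < (\<Sum>x\<in>{x}. pmf P x * pmf (W x) y powr (1 / (1 + \<rho>)))"
    using assms by (auto simp: pmf_positive_iff pmf_eq_0_set_pmf less_le)
  also have "\<dots> = tilted_mean P W {x} \<rho> y" by (simp add: tilted_mean_finite)
  also have "\<dots> \<le> tilted_mean P W A \<rho> y" using assms by (intro tilted_mean_mono) auto
  finally show ?thesis .
qed

lemma gallager_sum_pos:
  assumes "0 \<le> \<rho>"
  shows "0 < gallager_sum P W \<rho>"
proof -
  obtain x where x: "x \<in> set_pmf P" using set_pmf_not_empty[of P] by blast
  obtain y where y: "y \<in> set_pmf (W x)" using set_pmf_not_empty[of "W x"] by blast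
  have "0 < tilted_mean P W UNIV \<rho> y powr (1 + \<rho>)"
    using tilted_mean_pos[where A = UNIV and x = x and y = y and P = P and W = W and \<rho> = \<rho>] assms x y by simp
  also have "\<dots> = (\<Sum>\<^sub>\<infinity>y\<in>{y}. tilted_mean P W UNIV \<rho> y powr (1 + \<rho>))" by simp
  also have "\<dots> \<le> gallager_sum P W \<rho>"
    unfolding gallager_sum_def
    by (rule infsum_mono_neutral) (use gallager_sum_summable[OF assms] in auto)
  finally show ?thesis .
qed

lemma gallager_E0_mono:
  assumes "1 < b" "0 \<le> \<rho>" "\<rho> \<le> \<rho>'"
  shows "gallager_E0 b \<rho> P W \<le> gallager_E0 b \<rho>' P W"
  using assms gallager_sum_antimono[of \<rho> \<rho>' P W] gallager_sum_pos[of \<rho> P W] gallager_sum_pos[of \<rho>' P W]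
  by (simp add: gallager_E0_eq)

lemma gallager_E0_0: "gallager_E0 b 0 P W = 0"
  by (simp add: gallager_E0_eq gallager_sum_0)

lemma gallager_E0_nonneg: "1 < b \<Longrightarrow> 0 \<le> \<rho> \<Longrightarrow> 0 \<le> gallager_E0 b \<rho> P W"
  using gallager_E0_mono[of b 0 \<rho> P W] by (simp add: gallager_E0_0)


section \<open>The bound E_0(\<rho>) \<le> \<rho> I\<close>

definition nat_density :: "'a pmf \<Rightarrow> ('a \<Rightarrow> 'b pmf) \<Rightarrow> 'a \<Rightarrow> 'b \<Rightarrow> real" where
  "nat_density P W x y = ln (pmf (W x) y / pmf (output_pmf P W) y)"

lemma info_density_eq: "info_density b P W (x, y) = nat_density P W x y / ln b"
  by (simp add: info_density_def nat_density_def log_def)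

lemma output_pmf_pos:
  assumes "x \<in> set_pmf P" "y \<in> set_pmf (W x)"
  shows "0 < pmf (output_pmf P W) y"
proof -
  have "y \<in> set_pmf (output_pmf P W)" using assms by (auto simp: output_pmf_def)
  then show ?thesis by (rule pmf_positive)
qed

lemma pmf_eq_0_if_output_pmf_eq_0:
  assumes "pmf (output_pmf P W) y = 0" "x \<in> set_pmf P"
  shows "pmf (W x) y = 0"
proof (rule ccontr)
  assume "pmf (W x) y \<noteq> 0"
  then have "y \<in> set_pmf (W x)" by (simp add: set_pmf_iff)
  with assms(2) have "0 < pmf (output_pmf P W) y" by (rule output_pmf_pos)
  then show False using assms(1) by simp
qed

lemma mult_abs_ln_le_1:
  fixes w :: real
  assumes "0 \<le> w" "w \<le> 1"
  shows "\<bar>w * ln w\<bar> \<le> 1"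
proof (cases "w = 0")
  case False
  then have w: "0 < w" using assms by simp
  have "ln (1 / w) \<le> 1 / w - 1" using w by (intro ln_le_minus_one) auto
  then have "w * (- ln w) \<le> w * (1 / w)" using w by (intro mult_left_mono) (auto simp: ln_div)
  moreover have "w * ln w \<le> 0" using w assms by (intro mult_nonneg_nonpos) auto
  ultimately show ?thesis using w by simp
qed simp

text \<open>For a fixed output letter the integrand is w ln w - w ln q with w in [0, 1], hence
  bounded. This holds even if the mutual information is infinite; only the sum over y can
  diverge.\<close>

lemma integrable_density_term:
  "integrable (measure_pmf P) (\<lambda>x. pmf (W x) y * nat_density P W x y)"
proof (rule integrable_pmf_bounded[where B = "1 + \<bar>ln (pmf (output_pmf P W) y)\<bar>"])
  fix x assume x: "x \<in> set_pmf P"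
  let ?w = "pmf (W x) y" and ?q = "pmf (output_pmf P W) y"
  show "\<bar>?w * nat_density P W x y\<bar> \<le> 1 + \<bar>ln ?q\<bar>"
  proof (cases "?w = 0")
    case False
    then have w: "0 < ?w" and "y \<in> set_pmf (W x)" by (auto simp: set_pmf_iff less_le)
    then have q: "0 < ?q" using pmf_eq_0_if_output_pmf_eq_0[of P W y x] x False by (auto simp: less_le)
    have "\<bar>?w * nat_density P W x y\<bar> = \<bar>?w * ln ?w - ?w * ln ?q\<bar>"
      using w q by (simp add: nat_density_def ln_div right_diff_distrib)
    also have "\<dots> \<le> \<bar>?w * ln ?w\<bar> + \<bar>?w * ln ?q\<bar>" by linarith
    also have "\<dots> \<le> 1 + 1 * \<bar>ln ?q\<bar>"
      unfolding abs_mult[of ?w "ln ?q"] by (intro add_mono mult_abs_ln_le_1 mult_mono) (auto simp: pmf_le_1)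
    finally show ?thesis by simp
  qed simp
qed

text \<open>The contribution of the letter y to the mutual information, measured in nats. It is a
  finite number for each y.\<close>

definition output_density :: "'a pmf \<Rightarrow> ('a \<Rightarrow> 'b pmf) \<Rightarrow> 'b \<Rightarrow> real" where
  "output_density P W y = measure_pmf.expectation P (\<lambda>x. pmf (W x) y * nat_density P W x y)"

text \<open>Tangents of \<open>exp\<close> and of \<open>t \<mapsto> t\<^sup>1\<^sup>+\<^sup>\<rho>\<close>, both taken at the average density \<open>I\<close>, replace the two
  applications of Jensen's inequality behind \<open>E\<^sub>0(\<rho>) \<le> \<rho> I\<close>.\<close>

lemma tilted_mean_powr_ge:
  assumes "0 \<le> \<rho>"
  shows "exp (- \<rho> * I) * ((1 + \<rho> * I) * pmf (output_pmf P W) y - \<rho> * output_density P W y) \<le>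
    tilted_mean P W UNIV \<rho> y powr (1 + \<rho>)"
proof (cases "pmf (output_pmf P W) y = 0")
  case True
  then have "pmf (W x) y = 0" if "x \<in> set_pmf P" for x
    using that by (rule pmf_eq_0_if_output_pmf_eq_0)
  then have "output_density P W y = measure_pmf.expectation P (\<lambda>x. 0)"
    unfolding output_density_def by (intro expectation_pmf_cong) simp
  then show ?thesis using True by simp
next
  case False
  define q where "q = pmf (output_pmf P W) y"
  have q: "0 < q" using False by (simp add: q_def less_le)
  define s where "s = 1 / (1 + \<rho>)"
  have s: "0 < s" "s * (1 + \<rho>) = 1" "1 - s = \<rho> * s" using assms by (auto simp: s_def field_simps)
  define D where "D = output_density P W y / q"
  define z where "z = 1 - \<rho> * s * (D - I)"
  \<comment> \<open>Chosen so that c * w * exp (- \<rho> s (i - I)) is exactly w powr s, where i is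
    the density of the pair; the tangent of exp at 0 then bounds w powr s from below by an
    expression that is affine in i.\<close>
  define c where "c = q powr (s - 1) * exp (- (\<rho> * s * I))"
  have c: "0 < c" using q by (simp add: c_def)
  have q_eq: "measure_pmf.expectation P (\<lambda>x. pmf (W x) y) = q"
    by (simp add: q_def output_pmf_def pmf_bind)
  have intW: "integrable (measure_pmf P) (\<lambda>x. pmf (W x) y)"
    by (rule integrable_pmf_bounded[where B = 1]) (simp add: pmf_le_1)
  have "c * ((1 + \<rho> * s * I) * q - \<rho> * s * output_density P W y) =
      measure_pmf.expectation P (\<lambda>x. c * ((1 + \<rho> * s * I) * pmf (W x) y - \<rho> * s * (pmf (W x) y * nat_density P W x y)))"
    using integrable_density_term[of P W y] intW by (simp add: output_density_def q_eq)
  also have "\<dots> \<le> tilted_mean P W UNIV \<rho> y"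
    unfolding tilted_mean_def
  proof (rule expectation_pmf_mono)
    show "integrable (measure_pmf P) (\<lambda>x. c * ((1 + \<rho> * s * I) * pmf (W x) y - \<rho> * s * (pmf (W x) y * nat_density P W x y)))"
      by (intro integrable_mult_right Bochner_Integration.integrable_diff intW integrable_density_term)
    show "integrable (measure_pmf P) (\<lambda>x. indicator UNIV x * pmf (W x) y powr (1 / (1 + \<rho>)))"
      by (rule tilted_mean_integrand[OF assms])
    fix x assume x: "x \<in> set_pmf P"
    let ?w = "pmf (W x) y"
    show "c * ((1 + \<rho> * s * I) * ?w - \<rho> * s * (?w * nat_density P W x y)) \<le> indicator UNIV x * ?w powr (1 / (1 + \<rho>))"
    proof (cases "?w = 0")
      case False
      then have w: "0 < ?w" by (simp add: less_le)
      let ?i = "nat_density P W x y"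
      have i: "?i = ln ?w - ln q" using w q by (simp add: nat_density_def q_def ln_div)
      have "1 + - (\<rho> * s * (?i - I)) \<le> exp (- (\<rho> * s * (?i - I)))" by (rule exp_ge_add_one_self)
      then have "c * ?w * (1 + - (\<rho> * s * (?i - I))) \<le> c * ?w * exp (- (\<rho> * s * (?i - I)))"
        using c w by (intro mult_left_mono) auto
      also have "\<dots> = ?w powr s"
      proof -
        have "c * ?w * exp (- (\<rho> * s * (?i - I))) = exp ((s - 1) * ln q - \<rho> * s * I + ln ?w - \<rho> * s * (?i - I))"
          using q w by (simp add: c_def powr_def exp_add exp_diff exp_minus field_simps)
        also have "(s - 1) * ln q - \<rho> * s * I + ln ?w - \<rho> * s * (?i - I) = s * ln ?w"
        proof -
          have "(s - 1) * ln q - \<rho> * s * I + ln ?w - \<rho> * s * (?i - I) = ln ?w - (1 - s) * ln q - \<rho> * s * ?i"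
            by (simp add: algebra_simps)
          also have "\<dots> = s * ln ?w" unfolding i s(3)[symmetric] by (simp add: algebra_simps)
          finally show ?thesis .
        qed
        finally show ?thesis using w by (simp add: powr_def)
      qed
      finally show ?thesis by (simp add: s_def[symmetric] algebra_simps)
    qed simp
  qed
  also have "c * ((1 + \<rho> * s * I) * q - \<rho> * s * output_density P W y) = c * q * z"
    using q by (simp add: z_def D_def field_simps)
  finally have k: "c * q * z \<le> tilted_mean P W UNIV \<rho> y" .
  have cq: "(c * q) powr (1 + \<rho>) = exp (- \<rho> * I) * q"
  proof -
    have "c * q = exp (s * ln q - \<rho> * s * I)"
      using q by (simp add: c_def powr_def exp_diff exp_minus field_simps left_diff_distrib)
    then have "(c * q) powr (1 + \<rho>) = exp ((1 + \<rho>) * (s * ln q - \<rho> * s * I))" by (simp add: powr_def)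
    also have "(1 + \<rho>) * (s * ln q - \<rho> * s * I) = (s * (1 + \<rho>)) * ln q - \<rho> * I * (s * (1 + \<rho>))"
      by (simp add: algebra_simps)
    also have "\<dots> = ln q + - \<rho> * I" by (simp add: s(2))
    also have "exp (ln q + - \<rho> * I) = exp (- \<rho> * I) * q" using q by (simp only: exp_add exp_ln mult.commute)
    finally show ?thesis .
  qed
  have lin: "1 + (1 + \<rho>) * (z - 1) = 1 - \<rho> * (D - I)"
  proof -
    have "(1 + \<rho>) * (z - 1) = - (\<rho> * (s * (1 + \<rho>)) * (D - I))" by (simp add: z_def algebra_simps)
    then show ?thesis by (simp add: s(2))
  qed
  have "exp (- \<rho> * I) * q * (1 - \<rho> * (D - I)) \<le> tilted_mean P W UNIV \<rho> y powr (1 + \<rho>)"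
  \<comment> \<open>The lower bound c q z for the tilted mean is useful only for positive z. For z
    \<le> 0 the tangent at 1 is nonpositive, so the claimed lower bound is trivial.\<close>
  proof (cases "0 < z")
    case True
    have "exp (- \<rho> * I) * q * (1 - \<rho> * (D - I)) \<le> exp (- \<rho> * I) * q * z powr (1 + \<rho>)"
      unfolding lin[symmetric] using q True assms by (intro mult_left_mono powr_ge_tangent) auto
    also have "\<dots> = (c * q * z) powr (1 + \<rho>)"
      using c q True cq by (simp add: powr_mult)
    also have "\<dots> \<le> tilted_mean P W UNIV \<rho> y powr (1 + \<rho>)"
      using k c q True assms by (intro powr_mono2) auto
    finally show ?thesis .
  next
    case False
    then have "(1 + \<rho>) * (z - 1) \<le> (1 + \<rho>) * (- 1)" using assms by (intro mult_left_mono) auto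
    then have "1 - \<rho> * (D - I) \<le> 0" unfolding lin[symmetric] using assms by simp
    then have "exp (- \<rho> * I) * q * (1 - \<rho> * (D - I)) \<le> 0" using q by (intro mult_nonneg_nonpos) auto
    also have "0 \<le> tilted_mean P W UNIV \<rho> y powr (1 + \<rho>)" by simp
    finally show ?thesis .
  qed
  moreover have "exp (- \<rho> * I) * q * (1 - \<rho> * (D - I)) =
      exp (- \<rho> * I) * ((1 + \<rho> * I) * q - \<rho> * output_density P W y)"
    using q by (simp add: D_def field_simps)
  ultimately show ?thesis unfolding q_def by (simp only:)
qed

lemma nn_integral_joint_pmf:
  "(\<integral>\<^sup>+ z. f z \<partial>measure_pmf (joint_pmf P W)) =
    (\<integral>\<^sup>+ y. \<integral>\<^sup>+ x. ennreal (pmf (W x) y) * f (x, y) \<partial>measure_pmf P \<partial>count_space UNIV)"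
proof -
  have "(\<integral>\<^sup>+ z. f z \<partial>measure_pmf (joint_pmf P W)) =
      (\<integral>\<^sup>+ z. ennreal (pmf (joint_pmf P W) z) * f z \<partial>count_space UNIV)"
    by (rule nn_integral_measure_pmf)
  also have "\<dots> = (\<integral>\<^sup>+ y. \<integral>\<^sup>+ x. ennreal (pmf (joint_pmf P W) (x, y)) * f (x, y) \<partial>count_space UNIV \<partial>count_space UNIV)"
    by (rule nn_integral_snd_count_space[symmetric])
  also have "\<dots> = (\<integral>\<^sup>+ y. \<integral>\<^sup>+ x. ennreal (pmf (W x) y) * f (x, y) \<partial>measure_pmf P \<partial>count_space UNIV)"
    by (simp add: nn_integral_measure_pmf pmf_joint_pmf ennreal_mult' mult.assoc)
  finally show ?thesis .
qed

text \<open>From ln (q / w) \<le> q / w - 1 a pair contributes at most q(y) / ln b. This does not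
  involve x, and the q(y) sum to 1.\<close>

lemma info_density_neg_finite:
  assumes "1 < b"
  shows "(\<integral>\<^sup>+ z. ennreal (- info_density b P W z) \<partial>measure_pmf (joint_pmf P W)) \<le> ennreal (1 / ln b)"
proof -
  have lnb: "0 < ln b" using assms by simp
  have le: "ennreal (pmf (W x) y) * ennreal (- info_density b P W (x, y)) \<le> ennreal (pmf (output_pmf P W) y / ln b)" for x y
  proof (cases "pmf (W x) y = 0")
    case False
    let ?w = "pmf (W x) y" and ?q = "pmf (output_pmf P W) y"
    have w: "0 < ?w" using False by (simp add: less_le)
    have "?w * (- info_density b P W (x, y)) \<le> ?q / ln b"
    proof (cases "?q = 0")
      case True
      then show ?thesis by (simp add: info_density_def log_def)
    next
      case False
      then have q: "0 < ?q" by (simp add: less_le)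
      have "ln (?q / ?w) \<le> ?q / ?w - 1" using w q by (intro ln_le_minus_one) auto
      then have "?w * ln (?q / ?w) \<le> ?w * (?q / ?w)" using w by (intro mult_left_mono) auto
      then have "?w * (- ln (?w / ?q)) \<le> ?q" using w q by (simp add: ln_div)
      then have "?w * (- ln (?w / ?q)) / ln b \<le> ?q / ln b" using lnb by (intro divide_right_mono) auto
      then show ?thesis by (simp add: info_density_def log_def)
    qed
    then show ?thesis by (simp add: ennreal_mult'[symmetric] ennreal_leI)
  qed simp
  have "(\<integral>\<^sup>+ z. ennreal (- info_density b P W z) \<partial>measure_pmf (joint_pmf P W)) \<le>
      (\<integral>\<^sup>+ y. \<integral>\<^sup>+ x. ennreal (pmf (output_pmf P W) y / ln b) \<partial>measure_pmf P \<partial>count_space UNIV)"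
    unfolding nn_integral_joint_pmf by (intro nn_integral_mono le)
  also have "\<dots> = (\<integral>\<^sup>+ y. ennreal (1 / ln b) * ennreal (pmf (output_pmf P W) y) \<partial>count_space UNIV)"
    using lnb by (simp add: ennreal_mult'[symmetric] measure_pmf.emeasure_space_1)
  also have "\<dots> = ennreal (1 / ln b)" by (simp add: nn_integral_cmult nn_integral_pmf measure_pmf.emeasure_space_1)
  finally show ?thesis .
qed

text \<open>For finite I the tangent bounds are summed over all y. The weights q(y) add up to 1 and
  the output densities to I, so 1 + \<rho> I - \<rho> I = 1 remains and the Gallager sum is at least
  exp (- \<rho> I), with I in nats.\<close>

lemma gallager_E0_le:
  assumes b: "1 < b" and \<rho>: "0 < \<rho>"
  shows "ereal (gallager_E0 b \<rho> P W) \<le> ereal \<rho> * mutual_info b P W"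
proof (cases "mutual_info b P W = \<infinity>")
  case True
  then show ?thesis using \<rho> by simp
next
  case False
  let ?J = "joint_pmf P W" and ?j = "info_density b P W"
  let ?pos = "\<integral>\<^sup>+ z. ennreal (?j z) \<partial>measure_pmf ?J" and ?neg = "\<integral>\<^sup>+ z. ennreal (- ?j z) \<partial>measure_pmf ?J"
  have lnb: "0 < ln b" using b by simp
  have neg: "?neg \<noteq> \<infinity>" using info_density_neg_finite[OF b, of P W] by (auto simp: top_unique)
  have pos: "?pos \<noteq> \<infinity>"
    using False neg by (cases ?neg) (auto simp: mutual_info_def)
  have int: "integrable (measure_pmf ?J) ?j"
    unfolding real_integrable_def using pos neg by auto
  define I where "I = measure_pmf.expectation ?J ?j"
  have I: "mutual_info b P W = ereal I"
  proof -
    have "I = enn2real ?pos - enn2real ?neg"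
      unfolding I_def by (rule real_lebesgue_integral_def[OF int])
    then show ?thesis using pos neg unfolding mutual_info_def
      by (cases ?pos; cases ?neg) auto
  qed
  let ?f = "\<lambda>y x. pmf P x * (pmf (W x) y * nat_density P W x y)"
  have intn: "integrable (measure_pmf ?J) (\<lambda>z. ln b * ?j z)" by (intro integrable_mult_right int)
  have joint: "pmf ?J (x, y) * (ln b * ?j (x, y)) = ?f y x" for x y
    using lnb by (simp add: pmf_joint_pmf info_density_eq)
  \<comment> \<open>Finiteness of I makes the joint family summable, which licenses summing over x
    first and y afterwards.\<close>
  have summ: "(\<lambda>(x, y). ?f y x) summable_on UNIV \<times> UNIV"
    using infsum_pmf_mult(1)[OF intn] joint by (simp add: split_beta' flip: joint)
  then have summ': "(\<lambda>(y, x). ?f y x) summable_on UNIV \<times> UNIV"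
    by (subst summable_on_swap) simp
  have od: "(\<Sum>\<^sub>\<infinity>x. ?f y x) = output_density P W y" for y
    unfolding output_density_def by (rule infsum_pmf_mult(2)[OF integrable_density_term])
  have od_summable: "output_density P W summable_on UNIV"
    using summable_on_Sigma_banach[OF summ'] by (simp add: od[abs_def])
  have "(\<Sum>\<^sub>\<infinity>y. output_density P W y) = (\<Sum>\<^sub>\<infinity>(y, x)\<in>UNIV \<times> UNIV. ?f y x)"
    using infsum_Sigma_banach[OF summ'] by (simp add: od)
  also have "\<dots> = (\<Sum>\<^sub>\<infinity>(x, y)\<in>UNIV \<times> UNIV. ?f y x)"
    using infsum_swap_banach[OF summ'] infsum_Sigma_banach[OF summ] infsum_Sigma_banach[OF summ'] by simp
  also have "\<dots> = (\<Sum>\<^sub>\<infinity>z. pmf ?J z * (ln b * ?j z))"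
    by (simp add: split_beta' flip: joint)
  also have "\<dots> = ln b * I"
    using infsum_pmf_mult(2)[OF intn] by (simp add: I_def)
  finally have od_sum: "(\<Sum>\<^sub>\<infinity>y. output_density P W y) = ln b * I" .
  define I' where "I' = ln b * I"
  have "exp (- \<rho> * I') = (\<Sum>\<^sub>\<infinity>y. exp (- \<rho> * I') * ((1 + \<rho> * I') * pmf (output_pmf P W) y - \<rho> * output_density P W y))"
  proof -
    have "(\<Sum>\<^sub>\<infinity>y. (1 + \<rho> * I') * pmf (output_pmf P W) y + - \<rho> * output_density P W y) =
        (\<Sum>\<^sub>\<infinity>y. (1 + \<rho> * I') * pmf (output_pmf P W) y) + (\<Sum>\<^sub>\<infinity>y. - \<rho> * output_density P W y)"
      by (intro infsum_add summable_on_cmult_right od_summable pmf_summable_infsum(1))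
    also have "\<dots> = 1"
      by (simp only: infsum_cmult_right' pmf_summable_infsum(2) od_sum I'_def) (simp add: algebra_simps)
    finally show ?thesis by (simp add: infsum_cmult_right')
  qed
  also have "\<dots> \<le> gallager_sum P W \<rho>"
    unfolding gallager_sum_def
  proof (rule infsum_mono)
    have "(\<lambda>y. exp (- \<rho> * I') * ((1 + \<rho> * I') * pmf (output_pmf P W) y + - \<rho> * output_density P W y)) summable_on UNIV"
      by (intro summable_on_cmult_right summable_on_add od_summable pmf_summable_infsum(1))
    then show "(\<lambda>y. exp (- \<rho> * I') * ((1 + \<rho> * I') * pmf (output_pmf P W) y - \<rho> * output_density P W y)) summable_on UNIV"
      by simp
  qed (use \<rho> in \<open>auto intro: gallager_sum_summable tilted_mean_powr_ge[simplified]\<close>)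
  finally have "- (\<rho> * I') \<le> ln (gallager_sum P W \<rho>)"
    using gallager_sum_pos[of \<rho> P W] \<rho> by (simp add: ln_ge_iff)
  then have "- (\<rho> * I) \<le> ln (gallager_sum P W \<rho>) / ln b"
    using lnb by (simp add: I'_def field_simps)
  then show ?thesis using \<rho> by (simp add: I gallager_E0_eq log_def)
qed


section \<open>The slope of E_0 at 0\<close>

text \<open>A first order expansion in \<rho> whose error is uniform in w, so it survives averaging
  over an infinite input alphabet. With t = \<rho> / (1 + \<rho>) \<le> 1/2 the Taylor remainder is
  t^2 / 2 times w exp(z) (ln w)^2. The factors are bounded by w powr (-1/2) for exp(z) and 16 w powr
  (-1/2) for (ln w)^2, which gives 16 t^2 / 2 \<le> 8 \<rho>^2.\<close>

lemma powr_expansion_le: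
  fixes w \<rho> :: real
  assumes w: "0 \<le> w" "w \<le> 1" and \<rho>: "0 \<le> \<rho>" "\<rho> \<le> 1"
  shows "w powr (1 / (1 + \<rho>)) \<le> w - \<rho> / (1 + \<rho>) * (w * ln w) + 8 * \<rho>\<^sup>2"
proof (cases "w = 0")
  case False
  then have w0: "0 < w" using w by simp
  define t where "t = \<rho> / (1 + \<rho>)"
  have t: "0 \<le> t" "t \<le> 1 / 2" "t \<le> \<rho>" "1 / (1 + \<rho>) = 1 - t" using \<rho> by (auto simp: t_def field_simps)
  define z where "z = - t * ln w"
  have lnw: "ln w \<le> 0" using w0 w by simp
  have z0: "0 \<le> z" using t lnw by (simp add: z_def mult_nonneg_nonpos)
  have "exp z \<le> 1 + z + z\<^sup>2 / 2 * exp z"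
  proof -
    have "1 - z + (z\<^sup>2 / 2 - z\<^sup>2 / 2) \<le> exp (- z)" using exp_ge_add_one_self[of "- z"] by simp
    obtain u where u: "\<bar>u\<bar> \<le> \<bar>z\<bar>" "exp z = (\<Sum>m<2. z ^ m / fact m) + exp u / fact 2 * z ^ 2"
      using Maclaurin_exp_le[of z 2] by auto
    have "u \<le> z" using u(1) z0 by linarith
    then have "exp u \<le> exp z" by simp
    then have "exp u / 2 * z\<^sup>2 \<le> exp z / 2 * z\<^sup>2" by (intro mult_right_mono divide_right_mono) auto
    then show ?thesis using u(2) by (simp add: numeral_2_eq_2 algebra_simps)
  qed
  then have "w * exp z \<le> w * (1 + z + z\<^sup>2 / 2 * exp z)" using w0 by (intro mult_left_mono) auto
  also have "w * exp z = w powr (1 / (1 + \<rho>))"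
  proof -
    have "w * exp z = exp (ln w + z)" using w0 by (simp add: exp_add)
    also have "ln w + z = (1 - t) * ln w" by (simp add: z_def algebra_simps)
    finally show ?thesis using w0 t by (simp add: powr_def)
  qed
  finally have 1: "w powr (1 / (1 + \<rho>)) \<le> w - t * (w * ln w) + w * z\<^sup>2 / 2 * exp z"
    by (simp add: z_def algebra_simps)
  have "w * exp z * (ln w)\<^sup>2 \<le> 16"
  proof -
    have "exp z \<le> exp (- ln w / 2)" using t lnw mult_right_mono_neg[of t "1/2" "ln w"] by (simp add: z_def)
    moreover have "(ln w)\<^sup>2 \<le> (4 * exp (- ln w / 4))\<^sup>2"
    proof -
      have "- ln w / 4 \<le> exp (- ln w / 4)" using exp_ge_add_one_self[of "- ln w / 4"] by linarith
      then have "(- ln w)\<^sup>2 \<le> (4 * exp (- ln w / 4))\<^sup>2" using lnw by (intro power_mono) auto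
      then show ?thesis by simp
    qed
    ultimately have "exp z * (ln w)\<^sup>2 \<le> exp (- ln w / 2) * (4 * exp (- ln w / 4))\<^sup>2"
      by (intro mult_mono) auto
    also have "\<dots> = 16 * exp (- ln w)"
      by (simp add: power_mult_distrib flip: exp_double exp_add)
    also have "\<dots> = 16 / w" using w0 by (simp add: exp_minus divide_inverse)
    finally have "w * (exp z * (ln w)\<^sup>2) \<le> w * (16 / w)" using w0 by (intro mult_left_mono) auto
    then show ?thesis using w0 by (simp add: mult.assoc)
  qed
  then have "t\<^sup>2 / 2 * (w * exp z * (ln w)\<^sup>2) \<le> t\<^sup>2 / 2 * 16" by (intro mult_left_mono) auto
  moreover have "w * z\<^sup>2 / 2 * exp z = t\<^sup>2 / 2 * (w * exp z * (ln w)\<^sup>2)"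
    by (simp add: z_def power_mult_distrib)
  moreover have "t\<^sup>2 \<le> \<rho>\<^sup>2" using t by (intro power_mono) auto
  ultimately have "w * z\<^sup>2 / 2 * exp z \<le> 8 * \<rho>\<^sup>2" by linarith
  then show ?thesis using 1 unfolding t_def by linarith
qed (use \<rho> in auto)

text \<open>Only a lower bound for the difference quotient at 0 is wanted, so the tilted mean is
  majorised by a smooth function of \<rho> and the derivative of that function is computed
  instead.\<close>

lemma tilted_mean_deriv:
  fixes y :: 'b and P :: "'a pmf" and W :: "'a \<Rightarrow> 'b pmf"
  obtains g where "(g \<longlongrightarrow> output_density P W y) (at_right 0)"
    "\<And>\<rho>. 0 < \<rho> \<Longrightarrow> \<rho> \<le> 1 \<Longrightarrow> g \<rho> \<le> (pmf (output_pmf P W) y - tilted_mean P W UNIV \<rho> y powr (1 + \<rho>)) / \<rho>"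
proof (cases "pmf (output_pmf P W) y = 0")
  case True
  then have "pmf (W x) y = 0" if "x \<in> set_pmf P" for x
    using that by (rule pmf_eq_0_if_output_pmf_eq_0)
  then have "output_density P W y = measure_pmf.expectation P (\<lambda>x. 0)"
    unfolding output_density_def by (intro expectation_pmf_cong) simp
  moreover have "tilted_mean P W UNIV \<rho> y powr (1 + \<rho>) = 0" if "0 < \<rho>" for \<rho>
    using tilted_mean_powr_le[of \<rho> P W UNIV y] that True
    by (metis less_imp_le order_antisym_conv powr_ge_zero)
  ultimately show ?thesis using True by (intro that[of "\<lambda>_. 0"]) auto
next
  case False
  define q where "q = pmf (output_pmf P W) y"
  have q: "0 < q" using False by (simp add: q_def less_le)
  have q_eq: "measure_pmf.expectation P (\<lambda>x. pmf (W x) y) = q"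
    by (simp add: q_def output_pmf_def pmf_bind)
  have intW: "integrable (measure_pmf P) (\<lambda>x. pmf (W x) y)"
    by (rule integrable_pmf_bounded[where B = 1]) (simp add: pmf_le_1)
  have intL: "integrable (measure_pmf P) (\<lambda>x. pmf (W x) y * ln (pmf (W x) y))"
    by (rule integrable_pmf_bounded[where B = 1]) (simp add: mult_abs_ln_le_1 pmf_le_1)
  define h where "h = - measure_pmf.expectation P (\<lambda>x. pmf (W x) y * ln (pmf (W x) y))"
  have h0: "0 \<le> h"
  proof -
    have "0 \<le> measure_pmf.expectation P (\<lambda>x. - (pmf (W x) y * ln (pmf (W x) y)))"
    proof (intro Bochner_Integration.integral_nonneg)
      fix x
      show "0 \<le> - (pmf (W x) y * ln (pmf (W x) y))"
        by (cases "pmf (W x) y = 0") (auto simp: pmf_le_1 less_le mult_nonneg_nonpos)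
    qed
    then show ?thesis by (simp add: h_def)
  qed
  have od: "output_density P W y = - (h + q * ln q)"
  proof -
    have "output_density P W y = measure_pmf.expectation P (\<lambda>x. pmf (W x) y * ln (pmf (W x) y) - pmf (W x) y * ln q)"
      unfolding output_density_def
    proof (rule expectation_pmf_cong)
      fix x
      show "pmf (W x) y * nat_density P W x y = pmf (W x) y * ln (pmf (W x) y) - pmf (W x) y * ln q"
        using q by (cases "pmf (W x) y = 0")
          (auto simp: nat_density_def q_def[symmetric] ln_div less_le right_diff_distrib)
    qed
    also have "\<dots> = - h - q * ln q"
      using intW intL by (simp add: h_def q_eq)
    finally show ?thesis by simp
  qed
  \<comment> \<open>The average over P of the uniform expansion: q is the mean of w and h the mean
    of - w ln w. The power (1 + \<rho>) of m is written as exp of a logarithm to differentiate it;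
    its derivative at 0 is h + q ln q, the negative of the output density.\<close>
  define m where "m = (\<lambda>\<rho>. q + \<rho> / (1 + \<rho>) * h + 8 * \<rho>\<^sup>2 :: real)"
  define g where "g = (\<lambda>\<rho>. (q - exp ((1 + \<rho>) * ln (m \<rho>))) / \<rho>)"
  have mpos: "0 < m \<rho>" if "0 \<le> \<rho>" for \<rho>
    unfolding m_def using q h0 that by (intro add_pos_nonneg) auto
  have "((\<lambda>\<rho>. exp ((1 + \<rho>) * ln (m \<rho>))) has_real_derivative h + q * ln q) (at 0)"
    unfolding m_def using q by (auto intro!: derivative_eq_intros simp: field_simps)
  then have "((\<lambda>\<rho>. (exp ((1 + \<rho>) * ln (m \<rho>)) - q) / \<rho>) \<longlongrightarrow> h + q * ln q) (at 0)"
    unfolding has_field_derivative_iff using q by (simp add: m_def)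
  then have "((\<lambda>\<rho>. - ((exp ((1 + \<rho>) * ln (m \<rho>)) - q) / \<rho>)) \<longlongrightarrow> - (h + q * ln q)) (at 0)"
    by (rule tendsto_minus)
  moreover have "(\<lambda>\<rho>. - ((exp ((1 + \<rho>) * ln (m \<rho>)) - q) / \<rho>)) = g"
    unfolding g_def by (simp only: minus_divide_left minus_diff_eq)
  ultimately have "(g \<longlongrightarrow> - (h + q * ln q)) (at 0)" by simp
  then have lim: "(g \<longlongrightarrow> output_density P W y) (at_right 0)"
    unfolding od by (rule tendsto_within_subset) auto
  show ?thesis
  proof (rule that[OF lim])
    fix \<rho> :: real assume \<rho>: "0 < \<rho>" "\<rho> \<le> 1"
    have "tilted_mean P W UNIV \<rho> y \<le>
        measure_pmf.expectation P (\<lambda>x. pmf (W x) y - \<rho> / (1 + \<rho>) * (pmf (W x) y * ln (pmf (W x) y)) + 8 * \<rho>\<^sup>2)"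
      unfolding tilted_mean_def
    proof (rule expectation_pmf_mono)
      show "integrable (measure_pmf P) (\<lambda>x. indicator UNIV x * pmf (W x) y powr (1 / (1 + \<rho>)))"
        by (rule tilted_mean_integrand) (use \<rho> in auto)
      show "integrable (measure_pmf P) (\<lambda>x. pmf (W x) y - \<rho> / (1 + \<rho>) * (pmf (W x) y * ln (pmf (W x) y)) + 8 * \<rho>\<^sup>2)"
        by (intro Bochner_Integration.integrable_add Bochner_Integration.integrable_diff integrable_mult_right
            intW intL measure_pmf.integrable_const)
      show "indicator UNIV x * pmf (W x) y powr (1 / (1 + \<rho>)) \<le>
          pmf (W x) y - \<rho> / (1 + \<rho>) * (pmf (W x) y * ln (pmf (W x) y)) + 8 * \<rho>\<^sup>2" for x
        using powr_expansion_le[of "pmf (W x) y" \<rho>] \<rho> by (simp add: pmf_le_1)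
    qed
    also have "\<dots> = m \<rho>"
      using intW intL by (simp add: m_def h_def q_eq)
    finally have "tilted_mean P W UNIV \<rho> y powr (1 + \<rho>) \<le> m \<rho> powr (1 + \<rho>)"
      using \<rho> by (intro powr_mono2) (auto simp: tilted_mean_nonneg)
    also have "\<dots> = exp ((1 + \<rho>) * ln (m \<rho>))" using mpos[of \<rho>] \<rho> by (simp add: powr_def)
    finally show "g \<rho> \<le> (pmf (output_pmf P W) y - tilted_mean P W UNIV \<rho> y powr (1 + \<rho>)) / \<rho>"
      using \<rho> by (simp add: g_def q_def divide_right_mono)
  qed
qed

text \<open>Each difference q - tilted_mean powr (1 + \<rho>) is nonnegative, so a finite sum of
  them is at most 1 - F \<le> - ln F for the Gallager sum F. Dividing by \<rho> and letting \<rho>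
  tend to 0 needs an exchange with a finite sum only.\<close>

lemma sum_output_density_le:
  assumes b: "1 < b" and F: "finite F"
    and le: "\<And>\<rho>. 0 < \<rho> \<Longrightarrow> \<rho> \<le> 1 \<Longrightarrow> gallager_E0 b \<rho> P W \<le> \<rho> * r"
  shows "(\<Sum>y\<in>F. output_density P W y) \<le> r * ln b"
proof -
  have lnb: "0 < ln b" using b by simp
  have "\<forall>y. \<exists>g. (g \<longlongrightarrow> output_density P W y) (at_right 0) \<and>
    (\<forall>\<rho>. 0 < \<rho> \<longrightarrow> \<rho> \<le> 1 \<longrightarrow> g \<rho> \<le> (pmf (output_pmf P W) y - tilted_mean P W UNIV \<rho> y powr (1 + \<rho>)) / \<rho>)"
    using tilted_mean_deriv[of P W] by metis
  then obtain g where lim: "\<And>y. (g y \<longlongrightarrow> output_density P W y) (at_right 0)"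
    and g: "\<And>y \<rho>. 0 < \<rho> \<Longrightarrow> \<rho> \<le> 1 \<Longrightarrow>
      g y \<rho> \<le> (pmf (output_pmf P W) y - tilted_mean P W UNIV \<rho> y powr (1 + \<rho>)) / \<rho>"
    by metis
  have bound: "(\<Sum>y\<in>F. g y \<rho>) \<le> r * ln b" if \<rho>: "0 < \<rho>" "\<rho> \<le> 1" for \<rho>
  proof -
    let ?d = "\<lambda>y. pmf (output_pmf P W) y - tilted_mean P W UNIV \<rho> y powr (1 + \<rho>)"
    have s1: "(\<lambda>y. - (tilted_mean P W UNIV \<rho> y powr (1 + \<rho>))) summable_on UNIV"
      using gallager_sum_summable[of \<rho> P W] \<rho> by (simp add: summable_on_uminus)
    have s: "?d summable_on UNIV"
      using summable_on_add[OF pmf_summable_infsum(1)[of "output_pmf P W"] s1] by simp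
    have "(\<Sum>y\<in>F. ?d y) = (\<Sum>\<^sub>\<infinity>y\<in>F. ?d y)" using F by simp
    also have "\<dots> \<le> (\<Sum>\<^sub>\<infinity>y. ?d y)"
      using s F tilted_mean_powr_le[of \<rho> P W UNIV] \<rho> by (intro infsum_mono_neutral) auto
    also have "\<dots> = 1 - gallager_sum P W \<rho>"
      using infsum_add[OF pmf_summable_infsum(1)[of "output_pmf P W"] s1]
      by (simp add: gallager_sum_def pmf_summable_infsum infsum_uminus)
    also have "\<dots> \<le> - ln (gallager_sum P W \<rho>)"
      using ln_le_minus_one[OF gallager_sum_pos, of \<rho> P W] \<rho> by simp
    also have "\<dots> = gallager_E0 b \<rho> P W * ln b"
      using \<rho> lnb by (simp add: gallager_E0_eq log_def)
    also have "\<dots> \<le> \<rho> * r * ln b"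
      using le[OF \<rho>] lnb by (intro mult_right_mono) auto
    finally have "(\<Sum>y\<in>F. ?d y) / \<rho> \<le> r * ln b" using \<rho> by (simp add: field_simps)
    moreover have "(\<Sum>y\<in>F. g y \<rho>) \<le> (\<Sum>y\<in>F. ?d y / \<rho>)"
      by (intro sum_mono g \<rho>)
    ultimately show ?thesis by (simp add: sum_divide_distrib)
  qed
  have "((\<lambda>\<rho>. \<Sum>y\<in>F. g y \<rho>) \<longlongrightarrow> (\<Sum>y\<in>F. output_density P W y)) (at_right 0)"
    by (intro tendsto_sum lim)
  moreover have "eventually (\<lambda>\<rho>. (\<Sum>y\<in>F. g y \<rho>) \<le> r * ln b) (at_right 0)"
    unfolding eventually_at_right_field using bound by (intro exI[of _ 1]) auto
  ultimately show ?thesis by (rule tendsto_upperbound) simp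
qed

text \<open>If E_0(\<rho>) \<le> \<rho> r on (0, 1], all finite partial sums of output densities are
  at most r in base b. The negative part of the density is always finite, so the positive part is
  finite too, and I \<le> r follows without assuming that I is finite.\<close>

lemma ex_gallager_E0_gt:
  assumes b: "1 < b" and r: "ereal r < mutual_info b P W"
  obtains \<rho> where "0 < \<rho>" "\<rho> \<le> 1" "\<rho> * r < gallager_E0 b \<rho> P W"
proof -
  have False if "\<nexists>\<rho>. 0 < \<rho> \<and> \<rho> \<le> 1 \<and> \<rho> * r < gallager_E0 b \<rho> P W"
  proof -
    have le: "gallager_E0 b \<rho> P W \<le> \<rho> * r" if "0 < \<rho>" "\<rho> \<le> 1" for \<rho>
      using \<open>\<nexists>\<rho>. _ \<rho>\<close> that by force
    have lnb: "0 < ln b" using b by simp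
    have r0: "0 \<le> r" using le[of 1] gallager_E0_nonneg[OF b, of 1 P W] by simp
    let ?J = "joint_pmf P W" and ?j = "info_density b P W"
    let ?pos = "\<integral>\<^sup>+ z. ennreal (?j z) \<partial>measure_pmf ?J" and ?neg = "\<integral>\<^sup>+ z. ennreal (- ?j z) \<partial>measure_pmf ?J"
    let ?p = "\<lambda>y. measure_pmf.expectation P (\<lambda>x. pmf (W x) y * max 0 (?j (x, y)))"
    let ?n = "\<lambda>y. measure_pmf.expectation P (\<lambda>x. pmf (W x) y * max 0 (- ?j (x, y)))"
    have intj: "integrable (measure_pmf P) (\<lambda>x. pmf (W x) y * ?j (x, y))" for y
      using integrable_divide[OF integrable_density_term[of P W y], of "ln b"] by (simp add: info_density_eq)
    have maxp: "pmf (W x) y * max 0 (?j (x, y)) = max 0 (pmf (W x) y * ?j (x, y))"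
      and maxn: "pmf (W x) y * max 0 (- ?j (x, y)) = max 0 (- (pmf (W x) y * ?j (x, y)))" for x y
      by (auto simp: max_mult_distrib_left)
    have intp: "integrable (measure_pmf P) (\<lambda>x. pmf (W x) y * max 0 (?j (x, y)))"
      and intn: "integrable (measure_pmf P) (\<lambda>x. pmf (W x) y * max 0 (- ?j (x, y)))" for y
      unfolding maxp maxn by (intro Bochner_Integration.integrable_max intj Bochner_Integration.integrable_minus integrable_zero)+
    have mult_max: "ennreal w * ennreal t = ennreal (w * max 0 t)" if "0 \<le> w" for w t :: real
      using that by (cases "0 \<le> t") (auto simp: ennreal_mult' max_def ennreal_neg)
    have p0: "0 \<le> ?p y" and n0: "0 \<le> ?n y" for y
      by (auto intro!: Bochner_Integration.integral_nonneg)
    \<comment> \<open>Bounds on the signed density turn into bounds on its positive part once the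
      negative part is added.\<close>
    have pn: "?p y = ?n y + output_density P W y / ln b" for y
    proof -
      have "?p y - ?n y = measure_pmf.expectation P (\<lambda>x. pmf (W x) y * ?j (x, y))"
        by (subst Bochner_Integration.integral_diff[symmetric, OF intp intn])
          (auto intro!: Bochner_Integration.integral_cong simp: max_def algebra_simps)
      also have "\<dots> = output_density P W y / ln b"
        by (simp add: info_density_eq output_density_def)
      finally show ?thesis by simp
    qed
    have "(\<integral>\<^sup>+ x. ennreal (pmf (W x) y) * ennreal (?j (x, y)) \<partial>measure_pmf P) = ennreal (?p y)" for y
      by (subst nn_integral_eq_integral[symmetric, OF intp])
         (auto intro!: nn_integral_cong simp: mult_max)
    then have pos_eq: "?pos = (\<integral>\<^sup>+ y. ennreal (?p y) \<partial>count_space UNIV)"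
      by (simp add: nn_integral_joint_pmf)
    have "(\<integral>\<^sup>+ x. ennreal (pmf (W x) y) * ennreal (- ?j (x, y)) \<partial>measure_pmf P) = ennreal (?n y)" for y
      by (subst nn_integral_eq_integral[symmetric, OF intn])
         (auto intro!: nn_integral_cong simp: mult_max)
    then have neg_eq: "?neg = (\<integral>\<^sup>+ y. ennreal (?n y) \<partial>count_space UNIV)"
      by (simp add: nn_integral_joint_pmf)
    have neg_fin: "?neg < \<infinity>" using info_density_neg_finite[OF b, of P W] by (auto simp: top_unique less_top[symmetric])
    then obtain N where N: "0 \<le> N" "?neg = ennreal N" by (cases ?neg) auto
    have bound: "(\<Sum>y\<in>F. ?p y) \<le> N + r" if F: "finite F" for F
    proof -
      have "ennreal (\<Sum>y\<in>F. ?n y) = (\<integral>\<^sup>+ y. ennreal (?n y) * indicator F y \<partial>count_space UNIV)"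
        using F n0 by (simp add: nn_integral_count_space_indicator[symmetric] nn_integral_count_space_finite)
      also have "\<dots> \<le> ennreal N"
        unfolding N(2)[symmetric] neg_eq by (intro nn_integral_mono) (auto simp: indicator_def)
      finally have "(\<Sum>y\<in>F. ?n y) \<le> N" using N(1) by (simp add: ennreal_le_iff)
      moreover have "(\<Sum>y\<in>F. output_density P W y / ln b) \<le> r"
        using sum_output_density_le[OF b F le] lnb by (simp add: sum_divide_distrib[symmetric] divide_le_eq)
      ultimately show ?thesis by (simp add: pn sum.distrib)
    qed
    have summ: "?p summable_on UNIV"
      by (rule nonneg_bdd_above_summable_on) (use p0 bound in \<open>auto intro!: bdd_aboveI2[where M = "N + r"]\<close>)
    have "?pos \<le> ennreal (N + r)"
    proof -
      have "?pos = ennreal (infsum ?p UNIV)"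
        unfolding pos_eq by (rule nn_integral_count_space_infsum[OF summ p0])
      also have "\<dots> \<le> ennreal (N + r)"
        by (intro ennreal_leI infsum_le_finite_sums summ bound)
      finally show ?thesis .
    qed
    then have "enn2ereal ?pos \<le> ereal (N + r)"
      unfolding less_eq_ennreal.rep_eq using N(1) r0 by (simp only: enn2ereal_ennreal add_nonneg_nonneg)
    then have "mutual_info b P W \<le> ereal r"
      unfolding mutual_info_def N(2) using N(1)
      by (cases "enn2ereal ?pos") (auto simp: enn2ereal_ennreal)
    then show False using r by simp
  qed
  then show ?thesis using that by blast
qed

subsection \<open>Product channels and tilted laws\<close>

lemma pmf_memoryless:
  "pmf (memoryless n W x) y =
    (if \<forall>i. i \<notin> {..<n} \<longrightarrow> y i = undefined then \<Prod>i<n. pmf (W (x i)) (y i) else 0)"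
  unfolding memoryless_def by (rule pmf_Pi) simp

lemma pmf_iid_pmf:
  "pmf (iid_pmf n P) x =
    (if \<forall>i. i \<notin> {..<n} \<longrightarrow> x i = undefined then \<Prod>i<n. pmf P (x i) else 0)"
  unfolding iid_pmf_def by (rule pmf_Pi) simp

lemma expectation_memoryless_powr:
  assumes "0 \<le> \<rho>" "\<forall>i. i \<notin> {..<n} \<longrightarrow> y i = undefined"
  shows "measure_pmf.expectation (iid_pmf n P) (\<lambda>x. pmf (memoryless n W x) y powr (1 / (1 + \<rho>))) =
    (\<Prod>i<n. tilted_mean P W UNIV \<rho> (y i))"
proof -
  let ?s = "1 / (1 + \<rho>)"
  have "pmf (memoryless n W x) y powr ?s = (\<Prod>i<n. pmf (W (x i)) (y i) powr ?s)" for x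
    using assms(2) by (simp add: pmf_memoryless prod_powr_distrib)
  then have "measure_pmf.expectation (iid_pmf n P) (\<lambda>x. pmf (memoryless n W x) y powr ?s) =
      measure_pmf.expectation (iid_pmf n P) (\<lambda>x. \<Prod>i<n. pmf (W (x i)) (y i) powr ?s)"
    by simp
  also have "\<dots> = (\<Prod>i<n. measure_pmf.expectation P (\<lambda>x. pmf (W x) (y i) powr ?s))"
    unfolding iid_pmf_def
    by (rule expectation_prod_Pi_pmf) (use tilted_mean_integrand(3)[OF assms(1), of P UNIV W] in auto)
  finally show ?thesis by (simp add: tilted_mean_def)
qed

text \<open>Divided by its total F, the single-letter summand is a probability mass function v. The
  n-letter summand is F^n times the n-fold product of v, and a product law has total mass 1, so no
  product of infinite sums has to be expanded.\<close>

lemma nn_integral_memoryless_powr: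
  assumes \<rho>: "0 \<le> \<rho>"
  shows "(\<integral>\<^sup>+ y. ennreal (measure_pmf.expectation (iid_pmf n P)
      (\<lambda>x. pmf (memoryless n W x) y powr (1 / (1 + \<rho>))) powr (1 + \<rho>)) \<partial>count_space UNIV) =
    ennreal (gallager_sum P W \<rho> ^ n)"
proof -
  let ?k = "tilted_mean P W UNIV \<rho>" and ?f = "gallager_sum P W \<rho>"
  let ?h = "\<lambda>y. ?k y powr (1 + \<rho>) / ?f"
  have f: "0 < ?f" using gallager_sum_pos[OF \<rho>] .
  have h0: "0 \<le> ?h y" for y using f by simp
  have summ: "?h summable_on UNIV"
    using summable_on_cmult_left[OF gallager_sum_summable[OF \<rho>], of P W "1 / ?f"] by simp
  have "infsum ?h UNIV = 1"
    using f infsum_cmult_left'[of "\<lambda>y. ?k y powr (1 + \<rho>)" "1 / ?f" UNIV] by (simp add: gallager_sum_def)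
  then have h1: "(\<integral>\<^sup>+ y. ennreal (?h y) \<partial>count_space UNIV) = 1"
    using nn_integral_count_space_infsum[OF summ h0] by simp
  define v where "v = embed_pmf ?h"
  have v: "pmf v y = ?h y" for y unfolding v_def by (rule pmf_embed_pmf[OF h0 h1])
  have eq: "measure_pmf.expectation (iid_pmf n P) (\<lambda>x. pmf (memoryless n W x) y powr (1 / (1 + \<rho>))) powr (1 + \<rho>) =
      ?f ^ n * pmf (Pi_pmf {..<n} undefined (\<lambda>_. v)) y" for y
  proof (cases "\<forall>i. i \<notin> {..<n} \<longrightarrow> y i = undefined")
    case True
    have "(\<Prod>i<n. ?k (y i)) powr (1 + \<rho>) = (\<Prod>i<n. ?f * pmf v (y i))"
      using f by (simp add: v prod_powr_distrib tilted_mean_nonneg)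
    then show ?thesis
      unfolding expectation_memoryless_powr[OF \<rho> True] pmf_Pi[OF finite_lessThan]
      using True by (simp add: prod.distrib)
  next
    case False
    then have "pmf (memoryless n W x) y = 0" for x by (auto simp: pmf_memoryless)
    moreover have "pmf (Pi_pmf {..<n} undefined (\<lambda>_. v)) y = 0"
      unfolding pmf_Pi[OF finite_lessThan] using False by auto
    ultimately show ?thesis by simp
  qed
  show ?thesis
    unfolding eq using f
    by (simp add: ennreal_mult' nn_integral_cmult nn_integral_pmf measure_pmf.emeasure_space_1)
qed

lemma expected_loss_codebook_le:
  fixes M :: nat
  assumes M: "0 < M" and \<rho>: "0 \<le> \<rho>" "\<rho> \<le> 1"
  shows "measure_pmf.expectation (codebook_pmf n M P) (\<lambda>c. posterior_loss (code_joint_pmf n M W c)) \<le>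
    M powr \<rho> * gallager_sum P W \<rho> ^ n"
proof -
  have "ennreal (measure_pmf.expectation (codebook_pmf n M P) (\<lambda>c. posterior_loss (code_joint_pmf n M W c))) \<le>
      ennreal (M powr \<rho>) * ennreal (gallager_sum P W \<rho> ^ n)"
    unfolding codebook_pmf_def code_joint_pmf_def nn_integral_memoryless_powr[OF \<rho>(1), symmetric]
    by (rule expected_loss_le[OF M \<rho>])
  then show ?thesis
    using gallager_sum_pos[OF \<rho>(1), of P W] by (simp add: ennreal_mult'[symmetric] ennreal_le_iff)
qed

text \<open>Hoeffding's inequality with the interval [- c, c] for each term; the resulting
  exponential bound tends to 0.\<close>

lemma weak_law_Pi_pmf:
  fixes g :: "'z \<Rightarrow> real"
  assumes g: "\<And>z. z \<in> set_pmf T \<Longrightarrow> \<bar>g z\<bar> \<le> B" and \<delta>: "0 < \<delta>" and \<epsilon>: "0 < \<epsilon>"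
  shows "\<forall>\<^sub>F n in sequentially. measure_pmf.prob (Pi_pmf {..<n} d (\<lambda>_. T))
    {z. \<delta> * real n \<le> \<bar>(\<Sum>i<n. g (z i)) - n * measure_pmf.expectation T g\<bar>} \<le> \<epsilon>"
proof -
  \<comment> \<open>The added 1 keeps the interval nondegenerate, so the variance proxy in the
    exponent is not 0.\<close>
  define c where "c = \<bar>B\<bar> + 1"
  have c: "0 < c" by (simp add: c_def)
  have bound: "measure_pmf.prob (Pi_pmf {..<n} d (\<lambda>_. T))
      {z. \<delta> * real n \<le> \<bar>(\<Sum>i<n. g (z i)) - n * measure_pmf.expectation T g\<bar>} \<le> 2 * exp (- (\<delta>\<^sup>2 / (2 * c\<^sup>2)) * n)"
    if n: "0 < n" for n
  proof -
    let ?T = "Pi_pmf {..<n} d (\<lambda>_. T)"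
    have gc: "g z \<in> {- c..c}" if "z \<in> set_pmf T" for z using g[OF that] by (auto simp: c_def)
    have comp: "z i \<in> set_pmf T" if "z \<in> set_pmf ?T" "i < n" for z i
      using that by (auto simp: set_Pi_pmf PiE_dflt_def)
    have E: "measure_pmf.expectation ?T (\<lambda>z. g (z i)) = measure_pmf.expectation T g" if "i < n" for i
      using that by (intro expectation_Pi_pmf_component) auto
    interpret indep_interval_bounded_random_variables "measure_pmf ?T" "{..<n}" "\<lambda>i z. g (z i)" "\<lambda>_. - c" "\<lambda>_. c"
    proof
      show "prob_space.indep_vars (measure_pmf ?T) (\<lambda>_. borel) (\<lambda>i z. g (z i)) {..<n}"
        by (rule prob_space.indep_vars_compose2[OF prob_space_measure_pmf indep_vars_Pi_pmf, where Y = "\<lambda>_. g"]) auto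
      show "AE z in measure_pmf ?T. g (z i) \<in> {- c..c}" if "i \<in> {..<n}" for i
        using gc comp that by (intro AE_pmfI) auto
    qed auto
    interpret Hoeffding_ineq "measure_pmf ?T" "{..<n}" "\<lambda>i z. g (z i)" "\<lambda>_. - c" "\<lambda>_. c"
      "n * measure_pmf.expectation T g"
      by unfold_locales (simp add: E)
    have "measure_pmf.prob ?T {z \<in> space (measure_pmf ?T). \<bar>(\<Sum>i<n. g (z i)) - n * measure_pmf.expectation T g\<bar> \<ge> \<delta> * n}
        \<le> 2 * exp (- 2 * (\<delta> * n)\<^sup>2 / (\<Sum>i<n. (c - - c)\<^sup>2))"
      by (rule Hoeffding_ineq_abs_ge) (use \<delta> n c in auto)
    also have "- 2 * (\<delta> * n)\<^sup>2 / (\<Sum>i<n. (c - - c)\<^sup>2) = - (\<delta>\<^sup>2 / (2 * c\<^sup>2)) * n"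
      using n c by (simp add: power2_eq_square field_simps)
    finally show ?thesis by simp
  qed
  have "(\<lambda>n. 2 * exp (- (\<delta>\<^sup>2 / (2 * c\<^sup>2)) * real n)) \<longlonglongrightarrow> 2 * 0"
  proof (intro tendsto_mult tendsto_const filterlim_compose[OF exp_at_bot])
    show "filterlim (\<lambda>n. - (\<delta>\<^sup>2 / (2 * c\<^sup>2)) * real n) at_bot sequentially"
      by (rule filterlim_tendsto_neg_mult_at_bot[OF tendsto_const _ filterlim_real_sequentially]) (use \<delta> c in simp)
  qed
  then have "\<forall>\<^sub>F n in sequentially. 2 * exp (- (\<delta>\<^sup>2 / (2 * c\<^sup>2)) * real n) < \<epsilon>"
    using \<epsilon> by (intro order_tendstoD) auto
  then show ?thesis
    using eventually_gt_at_top[of 0]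
  proof eventually_elim
    case (elim n)
    then show ?case using bound[of n] by linarith
  qed
qed


section \<open>The tilted law on finite subalphabets\<close>

definition truncated_sum :: "'a pmf \<Rightarrow> ('a \<Rightarrow> 'b pmf) \<Rightarrow> 'a set \<Rightarrow> 'b set \<Rightarrow> real \<Rightarrow> real" where
  "truncated_sum P W A B \<rho> = (\<Sum>y\<in>B. tilted_mean P W A \<rho> y powr (1 + \<rho>))"

text \<open>The logarithm of the density, with respect to P, of the tilted law of x given y.\<close>

definition tilted_density :: "'a pmf \<Rightarrow> ('a \<Rightarrow> 'b pmf) \<Rightarrow> 'a set \<Rightarrow> real \<Rightarrow> 'a \<Rightarrow> 'b \<Rightarrow> real" where
  "tilted_density P W A \<rho> x y = 1 / (1 + \<rho>) * ln (pmf (W x) y) - ln (tilted_mean P W A \<rho> y)"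

text \<open>The tilted law: the output \<open>y\<close> has weight proportional to \<open>tilted_mean\<^sup>1\<^sup>+\<^sup>\<rho>\<close>, and given \<open>y\<close> the inputs \<open>x\<close> and
  \<open>x'\<close> are independent with weights proportional to \<open>P W\<^sup>1\<^sup>/\<^sup>(\<^sup>1\<^sup>+\<^sup>\<rho>\<^sup>)\<close>.  The conditional
  independence makes the transmitted and the competing word exchangeable.\<close>

definition tilted_weight ::
    "'a pmf \<Rightarrow> ('a \<Rightarrow> 'b pmf) \<Rightarrow> 'a set \<Rightarrow> 'b set \<Rightarrow> real \<Rightarrow> 'a \<times> 'a \<times> 'b \<Rightarrow> real" where
  "tilted_weight P W A B \<rho> = (\<lambda>(x, x', y). indicator (A \<times> A \<times> B) (x, x', y) *
     tilted_mean P W A \<rho> y powr (\<rho> - 1) * (pmf P x * pmf (W x) y powr (1 / (1 + \<rho>))) *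
     (pmf P x' * pmf (W x') y powr (1 / (1 + \<rho>))) / truncated_sum P W A B \<rho>)"

text \<open>The witnesses \<open>x0\<close>, \<open>x1\<close>, \<open>y0\<close> keep the truncated
  sum positive and give the two inputs of the tilted law a positive chance to differ.\<close>

locale tilting =
  fixes P :: "'a pmf" and W :: "'a \<Rightarrow> 'b pmf" and A :: "'a set" and B :: "'b set" and \<rho> :: real
    and x0 x1 :: 'a and y0 :: 'b
  assumes finA: "finite A" and finB: "finite B" and \<rho>0: "0 \<le> \<rho>" and \<rho>1: "\<rho> \<le> 1"
    and x01: "x0 \<in> A" "x1 \<in> A" "x0 \<noteq> x1" and y0: "y0 \<in> B"
    and x0P: "x0 \<in> set_pmf P" and x1P: "x1 \<in> set_pmf P"
    and y0W: "y0 \<in> set_pmf (W x0)" "y0 \<in> set_pmf (W x1)"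
begin

abbreviation "k \<equiv> tilted_mean P W A \<rho>"
abbreviation "f \<equiv> truncated_sum P W A B \<rho>"
abbreviation "s \<equiv> 1 / (1 + \<rho>)"
abbreviation "dens \<equiv> tilted_density P W A \<rho>"

lemma k_eq: "k y = (\<Sum>x\<in>A. pmf P x * pmf (W x) y powr s)"
  by (rule tilted_mean_finite[OF finA])

lemma k_pos: "x \<in> A \<Longrightarrow> x \<in> set_pmf P \<Longrightarrow> y \<in> set_pmf (W x) \<Longrightarrow> 0 < k y"
  using tilted_mean_pos[of \<rho> x A P y W] \<rho>0 by simp

lemma f_pos: "0 < f"
proof -
  have "0 < k y0 powr (1 + \<rho>)" using k_pos[OF x01(1) x0P y0W(1)] by simp
  also have "\<dots> \<le> f" unfolding truncated_sum_def using finB y0 by (intro member_le_sum) auto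
  finally show ?thesis .
qed

lemma tilted_weight_nonneg: "0 \<le> tilted_weight P W A B \<rho> z"
  using f_pos by (auto simp: tilted_weight_def split: prod.splits)

lemma sum_tilted_weight: "(\<Sum>z\<in>A \<times> A \<times> B. tilted_weight P W A B \<rho> z) = 1"
proof -
  let ?v = "\<lambda>x y. pmf P x * pmf (W x) y powr s"
  have "(\<Sum>z\<in>A \<times> A \<times> B. tilted_weight P W A B \<rho> z) =
      (\<Sum>x\<in>A. \<Sum>x'\<in>A. \<Sum>y\<in>B. tilted_weight P W A B \<rho> (x, x', y))"
    by (simp add: sum.cartesian_product)
  also have "\<dots> = (\<Sum>y\<in>B. \<Sum>x\<in>A. \<Sum>x'\<in>A. tilted_weight P W A B \<rho> (x, x', y))"
  proof -
    have "(\<Sum>x\<in>A. \<Sum>x'\<in>A. \<Sum>y\<in>B. tilted_weight P W A B \<rho> (x, x', y)) =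
        (\<Sum>x\<in>A. \<Sum>y\<in>B. \<Sum>x'\<in>A. tilted_weight P W A B \<rho> (x, x', y))"
      by (intro sum.cong refl sum.swap)
    also have "\<dots> = (\<Sum>y\<in>B. \<Sum>x\<in>A. \<Sum>x'\<in>A. tilted_weight P W A B \<rho> (x, x', y))"
      by (rule sum.swap)
    finally show ?thesis .
  qed
  also have "\<dots> = (\<Sum>y\<in>B. k y powr (1 + \<rho>) / f)"
  proof (intro sum.cong refl)
    fix y assume y: "y \<in> B"
    have "(\<Sum>x\<in>A. \<Sum>x'\<in>A. tilted_weight P W A B \<rho> (x, x', y)) =
        (\<Sum>x\<in>A. \<Sum>x'\<in>A. k y powr (\<rho> - 1) / f * (?v x y * ?v x' y))"
      using y by (intro sum.cong refl) (simp add: tilted_weight_def)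
    also have "\<dots> = k y powr (\<rho> - 1) / f * (k y * k y)"
    proof -
      have "k y * k y = (\<Sum>x\<in>A. \<Sum>x'\<in>A. ?v x y * ?v x' y)" unfolding k_eq by (rule sum_product)
      then show ?thesis by (simp only: sum_distrib_left)
    qed
    also have "\<dots> = k y powr (1 + \<rho>) / f"
    proof (cases "k y = 0")
      case False
      then have "0 < k y" using tilted_mean_nonneg[of P W A \<rho> y] by simp
      then show ?thesis by (simp add: powr_diff powr_add)
    qed simp
    finally show "(\<Sum>x\<in>A. \<Sum>x'\<in>A. tilted_weight P W A B \<rho> (x, x', y)) = k y powr (1 + \<rho>) / f" .
  qed
  also have "\<dots> = 1" using f_pos by (simp add: truncated_sum_def flip: sum_divide_distrib)
  finally show ?thesis .
qed

definition T :: "('a \<times> 'a \<times> 'b) pmf" where "T = embed_pmf (tilted_weight P W A B \<rho>)"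

lemma pmf_T: "pmf T z = tilted_weight P W A B \<rho> z"
  unfolding T_def
proof (rule pmf_embed_pmf[OF tilted_weight_nonneg])
  have "(\<integral>\<^sup>+ z. ennreal (tilted_weight P W A B \<rho> z) \<partial>count_space UNIV) =
      (\<integral>\<^sup>+ z. ennreal (tilted_weight P W A B \<rho> z) * indicator (A \<times> A \<times> B) z \<partial>count_space UNIV)"
    by (intro nn_integral_cong) (auto simp: tilted_weight_def split: prod.splits split_indicator)
  also have "\<dots> = ennreal (\<Sum>z\<in>A \<times> A \<times> B. tilted_weight P W A B \<rho> z)"
    using finA finB tilted_weight_nonneg
    by (simp add: nn_integral_count_space_indicator[symmetric] nn_integral_count_space_finite)
  finally show "(\<integral>\<^sup>+ z. ennreal (tilted_weight P W A B \<rho> z) \<partial>count_space UNIV) = 1"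
    by (simp add: sum_tilted_weight)
qed

lemma set_pmf_T:
  assumes "(x, x', y) \<in> set_pmf T"
  shows "x \<in> A" "x' \<in> A" "y \<in> B" "0 < pmf P x" "0 < pmf P x'" "0 < pmf (W x) y" "0 < pmf (W x') y" "0 < k y"
proof -
  have "tilted_weight P W A B \<rho> (x, x', y) \<noteq> 0" using assms by (simp add: set_pmf_iff pmf_T)
  then show "x \<in> A" "x' \<in> A" "y \<in> B" "0 < pmf P x" "0 < pmf P x'" "0 < pmf (W x) y" "0 < pmf (W x') y" "0 < k y"
    using tilted_mean_nonneg[of P W A \<rho> y]
    by (auto simp: tilted_weight_def indicator_def less_le split: if_splits)
qed

lemma finite_set_T: "finite (set_pmf T)"
proof (rule finite_subset)
  show "set_pmf T \<subseteq> A \<times> A \<times> B" using set_pmf_T by auto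
qed (use finA finB in auto)

lemma exp_dens:
  assumes "0 < pmf (W x) y" "0 < k y"
  shows "exp (dens x y) = pmf (W x) y powr s / k y"
  using assms by (simp add: tilted_density_def exp_diff powr_def)

text \<open>The powers of \<open>k\<close> and of W(y|x') cancel, and s (1 + \<rho>) = 1 restores
  W(y|x). So the original weight of transmitted word, fresh word and output differs from the tilted
  weight only by \<open>f\<close> and by the two densities, which concentrate at the same value
  \<open>rate\<close>.\<close>

lemma weight_change:
  assumes "(x, x', y) \<in> set_pmf T"
  shows "pmf P x * pmf P x' * pmf (W x) y = pmf T (x, x', y) * f * exp (\<rho> * dens x y - dens x' y)"
proof -
  note pos = set_pmf_T[OF assms]
  let ?w = "pmf (W x) y" and ?w' = "pmf (W x') y"
  have "pmf T (x, x', y) * f * exp (\<rho> * dens x y - dens x' y) =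
      pmf P x * pmf P x' * (k y powr (\<rho> - 1) * ?w powr s * ?w' powr s * exp (\<rho> * dens x y - dens x' y))"
    using pos f_pos by (simp add: pmf_T tilted_weight_def)
  also have "k y powr (\<rho> - 1) * ?w powr s * ?w' powr s * exp (\<rho> * dens x y - dens x' y) =
      exp ((\<rho> - 1) * ln (k y) + s * ln ?w + s * ln ?w' + (\<rho> * dens x y - dens x' y))"
    using pos by (simp add: powr_def exp_add)
  also have "(\<rho> - 1) * ln (k y) + s * ln ?w + s * ln ?w' + (\<rho> * dens x y - dens x' y) = (s * (1 + \<rho>)) * ln ?w"
    by (simp only: tilted_density_def ring_distribs) (simp add: algebra_simps)
  also have "\<dots> = ln ?w" using \<rho>0 by simp
  finally show ?thesis using pos by simp
qed

text \<open>The default triple makes all three coordinate words of a sample constantly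
  \<open>undefined\<close> outside {..<n}, as the conventions for words and outputs require.\<close>

definition Tn :: "nat \<Rightarrow> (nat \<Rightarrow> 'a \<times> 'a \<times> 'b) pmf" where
  "Tn n = Pi_pmf {..<n} (undefined, undefined, undefined) (\<lambda>_. T)"

text \<open>The average divergence of the tilted law of x given y from P. A fresh word drawn from P
  fits a given output with probability about exp (- n * rate).\<close>

definition rate :: real where "rate = measure_pmf.expectation T (\<lambda>(x, x', y). dens x y)"

definition swap :: "'a \<times> 'a \<times> 'b \<Rightarrow> 'a \<times> 'a \<times> 'b" where "swap = (\<lambda>(x, x', y). (x', x, y))"

lemma map_swap_T: "map_pmf swap T = T"
proof (rule pmf_eqI)
  fix z :: "'a \<times> 'a \<times> 'b"
  obtain x x' y where z: "z = (x, x', y)" by (cases z)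
  have "pmf (map_pmf swap T) (swap (x', x, y)) = pmf T (x', x, y)"
    by (rule pmf_map_inj') (auto simp: inj_on_def swap_def)
  also have "\<dots> = pmf T z"
    unfolding pmf_T z by (auto simp: tilted_weight_def indicator_def)
  finally show "pmf (map_pmf swap T) z = pmf T z" by (simp add: z swap_def)
qed

lemma map_swap_Tn: "map_pmf (\<lambda>z. swap \<circ> z) (Tn n) = Tn n"
  unfolding Tn_def
  by (subst Pi_pmf_map[symmetric, where dflt' = "(undefined, undefined, undefined)"])
     (auto simp: swap_def map_swap_T[unfolded swap_def])

lemma rate_swap: "measure_pmf.expectation T (\<lambda>(x, x', y). dens x' y) = rate"
proof -
  have "rate = measure_pmf.expectation (map_pmf swap T) (\<lambda>(x, x', y). dens x y)"
    by (simp add: rate_def map_swap_T)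
  also have "\<dots> = measure_pmf.expectation T (\<lambda>(x, x', y). dens x' y)"
    by (auto simp: swap_def intro!: Bochner_Integration.integral_cong)
  finally show ?thesis by simp
qed

definition typical :: "real \<Rightarrow> nat \<Rightarrow> (nat \<Rightarrow> 'a \<times> 'a \<times> 'b) set" where
  "typical \<delta> n = {z. \<bar>(\<Sum>i<n. case z i of (x, x', y) \<Rightarrow> dens x y) - n * rate\<bar> < \<delta> * n \<and>
    \<bar>(\<Sum>i<n. case z i of (x, x', y) \<Rightarrow> dens x' y) - n * rate\<bar> < \<delta> * n}"

definition distinct_words :: "nat \<Rightarrow> (nat \<Rightarrow> 'a \<times> 'a \<times> 'b) set" where
  "distinct_words n = {z. \<exists>i<n. fst (z i) \<noteq> fst (snd (z i))}"

definition confused :: "nat \<Rightarrow> (nat \<Rightarrow> 'a \<times> 'a \<times> 'b) set" where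
  "confused n = {z. (\<Prod>i<n. case z i of (x, x', y) \<Rightarrow> pmf (W x) y) \<le> (\<Prod>i<n. case z i of (x, x', y) \<Rightarrow> pmf (W x') y)}"

text \<open>Typicality and distinctness are both invariant under exchanging the two words, and one
  of the two orders always satisfies the likelihood comparison, ties included. Hence the third event
  takes away at most half of the probability.\<close>

lemma prob_typical_distinct_confused:
  assumes \<delta>: "0 < \<delta>"
  shows "\<forall>\<^sub>F n in sequentially. 1 / 8 \<le> measure_pmf.prob (Tn n) (typical \<delta> n \<inter> distinct_words n \<inter> confused n)"
proof -
  have bdd: "\<exists>C. \<forall>z\<in>set_pmf T. \<bar>g z\<bar> \<le> C" for g :: "'a \<times> 'a \<times> 'b \<Rightarrow> real"
    using finite_set_T by (intro exI[of _ "Max ((\<lambda>z. \<bar>g z\<bar>) ` set_pmf T)"]) auto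
  obtain C1 where C1: "\<And>z. z \<in> set_pmf T \<Longrightarrow> \<bar>case z of (x, x', y) \<Rightarrow> dens x y\<bar> \<le> C1" using bdd by meson
  obtain C2 where C2: "\<And>z. z \<in> set_pmf T \<Longrightarrow> \<bar>case z of (x, x', y) \<Rightarrow> dens x' y\<bar> \<le> C2" using bdd by meson
  let ?E = "{z. fst z = fst (snd z)}"
  define \<theta> where "\<theta> = measure_pmf.prob T ?E"
  have \<theta>: "0 \<le> \<theta>" "\<theta> < 1"
  proof -
    show "0 \<le> \<theta>" by (simp add: \<theta>_def)
    have "0 < pmf T (x0, x1, y0)"
      unfolding pmf_T tilted_weight_def
      using x01 y0 f_pos k_pos[OF x01(1) x0P y0W(1)] x0P x1P y0W
      by (auto simp: pmf_positive_iff intro!: divide_pos_pos mult_pos_pos pmf_positive)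
        (auto simp: set_pmf_iff less_le)
    then have "(x0, x1, y0) \<in> set_pmf T" by (simp add: pmf_positive_iff)
    then have "0 < measure_pmf.prob T (- ?E)"
      using x01 by (intro measure_pmf_posI[of "(x0, x1, y0)"]) auto
    then show "\<theta> < 1"
      using measure_pmf.prob_compl[of ?E T] by (simp add: \<theta>_def Compl_eq_Diff_UNIV)
  qed
  have same: "measure_pmf.prob (Tn n) (- distinct_words n) = \<theta> ^ n" for n
  proof -
    have "- distinct_words n = Pi {..<n} (\<lambda>_. ?E)"
      unfolding distinct_words_def Pi_def by blast
    then show ?thesis by (simp add: Tn_def measure_Pi_pmf_Pi \<theta>_def)
  qed
  have "(\<lambda>n. \<theta> ^ n) \<longlonglongrightarrow> 0" using \<theta> by (intro LIMSEQ_realpow_zero) auto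
  then have ev3: "\<forall>\<^sub>F n in sequentially. \<theta> ^ n < 1 / 4" by (rule order_tendstoD) simp
  note ev1 = weak_law_Pi_pmf[of T "\<lambda>(x, x', y). dens x y" C1 \<delta> "1/4" "(undefined, undefined, undefined)",
      OF C1 \<delta>, folded Tn_def rate_def, simplified]
  note ev2 = weak_law_Pi_pmf[of T "\<lambda>(x, x', y). dens x' y" C2 \<delta> "1/4" "(undefined, undefined, undefined)",
      OF C2 \<delta>, folded Tn_def, unfolded rate_swap, simplified]
  show ?thesis
    using ev1 ev2 ev3
  proof eventually_elim
    case (elim n)
    let ?p = "measure_pmf.prob (Tn n)"
    let ?N1 = "{z. \<delta> * real n \<le> \<bar>(\<Sum>i<n. case z i of (x, x', y) \<Rightarrow> dens x y) - n * rate\<bar>}"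
    let ?N2 = "{z. \<delta> * real n \<le> \<bar>(\<Sum>i<n. case z i of (x, x', y) \<Rightarrow> dens x' y) - n * rate\<bar>}"
    let ?G = "typical \<delta> n \<inter> distinct_words n"
    have "- ?G = (?N1 \<union> ?N2) \<union> (- distinct_words n)" by (auto simp: typical_def)
    then have "?p (- ?G) \<le> ?p (?N1 \<union> ?N2) + ?p (- distinct_words n)"
      by (simp add: measure_Un_le)
    also have "?p (?N1 \<union> ?N2) \<le> ?p ?N1 + ?p ?N2" by (simp add: measure_Un_le)
    \<comment> \<open>One quarter for each of the two atypical densities and one quarter for
      coinciding words.\<close>
    finally have "?p (- ?G) \<le> 3 / 4" using elim same[of n] by simp
    then have G: "1 / 4 \<le> ?p ?G"
      using measure_pmf.prob_compl[of ?G "Tn n"] by (simp add: Compl_eq_Diff_UNIV)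
    let ?S = "\<lambda>z :: nat \<Rightarrow> 'a \<times> 'a \<times> 'b. swap \<circ> z"
    have sum_swap: "(\<Sum>i<n. case (swap \<circ> z) i of (x, x', y) \<Rightarrow> dens x y) = (\<Sum>i<n. case z i of (x, x', y) \<Rightarrow> dens x' y)"
      "(\<Sum>i<n. case (swap \<circ> z) i of (x, x', y) \<Rightarrow> dens x' y) = (\<Sum>i<n. case z i of (x, x', y) \<Rightarrow> dens x y)"
      "(\<Prod>i<n. case (swap \<circ> z) i of (x, x', y) \<Rightarrow> pmf (W x) y) = (\<Prod>i<n. case z i of (x, x', y) \<Rightarrow> pmf (W x') y)"
      "(\<Prod>i<n. case (swap \<circ> z) i of (x, x', y) \<Rightarrow> pmf (W x') y) = (\<Prod>i<n. case z i of (x, x', y) \<Rightarrow> pmf (W x) y)" for z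
      by (auto intro!: sum.cong prod.cong simp: swap_def split: prod.splits)
    have SG: "?S -` ?G = ?G"
    proof -
      have "?S z \<in> distinct_words n \<longleftrightarrow> z \<in> distinct_words n" for z
        by (auto simp: distinct_words_def swap_def split_beta)
      moreover have "?S z \<in> typical \<delta> n \<longleftrightarrow> z \<in> typical \<delta> n" for z
        unfolding typical_def mem_Collect_eq sum_swap by blast
      ultimately show ?thesis by auto
    qed
    \<comment> \<open>Exchanging the words maps the part of G where the comparison fails into the
      part where it holds, and preserves the law.\<close>
    have "?p (?G \<inter> - confused n) \<le> ?p (?S -` (?G \<inter> confused n))"
    proof (rule measure_pmf.finite_measure_mono)
      have "?S z \<in> confused n" if "z \<notin> confused n" for z
        using that unfolding confused_def mem_Collect_eq sum_swap by linarith
      then show "?G \<inter> - confused n \<subseteq> ?S -` (?G \<inter> confused n)" using SG by blast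
    qed simp
    also have "\<dots> = measure_pmf.prob (map_pmf ?S (Tn n)) (?G \<inter> confused n)" by simp
    also have "\<dots> = ?p (?G \<inter> confused n)" by (simp only: map_swap_Tn)
    finally have "?p (?G \<inter> - confused n) \<le> ?p (?G \<inter> confused n)" .
    moreover have "?p ?G \<le> ?p (?G \<inter> confused n) + ?p (?G \<inter> - confused n)"
      by (rule order_trans[OF measure_pmf.finite_measure_mono measure_Un_le]) auto
    ultimately show ?case using G by simp
  qed
qed

text \<open>G consists of the triples of words in the support that are typical, distinct and
  confused. Typicality from below bounds the probability of a slice, hence h; the change of measure
  together with the probability 1/8 bounds the total original weight of G.\<close>

lemma expected_loss_codebook_ge:
  assumes \<delta>: "0 < \<delta>"
  shows "\<forall>\<^sub>F n in sequentially. \<forall>M>0.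
    (real M - 1) / (2 + (real M - 1) * (2 * exp (- (n * (rate - \<delta>))))) *
      (exp (n * (ln f + \<rho> * (rate - \<delta>) - (rate + \<delta>))) / 8) \<le>
    measure_pmf.expectation (codebook_pmf n M P) (\<lambda>c. posterior_loss (code_joint_pmf n M W c))"
  using prob_typical_distinct_confused[OF \<delta>]
proof eventually_elim
  case (elim n)
  let ?Z = "set_pmf (Tn n) \<inter> (typical \<delta> n \<inter> distinct_words n \<inter> confused n)"
  let ?\<phi> = "\<lambda>z :: nat \<Rightarrow> 'a \<times> 'a \<times> 'b. (fst \<circ> z, (fst \<circ> snd) \<circ> z, (snd \<circ> snd) \<circ> z)"
  define G where "G = ?\<phi> ` ?Z"
  let ?e = "exp (- (n * (rate - \<delta>)))"
  let ?V = "\<lambda>x y. pmf P x * pmf (W x) y powr s / k y"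
  have inj: "inj ?\<phi>"
  proof (rule injI)
    fix z z' assume eq: "?\<phi> z = ?\<phi> z'"
    show "z = z'"
    proof
      fix i
      have "fst (z i) = fst (z' i)" "fst (snd (z i)) = fst (snd (z' i))" "snd (snd (z i)) = snd (snd (z' i))"
        using eq by (auto simp: fun_eq_iff)
      then show "z i = z' i" by (simp add: prod_eq_iff)
    qed
  qed
  have set_Tn: "z i \<in> set_pmf T" if "z \<in> set_pmf (Tn n)" "i < n" for z i
    using that by (auto simp: Tn_def set_Pi_pmf PiE_dflt_def)
  have out_Tn: "z i = (undefined, undefined, undefined)" if "z \<in> set_pmf (Tn n)" "\<not> i < n" for z i
    using that by (auto simp: Tn_def set_Pi_pmf PiE_dflt_def)
  have finZ: "finite ?Z"
    using finite_set_T by (auto simp: Tn_def set_Pi_pmf intro!: finite_PiE_dflt)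
  have finG: "finite G" using finZ by (simp add: G_def)
  have pX: "pmf (iid_pmf n P) (fst \<circ> z) = (\<Prod>i<n. pmf P (fst (z i)))"
    and pX': "pmf (iid_pmf n P) ((fst \<circ> snd) \<circ> z) = (\<Prod>i<n. pmf P (fst (snd (z i))))"
    and pW: "pmf (memoryless n W x) ((snd \<circ> snd) \<circ> z) = (\<Prod>i<n. pmf (W (x i)) (snd (snd (z i))))"
    if "z \<in> set_pmf (Tn n)" for z x
    using out_Tn[OF that] by (auto simp: pmf_iid_pmf pmf_memoryless)
  have V: "0 \<le> ?V x y" "?V x y \<le> 1" if "x \<in> A" for x y
  proof -
    show "0 \<le> ?V x y" by (simp add: tilted_mean_nonneg)
    have "pmf P x * pmf (W x) y powr s \<le> k y"
      unfolding k_eq using that finA by (intro member_le_sum) auto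
    then show "?V x y \<le> 1"
      using tilted_mean_nonneg[of P W A \<rho> y] by (auto simp: divide_le_eq_1 less_le)
  qed
  \<comment> \<open>P is the tilted conditional law \<open>?V\<close> divided by its density. Lower
    bounds on the density thus become upper bounds on the probability of a word.\<close>
  have p_eq: "pmf P x = ?V x y * exp (- dens x y)" if "0 < pmf (W x) y" "0 < k y" for x y
    using exp_dens[OF that] that by (simp add: exp_minus)
  have prod_eq: "(\<Prod>i<n. pmf P (x i)) = (\<Prod>i<n. ?V (x i) (y i)) * exp (- (\<Sum>i<n. dens (x i) (y i)))"
    if "\<And>i. i < n \<Longrightarrow> 0 < pmf (W (x i)) (y i) \<and> 0 < k (y i)" for x y
  proof -
    have "(\<Prod>i<n. pmf P (x i)) = (\<Prod>i<n. ?V (x i) (y i) * exp (- dens (x i) (y i)))"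
      by (intro prod.cong refl p_eq) (use that in auto)
    moreover have "exp (- (\<Sum>i<n. dens (x i) (y i))) = (\<Prod>i<n. exp (- dens (x i) (y i)))"
      by (simp add: exp_sum flip: sum_negf)
    ultimately show ?thesis by (simp only: prod.distrib)
  qed
  \<comment> \<open>For the transmitted word the tilted factor may be dropped. For the competitor it
    is kept, because the bound will be summed over all competitors of one output.\<close>
  have bnd: "pmf (iid_pmf n P) (fst \<circ> z) \<le> ?e"
      "pmf (iid_pmf n P) ((fst \<circ> snd) \<circ> z) \<le> (\<Prod>i<n. ?V (fst (snd (z i))) (snd (snd (z i)))) * ?e"
    if z: "z \<in> ?Z" for z
  proof -
    have zT: "(fst (z i), fst (snd (z i)), snd (snd (z i))) \<in> set_pmf T" if "i < n" for i
      using set_Tn[of z i] z that by simp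
    note pos = set_pmf_T[OF zT]
    have htyp: "n * (rate - \<delta>) \<le> (\<Sum>i<n. dens (fst (z i)) (snd (snd (z i))))"
      "n * (rate - \<delta>) \<le> (\<Sum>i<n. dens (fst (snd (z i))) (snd (snd (z i))))"
      using z by (auto simp: typical_def split_beta abs_less_iff algebra_simps)
    have zn: "z \<in> set_pmf (Tn n)" using z by simp
    have "pmf (iid_pmf n P) (fst \<circ> z) = (\<Prod>i<n. ?V (fst (z i)) (snd (snd (z i)))) *
        exp (- (\<Sum>i<n. dens (fst (z i)) (snd (snd (z i)))))"
      unfolding pX[OF zn] by (rule prod_eq) (use pos in auto)
    also have "\<dots> \<le> 1 * ?e"
      using htyp(1) by (intro mult_mono prod_le_1 prod_nonneg ballI conjI V pos(1)) auto
    finally show "pmf (iid_pmf n P) (fst \<circ> z) \<le> ?e" by simp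
    have "pmf (iid_pmf n P) ((fst \<circ> snd) \<circ> z) = (\<Prod>i<n. ?V (fst (snd (z i))) (snd (snd (z i)))) *
        exp (- (\<Sum>i<n. dens (fst (snd (z i))) (snd (snd (z i)))))"
      unfolding pX'[OF zn] by (rule prod_eq) (use pos in auto)
    also have "\<dots> \<le> (\<Prod>i<n. ?V (fst (snd (z i))) (snd (snd (z i)))) * ?e"
      using htyp(2) by (intro mult_left_mono prod_nonneg ballI V pos(2)) auto
    finally show "pmf (iid_pmf n P) ((fst \<circ> snd) \<circ> z) \<le> (\<Prod>i<n. ?V (fst (snd (z i))) (snd (snd (z i)))) * ?e" .
  qed
  have G: "x \<noteq> x' \<and> 0 < pmf (memoryless n W x) y \<and> pmf (memoryless n W x) y \<le> pmf (memoryless n W x') y"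
    if G1: "(x, x', y) \<in> G" for x x' y
  proof -
    obtain z where z: "z \<in> ?Z" "x = fst \<circ> z" "x' = (fst \<circ> snd) \<circ> z" "y = (snd \<circ> snd) \<circ> z"
      using G1 by (auto simp: G_def)
    have zn: "z \<in> set_pmf (Tn n)" using z by simp
    have zT: "(fst (z i), fst (snd (z i)), snd (snd (z i))) \<in> set_pmf T" if "i < n" for i
      using set_Tn[of z i] zn that by simp
    have "x \<noteq> x'" using z by (auto simp: distinct_words_def fun_eq_iff)
    moreover have "0 < pmf (memoryless n W x) y"
      unfolding z(4) pW[OF zn] using set_pmf_T(6)[OF zT] z(2) by (intro prod_pos) auto
    moreover have "pmf (memoryless n W x) y \<le> pmf (memoryless n W x') y"
      unfolding z(4) pW[OF zn] using z by (simp add: confused_def split_beta)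
    ultimately show ?thesis by blast
  qed
  \<comment> \<open>One summand exp (- n (rate - \<delta>)) is for the word x itself and one for the
    whole slice of competitors; this is the factor 2.\<close>
  have h: "pmf (iid_pmf n P) x + measure_pmf.prob (iid_pmf n P) {x'. (x, x', y) \<in> G} \<le> 2 * ?e"
    if G1: "(x, x1', y) \<in> G" for x x1' y
  proof -
    let ?S = "{x'. (x, x', y) \<in> G}"
    obtain z where z: "z \<in> ?Z" "x = fst \<circ> z" "y = (snd \<circ> snd) \<circ> z"
      using G1 by (auto simp: G_def)
    have zn: "z \<in> set_pmf (Tn n)" using z by simp
    have zT: "(fst (z i), fst (snd (z i)), snd (snd (z i))) \<in> set_pmf T" if "i < n" for i
      using set_Tn[of z i] zn that by simp
    have 1: "pmf (iid_pmf n P) x \<le> ?e" unfolding z(2) by (rule bnd(1)[OF z(1)])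
    have elem: "x' \<in> PiE {..<n} (\<lambda>_. A) \<and> pmf (iid_pmf n P) x' \<le> (\<Prod>i<n. ?V (x' i) (y i)) * ?e"
      if "x' \<in> ?S" for x'
    proof -
      obtain z' where z': "z' \<in> ?Z" "x' = (fst \<circ> snd) \<circ> z'" "y = (snd \<circ> snd) \<circ> z'"
        using \<open>x' \<in> ?S\<close> by (auto simp: G_def)
      have z'n: "z' \<in> set_pmf (Tn n)" using z' by simp
      have z'T: "(fst (z' i), fst (snd (z' i)), snd (snd (z' i))) \<in> set_pmf T" if "i < n" for i
        using set_Tn[of z' i] z'n that by simp
      have "x' \<in> PiE {..<n} (\<lambda>_. A)"
        using set_pmf_T(2)[OF z'T] out_Tn[OF z'n] by (auto simp: z'(2) PiE_def extensional_def)
      moreover have "pmf (iid_pmf n P) x' \<le> (\<Prod>i<n. ?V (x' i) (y i)) * ?e"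
        using bnd(2)[OF z'(1)] by (simp add: z'(2,3))
      ultimately show ?thesis by blast
    qed
    have finPi: "finite (PiE {..<n} (\<lambda>_. A))" using finA by (intro finite_PiE) auto
    have finS: "finite ?S" using elem by (intro finite_subset[OF _ finPi]) auto
    have "measure_pmf.prob (iid_pmf n P) ?S = (\<Sum>x'\<in>?S. pmf (iid_pmf n P) x')"
      by (rule measure_measure_pmf_finite[OF finS])
    also have "\<dots> \<le> (\<Sum>x'\<in>?S. (\<Prod>i<n. ?V (x' i) (y i)) * ?e)" using elem by (intro sum_mono) auto
    also have "\<dots> \<le> (\<Sum>x'\<in>PiE {..<n} (\<lambda>_. A). (\<Prod>i<n. ?V (x' i) (y i)) * ?e)"
      using elem finPi
      by (intro sum_mono2) (auto intro!: mult_nonneg_nonneg prod_nonneg divide_nonneg_nonneg tilted_mean_nonneg)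
    also have "\<dots> = (\<Prod>i<n. \<Sum>x\<in>A. ?V x (y i)) * ?e"
      using finA by (subst prod_sum_PiE) (auto simp: sum_distrib_right)
    \<comment> \<open>Given y the tilted conditional weights form a probability law on A, so summing
      over all competing words costs nothing.\<close>
    also have "(\<Prod>i<n. \<Sum>x\<in>A. ?V x (y i)) = 1"
    proof (intro prod.neutral ballI)
      fix i assume "i \<in> {..<n}"
      then have "0 < k (y i)" using set_pmf_T(8)[OF zT] by (simp add: z(3))
      then show "(\<Sum>x\<in>A. ?V x (y i)) = 1" by (simp add: k_eq flip: sum_divide_distrib)
    qed
    finally show ?thesis using 1 by simp
  qed
  have mass: "exp (n * (ln f + \<rho> * (rate - \<delta>) - (rate + \<delta>))) / 8 \<le>
      (\<Sum>(x, x', y)\<in>G. pmf (iid_pmf n P) x * pmf (iid_pmf n P) x' * pmf (memoryless n W x) y)"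
  proof -
    let ?E = "exp (n * (ln f + \<rho> * (rate - \<delta>) - (rate + \<delta>)))"
    have one: "?E * pmf (Tn n) z \<le>
        pmf (iid_pmf n P) (fst \<circ> z) * pmf (iid_pmf n P) ((fst \<circ> snd) \<circ> z) * pmf (memoryless n W (fst \<circ> z)) ((snd \<circ> snd) \<circ> z)"
      if z: "z \<in> ?Z" for z
    proof -
      have zn: "z \<in> set_pmf (Tn n)" using z by simp
      have zT: "(fst (z i), fst (snd (z i)), snd (snd (z i))) \<in> set_pmf T" if "i < n" for i
        using set_Tn[of z i] zn that by simp
      let ?d = "\<lambda>i. dens (fst (z i)) (snd (snd (z i)))" and ?d' = "\<lambda>i. dens (fst (snd (z i))) (snd (snd (z i)))"
      have "pmf (iid_pmf n P) (fst \<circ> z) * pmf (iid_pmf n P) ((fst \<circ> snd) \<circ> z) * pmf (memoryless n W (fst \<circ> z)) ((snd \<circ> snd) \<circ> z) =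
          (\<Prod>i<n. pmf P (fst (z i)) * pmf P (fst (snd (z i))) * pmf (W (fst (z i))) (snd (snd (z i))))"
        by (simp only: pX[OF zn] pX'[OF zn] pW[OF zn] prod.distrib o_apply)
      also have "\<dots> = (\<Prod>i<n. pmf T (z i) * f * exp (\<rho> * ?d i - ?d' i))"
        by (intro prod.cong refl) (use weight_change[OF zT] in simp)
      also have "\<dots> = pmf (Tn n) z * f ^ n * exp (\<Sum>i<n. \<rho> * ?d i - ?d' i)"
        using out_Tn[OF zn] by (simp add: Tn_def pmf_Pi prod.distrib exp_sum)
      also have "f ^ n = exp (n * ln f)" using f_pos by (simp add: exp_of_nat_mult)
      finally have eq: "pmf (iid_pmf n P) (fst \<circ> z) * pmf (iid_pmf n P) ((fst \<circ> snd) \<circ> z) * pmf (memoryless n W (fst \<circ> z)) ((snd \<circ> snd) \<circ> z) =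
          pmf (Tn n) z * exp (n * ln f + (\<Sum>i<n. \<rho> * ?d i - ?d' i))" by (simp only: exp_add mult.assoc)
      have htyp: "n * (rate - \<delta>) \<le> (\<Sum>i<n. ?d i)" "(\<Sum>i<n. ?d' i) \<le> n * (rate + \<delta>)"
        using z by (auto simp: typical_def split_beta abs_less_iff algebra_simps)
      have "\<rho> * (n * (rate - \<delta>)) \<le> \<rho> * (\<Sum>i<n. ?d i)" using htyp(1) \<rho>0 by (rule mult_left_mono)
      \<comment> \<open>The density of the transmitted word enters with weight \<rho> \<ge> 0 and is
        bounded from below, that of the competitor with weight -1 and is bounded from above.\<close>
      then have "n * (ln f + \<rho> * (rate - \<delta>) - (rate + \<delta>)) \<le> n * ln f + (\<Sum>i<n. \<rho> * ?d i - ?d' i)"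
        using htyp(2) by (simp add: sum_subtractf sum_distrib_left algebra_simps)
      then show ?thesis unfolding eq by (subst mult.commute) (intro mult_left_mono, auto)
    qed
    have "?E / 8 = ?E * (1 / 8)" by simp
    also have "\<dots> \<le> ?E * measure_pmf.prob (Tn n) (typical \<delta> n \<inter> distinct_words n \<inter> confused n)"
      using elim by (intro mult_left_mono) auto
    also have "measure_pmf.prob (Tn n) (typical \<delta> n \<inter> distinct_words n \<inter> confused n) = measure_pmf.prob (Tn n) ?Z"
      by (rule measure_prob_cong_0) (auto simp: set_pmf_iff)
    also have "\<dots> = (\<Sum>z\<in>?Z. pmf (Tn n) z)" by (rule measure_measure_pmf_finite[OF finZ])
    also have "?E * \<dots> \<le> (\<Sum>z\<in>?Z. pmf (iid_pmf n P) (fst \<circ> z) * pmf (iid_pmf n P) ((fst \<circ> snd) \<circ> z) *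
        pmf (memoryless n W (fst \<circ> z)) ((snd \<circ> snd) \<circ> z))"
      unfolding sum_distrib_left by (intro sum_mono one)
    also have "\<dots> = (\<Sum>(x, x', y)\<in>G. pmf (iid_pmf n P) x * pmf (iid_pmf n P) x' * pmf (memoryless n W x) y)"
      unfolding G_def by (subst sum.reindex) (use inj in \<open>auto intro: inj_on_subset\<close>)
    finally show ?thesis .
  qed
  show ?case
  proof (intro allI impI)
    fix M :: nat assume M: "0 < M"
    have "(real M - 1) / (2 + (real M - 1) * (2 * ?e)) * (exp (n * (ln f + \<rho> * (rate - \<delta>) - (rate + \<delta>))) / 8) \<le>
        (real M - 1) / (2 + (real M - 1) * (2 * ?e)) *
          (\<Sum>(x, x', y)\<in>G. pmf (iid_pmf n P) x * pmf (iid_pmf n P) x' * pmf (memoryless n W x) y)"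
      using M by (intro mult_left_mono mass divide_nonneg_pos add_pos_nonneg mult_nonneg_nonneg) auto
    also have "\<dots> \<le> measure_pmf.expectation (codebook_pmf n M P) (\<lambda>c. posterior_loss (code_joint_pmf n M W c))"
      unfolding codebook_pmf_def code_joint_pmf_def
      by (rule expected_loss_ge[OF M finG G h]) auto
    finally show "(real M - 1) / (2 + (real M - 1) * (2 * ?e)) * (exp (n * (ln f + \<rho> * (rate - \<delta>) - (rate + \<delta>))) / 8) \<le>
      measure_pmf.expectation (codebook_pmf n M P) (\<lambda>c. posterior_loss (code_joint_pmf n M W c))" .
  qed
qed

end

subsection \<open>Lower bound on the expected loss\<close>

text \<open>The transition is at N e = 1: below it the number N of words limits the expression,
  above it the saturation value 1 / e does.\<close>

lemma min_rate_bound: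
  fixes a e :: real
  assumes "0 < a" "a \<le> N" "0 < e"
  shows "min a (1 / e) / 4 \<le> N / (2 + N * (2 * e))"
proof -
  have N: "0 < N" using assms by simp
  have pos: "0 < 2 + N * (2 * e)" using N assms by (simp add: add_pos_pos)
  show ?thesis
  proof (cases "N * e \<le> 1")
    case True
    have "N / 4 \<le> N / (2 + N * (2 * e))"
      using True N pos by (intro divide_left_mono) auto
    moreover have "min a (1 / e) / 4 \<le> N / 4" using assms(2) by simp
    ultimately show ?thesis by (rule order_trans[rotated])
  next
    case False
    have "1 / e / 4 = N / (4 * (N * e))" using N assms by simp
    also have "\<dots> \<le> N / (2 + N * (2 * e))"
      using False N pos assms by (intro divide_left_mono) auto
    finally have "1 / e / 4 \<le> N / (2 + N * (2 * e))" .
    moreover have "min a (1 / e) / 4 \<le> 1 / e / 4" by (rule divide_right_mono) auto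
    ultimately show ?thesis by (rule order_trans[rotated])
  qed
qed

text \<open>The number of useful competitors is about exp (n * min R rate): beyond
  \<open>rate\<close> further codewords only compete with each other. The constant 64 is 8 from this
  count times 8 from the probability of the good event.\<close>

lemma (in tilting) expected_loss_exponent:
  assumes \<delta>: "0 < \<delta>"
    and M: "\<forall>\<^sub>F n in sequentially. exp (real n * R) / 2 \<le> real (M n) - 1"
  shows "\<forall>\<^sub>F n in sequentially.
    exp (- (n * (- ln f + (1 - \<rho>) * rate - min R rate + 3 * \<delta>))) / 64 \<le>
    measure_pmf.expectation (codebook_pmf n (M n) P) (\<lambda>c. posterior_loss (code_joint_pmf n (M n) W c))"
  using expected_loss_codebook_ge[OF \<delta>] M
proof eventually_elim
  case (elim n)
  let ?L = "measure_pmf.expectation (codebook_pmf n (M n) P) (\<lambda>c. posterior_loss (code_joint_pmf n (M n) W c))"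
  let ?E = "exp (n * (ln f + \<rho> * (rate - \<delta>) - (rate + \<delta>)))" and ?e = "exp (- (n * (rate - \<delta>)))"
  have N: "0 < real (M n) - 1" using elim(2) by (rule less_le_trans[rotated]) simp
  then have M0: "0 < M n" by linarith
  have "exp (n * (min R rate - \<delta>)) / 2 \<le> min (exp (n * R) / 2) (1 / ?e)"
  proof (rule min.boundedI)
    have "min R rate - \<delta> \<le> R" "min R rate - \<delta> \<le> rate - \<delta>" using \<delta> by auto
    then have 1: "n * (min R rate - \<delta>) \<le> n * R" and 2: "n * (min R rate - \<delta>) \<le> n * (rate - \<delta>)"
      by (intro mult_left_mono; simp)+
    show "exp (n * (min R rate - \<delta>)) / 2 \<le> exp (n * R) / 2" using 1 by simp
    have "exp (n * (min R rate - \<delta>)) / 2 \<le> exp (n * (min R rate - \<delta>))" by simp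
    also have "\<dots> \<le> exp (n * (rate - \<delta>))" using 2 by simp
    finally show "exp (n * (min R rate - \<delta>)) / 2 \<le> 1 / ?e" by (simp add: exp_minus inverse_eq_divide)
  qed
  then have "exp (n * (min R rate - \<delta>)) / 8 \<le> min (exp (n * R) / 2) (1 / ?e) / 4" by simp
  also have "\<dots> \<le> (real (M n) - 1) / (2 + (real (M n) - 1) * (2 * ?e))"
    by (rule min_rate_bound) (use elim(2) in auto)
  finally have "exp (n * (min R rate - \<delta>)) / 8 * (?E / 8) \<le>
      (real (M n) - 1) / (2 + (real (M n) - 1) * (2 * ?e)) * (?E / 8)"
    by (intro mult_right_mono) auto
  also have "\<dots> \<le> ?L" using elim(1) M0 by blast
  finally have 1: "exp (n * (min R rate - \<delta>)) * ?E / 64 \<le> ?L" by simp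
  \<comment> \<open>The three units of \<delta> come from the count of competitors, from the upper
    density bound, and from \<rho> \<delta> \<le> \<delta>.\<close>
  have "ln f - (1 - \<rho>) * rate + min R rate - 3 * \<delta> \<le> min R rate - \<delta> + (ln f + \<rho> * (rate - \<delta>) - (rate + \<delta>))"
    using mult_right_mono[OF \<rho>1, of \<delta>] \<delta> by (simp add: algebra_simps)
  then have "n * (ln f - (1 - \<rho>) * rate + min R rate - 3 * \<delta>) \<le>
      n * (min R rate - \<delta> + (ln f + \<rho> * (rate - \<delta>) - (rate + \<delta>)))"
    by (intro mult_left_mono) auto
  then have "exp (n * (ln f - (1 - \<rho>) * rate + min R rate - 3 * \<delta>)) \<le> exp (n * (min R rate - \<delta>)) * ?E"
    by (simp only: exp_add[symmetric] distrib_left[of "real n", symmetric] exp_le_cancel_iff)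
  moreover have "- (n * (- ln f + (1 - \<rho>) * rate - min R rate + 3 * \<delta>)) =
      n * (ln f - (1 - \<rho>) * rate + min R rate - 3 * \<delta>)" by (simp add: algebra_simps)
  ultimately have "exp (- (n * (- ln f + (1 - \<rho>) * rate - min R rate + 3 * \<delta>))) \<le> exp (n * (min R rate - \<delta>)) * ?E"
    by (simp only:)
  then show ?case using 1 by linarith
qed

lemma continuous_tilted_mean_terms:
  fixes P :: "'a pmf" and W :: "'a \<Rightarrow> 'b pmf"
  assumes "finite A"
  shows "continuous_on {0..1} (\<lambda>\<rho>. pmf (W x) y powr (1 / (1 + \<rho>)))"
    and "continuous_on {0..1} (\<lambda>\<rho>. tilted_mean P W A \<rho> y)"
    \<comment> \<open>Whether the tilted mean vanishes depends on the supports alone and so not on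
      \<rho>. Powers and logarithms of it are then continuous in \<rho>, either as functions of a
      positive quantity or with constant value on [0, 1].\<close>
    and "(\<forall>\<rho>\<in>{0..1}. tilted_mean P W A \<rho> y = 0) \<or> (\<forall>\<rho>\<in>{0..1}. 0 < tilted_mean P W A \<rho> y)"
proof -
  show pw: "continuous_on {0..1} (\<lambda>\<rho>. pmf (W x) y powr (1 / (1 + \<rho>)))" for x
    by (cases "pmf (W x) y = 0") (auto intro!: continuous_intros)
  show "continuous_on {0..1} (\<lambda>\<rho>. tilted_mean P W A \<rho> y)"
    unfolding tilted_mean_finite[OF assms] by (intro continuous_intros pw)
  show "(\<forall>\<rho>\<in>{0..1}. tilted_mean P W A \<rho> y = 0) \<or> (\<forall>\<rho>\<in>{0..1}. 0 < tilted_mean P W A \<rho> y)"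
  proof (cases "\<exists>x\<in>A. x \<in> set_pmf P \<and> y \<in> set_pmf (W x)")
    case True
    then show ?thesis using tilted_mean_pos[of _ _ A P y W] by fastforce
  next
    case False
    then have "tilted_mean P W A \<rho> y = 0" for \<rho>
      unfolding tilted_mean_finite[OF assms] by (intro sum.neutral) (auto simp: set_pmf_iff)
    then show ?thesis by simp
  qed
qed

text \<open>The same number as \<open>rate\<close>, written as an explicit finite sum outside the
  locale so that it can be treated as a function of \<rho>.\<close>

definition tilted_rate :: "'a pmf \<Rightarrow> ('a \<Rightarrow> 'b pmf) \<Rightarrow> 'a set \<Rightarrow> 'b set \<Rightarrow> real \<Rightarrow> real" where
  "tilted_rate P W A B \<rho> = (\<Sum>(x, x', y)\<in>A \<times> A \<times> B. tilted_weight P W A B \<rho> (x, x', y) * tilted_density P W A \<rho> x y)"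

lemma (in tilting) rate_eq: "rate = tilted_rate P W A B \<rho>"
proof -
  have "rate = (\<Sum>z\<in>A \<times> A \<times> B. (case z of (x, x', y) \<Rightarrow> dens x y) * pmf T z)"
    unfolding rate_def
    by (rule integral_measure_pmf_real) (use finA finB set_pmf_T in auto)
  then show ?thesis
    by (simp add: tilted_rate_def pmf_T split_beta mult.commute)
qed

lemma continuous_tilted_rate:
  assumes "\<And>\<rho>. \<rho> \<in> {0..1} \<Longrightarrow> tilting P W A B \<rho> x0 x1 y0"
  shows "continuous_on {0..1} (tilted_rate P W A B)"
proof -
  interpret t0: tilting P W A B 0 x0 x1 y0 by (rule assms) simp
  note pw = continuous_tilted_mean_terms(1)[OF t0.finA, where W = W]
  note k = continuous_tilted_mean_terms(2)[OF t0.finA, where W = W and P = P]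
  note dich = continuous_tilted_mean_terms(3)[OF t0.finA, where W = W and P = P]
  have kp: "continuous_on {0..1} (\<lambda>\<rho>. tilted_mean P W A \<rho> y powr g \<rho>)"
    if "continuous_on {0..1} g" for y and g :: "real \<Rightarrow> real"
    using dich[of y]
  proof
    assume 0: "\<forall>\<rho>\<in>{0..1}. tilted_mean P W A \<rho> y = 0"
    have "continuous_on {0..1} (\<lambda>_::real. 0::real)" by simp
    then show ?thesis by (rule continuous_on_cong[THEN iffD1, rotated 2]) (use 0 in auto)
  next
    assume "\<forall>\<rho>\<in>{0..1}. 0 < tilted_mean P W A \<rho> y"
    then show ?thesis using that k by (intro continuous_on_powr) (auto simp: less_imp_neq[symmetric])
  qed
  have kl: "continuous_on {0..1} (\<lambda>\<rho>. ln (tilted_mean P W A \<rho> y))" for y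
    using dich[of y]
  proof
    assume 0: "\<forall>\<rho>\<in>{0..1}. tilted_mean P W A \<rho> y = 0"
    have "continuous_on {0..1} (\<lambda>_::real. ln 0::real)" by simp
    then show ?thesis by (rule continuous_on_cong[THEN iffD1, rotated 2]) (use 0 in auto)
  next
    assume "\<forall>\<rho>\<in>{0..1}. 0 < tilted_mean P W A \<rho> y"
    then show ?thesis using k by (intro continuous_on_ln) (auto simp: less_imp_neq[symmetric])
  qed
  have kp1: "continuous_on {0..1} (\<lambda>\<rho>. tilted_mean P W A \<rho> y powr (\<rho> - 1))" for y
    by (intro kp continuous_intros)
  have kp2: "continuous_on {0..1} (\<lambda>\<rho>. tilted_mean P W A \<rho> y powr (1 + \<rho>))" for y
    by (intro kp continuous_intros)
  have lin: "continuous_on {0..1} (\<lambda>\<rho>::real. 1 / (1 + \<rho>))"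
    by (intro continuous_intros) auto
  have f: "continuous_on {0..1} (truncated_sum P W A B)"
    unfolding truncated_sum_def[abs_def] by (intro continuous_on_sum kp2)
  have f0: "truncated_sum P W A B \<rho> \<noteq> 0" if "\<rho> \<in> {0..1}" for \<rho>
    using tilting.f_pos[OF assms[OF that]] by simp
  have "continuous_on {0..1} (\<lambda>\<rho>. \<Sum>z\<in>A \<times> A \<times> B. tilted_weight P W A B \<rho> z *
      tilted_density P W A \<rho> (fst z) (snd (snd z)))"
    unfolding tilted_weight_def tilted_density_def split_beta
    by (intro continuous_on_sum continuous_on_mult continuous_on_divide continuous_on_diff continuous_on_const
        kp1 kl pw f lin ballI f0) auto
  then show ?thesis
    by (simp add: tilted_rate_def[abs_def] split_beta)
qed

text \<open>A \<open>\<rho>\<close> at which the tilted information rate equals \<open>R\<close> will do; if there is none, the rate stays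
  on one side of \<open>R\<close> and an end point of \<open>[0, 1]\<close> satisfies the inequality.\<close>

lemma ex_tilting:
  assumes "\<And>\<rho>. \<rho> \<in> {0..1} \<Longrightarrow> tilting P W A B \<rho> x0 x1 y0"
  obtains \<rho> where "\<rho> \<in> {0..1}"
    "(1 - \<rho>) * tilted_rate P W A B \<rho> - min R (tilted_rate P W A B \<rho>) \<le> - \<rho> * R"
proof -
  let ?I = "tilted_rate P W A B"
  consider "?I 0 \<le> R" | "R \<le> ?I 1" | "?I 1 \<le> R" "R \<le> ?I 0" by linarith
  then show ?thesis
  proof cases
    case 1
    then show ?thesis by (intro that[of 0]) auto
  next
    case 2
    then show ?thesis by (intro that[of 1]) auto
  next
    case 3
    then obtain \<rho> where "0 \<le> \<rho>" "\<rho> \<le> 1" "?I \<rho> = R"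
      using IVT2'[of ?I 1 R 0] continuous_tilted_rate[OF assms] by auto
    then show ?thesis by (intro that[of \<rho>]) (auto simp: algebra_simps)
  qed
qed

section \<open>Approximation by finite subalphabets\<close>

lemma tilted_mean_tendsto:
  assumes "0 \<le> \<rho>"
  shows "((\<lambda>A. tilted_mean P W A \<rho> y) \<longlongrightarrow> tilted_mean P W UNIV \<rho> y) (finite_subsets_at_top UNIV)"
proof -
  let ?g = "\<lambda>x. pmf P x * pmf (W x) y powr (1 / (1 + \<rho>))"
  have int: "integrable (measure_pmf P) (\<lambda>x. pmf (W x) y powr (1 / (1 + \<rho>)))"
    using tilted_mean_integrand(3)[OF assms, of P UNIV W y] by simp
  have "(?g has_sum tilted_mean P W UNIV \<rho> y) UNIV"
    using has_sum_infsum[OF infsum_pmf_mult(1)[OF int]] infsum_pmf_mult(2)[OF int] by (simp add: tilted_mean_def)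
  then have "(sum ?g \<longlongrightarrow> tilted_mean P W UNIV \<rho> y) (finite_subsets_at_top UNIV)"
    by (simp add: has_sum_def)
  then show ?thesis
    by (rule Lim_transform_eventually)
       (auto intro!: eventually_finite_subsets_at_top_weakI simp: tilted_mean_finite)
qed

lemma truncated_sum_mono:
  assumes "0 \<le> \<rho>" "A \<subseteq> A'" "B \<subseteq> B'" "finite B'"
  shows "truncated_sum P W A B \<rho> \<le> truncated_sum P W A' B' \<rho>"
proof -
  have "truncated_sum P W A B \<rho> \<le> truncated_sum P W A' B \<rho>"
    unfolding truncated_sum_def
    using assms by (intro sum_mono powr_mono2 tilted_mean_mono) (auto simp: tilted_mean_nonneg)
  also have "\<dots> \<le> truncated_sum P W A' B' \<rho>"
    unfolding truncated_sum_def using assms by (intro sum_mono2) auto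
  finally show ?thesis .
qed

lemma truncated_sum_antimono:
  assumes "0 \<le> \<rho>" "\<rho> \<le> \<rho>'"
  shows "truncated_sum P W A B \<rho>' \<le> truncated_sum P W A B \<rho>"
  unfolding truncated_sum_def using assms by (intro sum_mono tilted_mean_powr_antimono)

text \<open>Convergence of the outer sum first provides a finite B; for these finitely many outputs
  the tilted means over finite A converge together.\<close>

lemma ex_truncation:
  assumes \<rho>: "0 \<le> \<rho>" and t: "t < gallager_sum P W \<rho>"
  obtains A B where "finite A" "finite B" "t < truncated_sum P W A B \<rho>"
proof -
  let ?g = "\<lambda>y. tilted_mean P W UNIV \<rho> y powr (1 + \<rho>)"
  have "(sum ?g \<longlongrightarrow> gallager_sum P W \<rho>) (finite_subsets_at_top UNIV)"
    using has_sum_infsum[OF gallager_sum_summable[OF \<rho>], of P W] by (simp add: has_sum_def gallager_sum_def)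
  then have "\<forall>\<^sub>F B in finite_subsets_at_top UNIV. t < sum ?g B" using t by (rule order_tendstoD)
  then obtain B where B: "finite B" "t < sum ?g B"
    by (auto simp: eventually_finite_subsets_at_top)
  have "((\<lambda>A. truncated_sum P W A B \<rho>) \<longlongrightarrow> sum ?g B) (finite_subsets_at_top UNIV)"
    unfolding truncated_sum_def
    using \<rho> by (intro tendsto_sum tendsto_powr' tilted_mean_tendsto tendsto_const) (auto simp: tilted_mean_nonneg)
  then have "\<forall>\<^sub>F A in finite_subsets_at_top UNIV. t < truncated_sum P W A B \<rho>" using B(2) by (rule order_tendstoD)
  then obtain A where "finite A" "t < truncated_sum P W A B \<rho>"
    by (auto simp: eventually_finite_subsets_at_top)
  then show ?thesis using B(1) that by blast
qed

text \<open>A single pair of subalphabets has to serve every \<rho>. Truncated sums decrease in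
  \<rho>, so it is enough to approximate at the finitely many points i / N and to round \<rho> up;
  the linear term \<rho> R then changes by at most R / N.\<close>

lemma ex_truncation_uniform:
  assumes E: "\<And>\<rho>. \<rho> \<in> {0..1} \<Longrightarrow> - ln (gallager_sum P W \<rho>) - \<rho> * R \<le> E"
    and R: "0 \<le> R" and \<epsilon>: "0 < \<epsilon>" and fin: "finite A0" "finite B0"
  obtains A B where "finite A" "finite B" "A0 \<subseteq> A" "B0 \<subseteq> B"
    "\<And>\<rho>. \<rho> \<in> {0..1} \<Longrightarrow> 0 < truncated_sum P W A B \<rho> \<Longrightarrow> - ln (truncated_sum P W A B \<rho>) - \<rho> * R \<le> E + \<epsilon>"
proof -
  obtain N :: nat where N: "0 < N" "R / N \<le> \<epsilon> / 2"
  proof -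
    obtain N :: nat where N: "2 * R / \<epsilon> < N" using reals_Archimedean2 by blast
    have "R / Suc N \<le> \<epsilon> / 2" using N \<epsilon> by (simp add: field_simps)
    then show ?thesis using that[of "Suc N"] by simp
  qed
  define r where "r i = real i / real N" for i
  have r: "0 \<le> r i" "i \<le> N \<Longrightarrow> r i \<le> 1" for i using N by (auto simp: r_def)
  have "\<exists>A B. finite A \<and> finite B \<and> exp (- (\<epsilon> / 2)) * gallager_sum P W (r i) < truncated_sum P W A B (r i)" for i
  proof -
    have "exp (- (\<epsilon> / 2)) * gallager_sum P W (r i) < 1 * gallager_sum P W (r i)"
      using \<epsilon> gallager_sum_pos[OF r(1), of P W] by (intro mult_strict_right_mono) auto
    then show ?thesis using ex_truncation[OF r(1), of "exp (- (\<epsilon> / 2)) * gallager_sum P W (r i)" P W] by (metis mult_1)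
  qed
  then obtain AA BB where AB: "\<And>i. finite (AA i)" "\<And>i. finite (BB i)"
    "\<And>i. exp (- (\<epsilon> / 2)) * gallager_sum P W (r i) < truncated_sum P W (AA i) (BB i) (r i)" by metis
  define A where "A = A0 \<union> (\<Union>i\<le>N. AA i)"
  define B where "B = B0 \<union> (\<Union>i\<le>N. BB i)"
  have finA: "finite A" and finB: "finite B" using fin AB by (auto simp: A_def B_def)
  have ge: "exp (- (\<epsilon> / 2)) * gallager_sum P W (r i) < truncated_sum P W A B (r i)" if "i \<le> N" for i
  proof -
    have "truncated_sum P W (AA i) (BB i) (r i) \<le> truncated_sum P W A B (r i)"
      using that finB by (intro truncated_sum_mono r) (auto simp: A_def B_def)
    then show ?thesis using AB(3)[of i] by simp
  qed
  show ?thesis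
  proof (rule that[OF finA finB])
    fix \<rho> :: real assume \<rho>: "\<rho> \<in> {0..1}" and pos: "0 < truncated_sum P W A B \<rho>"
    \<comment> \<open>Rounding up puts \<rho> to the left of the grid point, where the truncated sum
      is at least as large.\<close>
    define i where "i = nat \<lceil>\<rho> * N\<rceil>"
    have i: "\<rho> * N \<le> i" "real i < \<rho> * N + 1" using \<rho> by (auto simp: i_def) linarith+
    have "\<rho> * real N \<le> 1 * real N" using \<rho> by (intro mult_right_mono) auto
    then have iN: "i \<le> N" using i(2) by linarith
    have \<rho>r: "\<rho> \<le> r i" "r i \<le> \<rho> + 1 / N" using i N by (auto simp: r_def field_simps)
    have "exp (- (\<epsilon> / 2)) * gallager_sum P W (r i) \<le> truncated_sum P W A B (r i)" using ge[OF iN] by simp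
    also have "\<dots> \<le> truncated_sum P W A B \<rho>" using \<rho> \<rho>r by (intro truncated_sum_antimono) auto
    finally have "ln (exp (- (\<epsilon> / 2)) * gallager_sum P W (r i)) \<le> ln (truncated_sum P W A B \<rho>)"
      using gallager_sum_pos[OF r(1), of P W i] by (intro ln_mono) auto
    then have 1: "- (\<epsilon> / 2) + ln (gallager_sum P W (r i)) \<le> ln (truncated_sum P W A B \<rho>)"
      using gallager_sum_pos[OF r(1), of P W i] by (simp add: ln_mult)
    have 2: "- ln (gallager_sum P W (r i)) - r i * R \<le> E" using E[of "r i"] r iN by simp
    have "r i * R \<le> (\<rho> + 1 / N) * R" using \<rho>r R by (intro mult_right_mono) auto
    moreover have "(\<rho> + 1 / N) * R = \<rho> * R + R / N" by (simp add: distrib_right)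
    ultimately have "r i * R \<le> \<rho> * R + \<epsilon> / 2" using N(2) by linarith
    then show "- ln (truncated_sum P W A B \<rho>) - \<rho> * R \<le> E + \<epsilon>" using 1 2 by linarith
  qed (auto simp: A_def B_def)
qed

lemma expected_loss_lower_exponent:
  fixes P :: "'a pmf" and W :: "'a \<Rightarrow> 'b pmf" and E R \<epsilon> :: real
  assumes overlap: "x0 \<in> set_pmf P" "x1 \<in> set_pmf P" "x0 \<noteq> x1" "y0 \<in> set_pmf (W x0)" "y0 \<in> set_pmf (W x1)"
    and E: "\<And>\<rho>. \<rho> \<in> {0..1} \<Longrightarrow> - ln (gallager_sum P W \<rho>) - \<rho> * R \<le> E"
    and R: "0 \<le> R" and \<epsilon>: "0 < \<epsilon>"
    and M: "\<forall>\<^sub>F n in sequentially. exp (real n * R) / 2 \<le> real (M n) - 1"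
  shows "\<forall>\<^sub>F n in sequentially. exp (- (n * (E + \<epsilon>))) / 64 \<le>
    measure_pmf.expectation (codebook_pmf n (M n) P) (\<lambda>c. posterior_loss (code_joint_pmf n (M n) W c))"
proof -
  obtain A B where AB: "finite A" "finite B" "{x0, x1} \<subseteq> A" "{y0} \<subseteq> B"
    and le: "\<And>\<rho>. \<rho> \<in> {0..1} \<Longrightarrow> 0 < truncated_sum P W A B \<rho> \<Longrightarrow>
      - ln (truncated_sum P W A B \<rho>) - \<rho> * R \<le> E + \<epsilon> / 2"
    using ex_truncation_uniform[of P W R E "\<epsilon> / 2" "{x0, x1}" "{y0}", OF E R half_gt_zero[OF \<epsilon>]
        finite.insertI[OF finite.insertI[OF finite.emptyI]] finite.insertI[OF finite.emptyI]]
    by blast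
  have t: "tilting P W A B \<rho> x0 x1 y0" if "\<rho> \<in> {0..1}" for \<rho>
    using that AB overlap by unfold_locales auto
  obtain \<rho> where \<rho>: "\<rho> \<in> {0..1}"
    "(1 - \<rho>) * tilted_rate P W A B \<rho> - min R (tilted_rate P W A B \<rho>) \<le> - \<rho> * R"
    using ex_tilting[OF t] by blast
  interpret tilting P W A B \<rho> x0 x1 y0 by (rule t[OF \<rho>(1)])
  \<comment> \<open>The choice of \<rho> replaces the rate terms by - \<rho> R. Half of \<epsilon>
    pays for truncation, the other half for the three units of \<delta> = \<epsilon> / 6.\<close>
  have "- ln f + (1 - \<rho>) * rate - min R rate + 3 * (\<epsilon> / 6) \<le> E + \<epsilon>"
    using le[OF \<rho>(1) f_pos] \<rho>(2) unfolding rate_eq by simp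
  then have "exp (- (n * (E + \<epsilon>))) \<le> exp (- (n * (- ln f + (1 - \<rho>) * rate - min R rate + 3 * (\<epsilon> / 6))))" for n :: nat
    by (simp only: exp_le_cancel_iff neg_le_iff_le) (intro mult_left_mono, auto)
  moreover have "\<forall>\<^sub>F n in sequentially.
    exp (- (n * (- ln f + (1 - \<rho>) * rate - min R rate + 3 * (\<epsilon> / 6)))) / 64 \<le>
    measure_pmf.expectation (codebook_pmf n (M n) P) (\<lambda>c. posterior_loss (code_joint_pmf n (M n) W c))"
    by (rule expected_loss_exponent[OF _ M]) (use \<epsilon> in simp)
  ultimately show ?thesis
    by (elim eventually_mono) (rule order_trans[OF divide_right_mono], auto)
qed

section \<open>Vanishing entropy and the size of the code\<close>

text \<open>If v determines u, every posterior is 0 or 1 and entropies of all orders vanish. Read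
  contrapositively for codes, a nonzero ensemble entropy excludes the single-message code and yields
  two letters with a common output.\<close>

lemma arimoto_renyi_determined:
  fixes J :: "('u \<times> 'v) pmf"
  assumes "0 < \<alpha>" and fin: "finite (fst ` set_pmf J)"
    and det: "\<And>u u' v. (u, v) \<in> set_pmf J \<Longrightarrow> (u', v) \<in> set_pmf J \<Longrightarrow> u = u'"
  shows "arimoto_renyi b \<alpha> J = 0"
proof -
  let ?A = "fst ` set_pmf J"
  have c01: "cond_prob_fst J u v \<in> {0, 1}" for u v
  proof (cases "(u, v) \<in> set_pmf J")
    case True
    have "pmf (map_pmf snd J) v = (\<Sum>u'\<in>{u}. pmf J (u', v))"
      unfolding pmf_snd_eq_sum[OF fin order_refl]
    proof (rule sum.mono_neutral_right[OF fin])
      show "{u} \<subseteq> ?A" using True by force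
      show "\<forall>u'\<in>?A - {u}. pmf J (u', v) = 0"
        using det[OF _ True] by (auto simp: pmf_eq_0_set_pmf)
    qed
    then show ?thesis using True by (simp add: cond_prob_fst_def set_pmf_iff)
  next
    case False
    then show ?thesis by (simp add: cond_prob_fst_def set_pmf_iff)
  qed
  have sum1: "(\<Sum>\<^sub>\<infinity>u. h (cond_prob_fst J u v)) = h 1"
    if v: "v \<in> set_pmf (map_pmf snd J)" and h: "h 0 = 0" for v and h :: "real \<Rightarrow> real"
  proof -
    have "(\<Sum>\<^sub>\<infinity>u. h (cond_prob_fst J u v)) = (\<Sum>u\<in>?A. h (cond_prob_fst J u v))"
      by (rule infsum_cond_prob_fst[OF fin order_refl, where h = h]) (rule h)
    also have "\<dots> = (\<Sum>u\<in>?A. cond_prob_fst J u v * h 1)"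
    proof (intro sum.cong refl)
      fix u
      show "h (cond_prob_fst J u v) = cond_prob_fst J u v * h 1" using c01[of u v] h by auto
    qed
    also have "\<dots> = h 1" using sum_cond_prob_fst[OF fin order_refl v] by (simp flip: sum_distrib_right)
    finally show ?thesis .
  qed
  show ?thesis
  proof (cases "\<alpha> = 1")
    case True
    have "measure_pmf.expectation (map_pmf snd J)
          (\<lambda>v. - (\<Sum>\<^sub>\<infinity>u. cond_prob_fst J u v * log b (cond_prob_fst J u v))) = measure_pmf.expectation (map_pmf snd J) (\<lambda>_. 0)"
      by (rule expectation_pmf_cong) (use sum1[where h = "\<lambda>t. t * log b t"] in simp)
    then show ?thesis using True by (simp add: arimoto_renyi_def del: integral_map_pmf)
  next
    case False
    have "measure_pmf.expectation (map_pmf snd J)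
          (\<lambda>v. (\<Sum>\<^sub>\<infinity>u. cond_prob_fst J u v powr \<alpha>) powr (1 / \<alpha>)) = measure_pmf.expectation (map_pmf snd J) (\<lambda>_. 1)"
      by (rule expectation_pmf_cong) (use sum1[where h = "\<lambda>t. t powr \<alpha>"] in simp)
    then show ?thesis using False by (simp add: arimoto_renyi_def del: integral_map_pmf)
  qed
qed

lemma fst_set_code_joint_pmf: "0 < M \<Longrightarrow> fst ` set_pmf (code_joint_pmf n M W c) \<subseteq> c ` {..<M}"
  by (auto simp: code_joint_pmf_def joint_pmf_def lessThan_empty_iff)

lemma finite_fst_code_joint_pmf:
  assumes "0 < M"
  shows "finite (fst ` set_pmf (code_joint_pmf n M W c))" "card (fst ` set_pmf (code_joint_pmf n M W c)) \<le> M"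
proof -
  show "finite (fst ` set_pmf (code_joint_pmf n M W c))"
    by (rule finite_subset[OF fst_set_code_joint_pmf[OF assms]]) simp
  show "card (fst ` set_pmf (code_joint_pmf n M W c)) \<le> M"
    using card_mono[OF _ fst_set_code_joint_pmf[OF assms]] card_image_le[of "{..<M}" c]
    by (metis card_lessThan finite_imageI finite_lessThan le_trans)
qed

lemma code_size_ge: "b powr (real n * R) \<le> real (code_size b R n)"
  unfolding code_size_def by (smt (verit) of_nat_nat powr_ge_zero real_nat_ceiling_ge)

lemma code_size_pos: "1 < b \<Longrightarrow> 0 < code_size b R n"
  using code_size_ge[of b n R] by (smt (verit) gr0I of_nat_0 powr_gt_zero)

lemma code_size_le:
  assumes "1 < b" "0 \<le> R"
  shows "real (code_size b R n) \<le> 2 * b powr (real n * R)"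
proof -
  have "1 \<le> b powr (real n * R)" using assms by (intro ge_one_powr_ge_zero) auto
  then show ?thesis unfolding code_size_def by linarith
qed

lemma ensemble_entropy_0_rate_0:
  assumes "0 < \<alpha>" "1 < b"
  shows "ensemble_entropy b \<alpha> 0 P W n = 0"
proof -
  have 1: "code_size b 0 n = 1" using assms by (simp add: code_size_def)
  have "arimoto_renyi b \<alpha> (code_joint_pmf n 1 W c) = 0" for c
  proof (rule arimoto_renyi_determined[OF assms(1) finite_fst_code_joint_pmf(1)])
    fix u u' v
    assume "(u, v) \<in> set_pmf (code_joint_pmf n 1 W c)" "(u', v) \<in> set_pmf (code_joint_pmf n 1 W c)"
    then have "u \<in> c ` {..<1}" "u' \<in> c ` {..<1}" using fst_set_code_joint_pmf[of 1 n W c] by force+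
    then show "u = u'" by (auto simp: lessThan_Suc)
  qed simp
  then show ?thesis by (simp add: ensemble_entropy_def 1)
qed

text \<open>The assumption lets each output letter determine the input letter; applied at every
  position it lets the output word determine the codeword.\<close>

lemma ensemble_entropy_0_disjoint:
  assumes \<alpha>: "0 < \<alpha>" and b: "1 < b"
    and disj: "\<And>x x' y. x \<in> set_pmf P \<Longrightarrow> x' \<in> set_pmf P \<Longrightarrow> y \<in> set_pmf (W x) \<Longrightarrow> y \<in> set_pmf (W x') \<Longrightarrow> x = x'"
  shows "ensemble_entropy b \<alpha> R P W n = 0"
proof -
  let ?M = "code_size b R n"
  have M: "0 < ?M" by (rule code_size_pos[OF b])
  have "arimoto_renyi b \<alpha> (code_joint_pmf n ?M W c) = 0" if c: "c \<in> set_pmf (codebook_pmf n ?M P)" for c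
  proof (rule arimoto_renyi_determined[OF \<alpha> finite_fst_code_joint_pmf(1)[OF M]])
    fix u u' v
    assume u: "(u, v) \<in> set_pmf (code_joint_pmf n ?M W c)" and u': "(u', v) \<in> set_pmf (code_joint_pmf n ?M W c)"
    have word: "w \<in> set_pmf (iid_pmf n P) \<and> v \<in> set_pmf (memoryless n W w)"
      if "(w, v) \<in> set_pmf (code_joint_pmf n ?M W c)" for w
      using that c M by (auto simp: code_joint_pmf_def joint_pmf_def codebook_pmf_def set_Pi_pmf PiE_dflt_def lessThan_empty_iff)
    show "u = u'"
    proof
      fix i
      show "u i = u' i"
        using word[OF u] word[OF u'] disj[of "u i" "u' i" "v i"]
        by (cases "i < n") (auto simp: iid_pmf_def memoryless_def set_Pi_pmf PiE_dflt_def)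
    qed
  qed
  then have "ensemble_entropy b \<alpha> R P W n = measure_pmf.expectation (codebook_pmf n ?M P) (\<lambda>_. 0)"
    unfolding ensemble_entropy_def by (rule expectation_pmf_cong)
  then show ?thesis by simp
qed

subsection \<open>Exponents and the critical rate\<close>

text \<open>A constant factor contributes log b C / n to the exponent and disappears in the limit. A
  vanishing entropy has exponent \<infinity> and is harmless for a lower bound.\<close>

lemma liminf_entropy_exponent_ge:
  assumes b: "1 < b" and C: "0 < C"
    and H: "\<And>n. 0 \<le> ensemble_entropy b \<alpha> R P W n"
      "\<And>n. ensemble_entropy b \<alpha> R P W n \<le> C * b powr (- (real n * v))"
  shows "ereal v \<le> liminf (entropy_exponent b \<alpha> R P W)"
proof -
  have le: "ereal (v - log b C / n) \<le> entropy_exponent b \<alpha> R P W n" if n: "0 < n" for n :: nat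
  proof (cases "ensemble_entropy b \<alpha> R P W n = 0")
    case True
    then show ?thesis using n by (simp add: entropy_exponent_def elog_def)
  next
    case False
    let ?H = "ensemble_entropy b \<alpha> R P W n"
    have pos: "0 < ?H" using False H(1)[of n] by simp
    have "log b ?H \<le> log b (C * b powr (- (real n * v)))"
      using pos H(2)[of n] b by (simp add: log_le_cancel_iff)
    also have "\<dots> = log b C - n * v" using C b by (simp add: log_mult log_powr)
    finally have "1 / n * log b ?H \<le> 1 / n * (log b C - n * v)" by (rule mult_left_mono) simp
    also have "\<dots> = log b C / n - v" using n by (simp add: field_simps)
    finally show ?thesis using False by (simp add: entropy_exponent_def elog_def)
  qed
  have lim: "(\<lambda>n. ereal (v - log b C / real n)) \<longlonglongrightarrow> ereal (v - 0)"
    by (intro tendsto_intros lim_const_over_n)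
  have "ereal v = liminf (\<lambda>n. ereal (v - log b C / real n))"
    using lim_imp_Liminf[OF sequentially_bot lim] by simp
  also have "\<dots> \<le> liminf (entropy_exponent b \<alpha> R P W)"
  proof (rule Liminf_mono)
    show "\<forall>\<^sub>F n in sequentially. ereal (v - log b C / real n) \<le> entropy_exponent b \<alpha> R P W n"
      using eventually_gt_at_top[of 0] by eventually_elim (rule le)
  qed
  finally show ?thesis .
qed

lemma limsup_entropy_exponent_le:
  assumes b: "1 < b" and C: "0 < C"
    and H: "\<forall>\<^sub>F n in sequentially. C * b powr (- (real n * v)) \<le> ensemble_entropy b \<alpha> R P W n"
  shows "limsup (entropy_exponent b \<alpha> R P W) \<le> ereal v"
proof -
  have le: "entropy_exponent b \<alpha> R P W n \<le> ereal (v - log b C / n)"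
    if n: "0 < n" and H: "C * b powr (- (real n * v)) \<le> ensemble_entropy b \<alpha> R P W n" for n :: nat
  proof -
    let ?H = "ensemble_entropy b \<alpha> R P W n"
    have pos0: "0 < C * b powr (- (real n * v))" using C b by simp
    then have pos: "0 < ?H" using H by linarith
    have "log b C - n * v = log b (C * b powr (- (real n * v)))" using C b by (simp add: log_mult log_powr)
    also have "\<dots> \<le> log b ?H" using pos pos0 H b by (simp add: log_le_cancel_iff)
    finally have "1 / n * (log b C - n * v) \<le> 1 / n * log b ?H" by (rule mult_left_mono) simp
    moreover have "1 / n * (log b C - n * v) = log b C / n - v" using n by (simp add: field_simps)
    ultimately show ?thesis using pos by (simp add: entropy_exponent_def elog_def)
  qed
  have lim: "(\<lambda>n. ereal (v - log b C / real n)) \<longlonglongrightarrow> ereal (v - 0)"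
    by (intro tendsto_intros lim_const_over_n)
  have "limsup (entropy_exponent b \<alpha> R P W) \<le> limsup (\<lambda>n. ereal (v - log b C / real n))"
  proof (rule Limsup_mono)
    show "\<forall>\<^sub>F n in sequentially. entropy_exponent b \<alpha> R P W n \<le> ereal (v - log b C / real n)"
      using eventually_gt_at_top[of 0] H by eventually_elim (rule le)
  qed
  also have "limsup (\<lambda>n. ereal (v - log b C / real n)) = ereal v"
    using lim_imp_Limsup[OF sequentially_bot lim] by simp
  finally show ?thesis .
qed

lemma expectation_posterior_loss_bounds:
  "integrable (measure_pmf p) (\<lambda>c. posterior_loss (J c))"
  "0 \<le> measure_pmf.expectation p (\<lambda>c. posterior_loss (J c))"
proof -
  show "integrable (measure_pmf p) (\<lambda>c. posterior_loss (J c))"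
  proof (rule integrable_pmf_bounded)
    show "\<bar>posterior_loss (J c)\<bar> \<le> 1" for c
      using posterior_loss_nonneg[of "J c"] posterior_loss_le_1[of "J c"] by linarith
  qed
  show "0 \<le> measure_pmf.expectation p (\<lambda>c. posterior_loss (J c))"
    by (intro Bochner_Integration.integral_nonneg posterior_loss_nonneg)
qed

lemma ensemble_entropy_ge:
  assumes b: "1 < b" and \<alpha>: "0 < \<alpha>"
  obtains c where "0 < c"
    "\<And>n. ensemble_entropy b \<alpha> R P W n \<noteq> 0 \<Longrightarrow>
      c * measure_pmf.expectation (codebook_pmf n (code_size b R n) P)
        (\<lambda>d. posterior_loss (code_joint_pmf n (code_size b R n) W d)) \<le> ensemble_entropy b \<alpha> R P W n"
    "\<And>n. 0 \<le> ensemble_entropy b \<alpha> R P W n"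
proof -
  obtain c where c: "0 < c"
    "\<And>J :: ((nat \<Rightarrow> 'a) \<times> (nat \<Rightarrow> 'b)) pmf. finite (fst ` set_pmf J) \<Longrightarrow> c * posterior_loss J \<le> arimoto_renyi b \<alpha> J"
    using posterior_loss_le_arimoto_renyi[OF b \<alpha>] by blast
  have le: "c * posterior_loss (code_joint_pmf n (code_size b R n) W d) \<le> arimoto_renyi b \<alpha> (code_joint_pmf n (code_size b R n) W d)" for n d
    by (intro c(2) finite_fst_code_joint_pmf code_size_pos b)
  show ?thesis
  proof (rule that[OF c(1)])
    fix n assume ne: "ensemble_entropy b \<alpha> R P W n \<noteq> 0"
    let ?p = "codebook_pmf n (code_size b R n) P"
    \<comment> \<open>A Bochner integral of a non-integrable function is 0, so a nonzero expectation
      certifies integrability.\<close>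
    have "integrable (measure_pmf ?p) (\<lambda>d. arimoto_renyi b \<alpha> (code_joint_pmf n (code_size b R n) W d))"
      using ne unfolding ensemble_entropy_def by (metis not_integrable_integral_eq)
    then have "measure_pmf.expectation ?p (\<lambda>d. c * posterior_loss (code_joint_pmf n (code_size b R n) W d)) \<le> ensemble_entropy b \<alpha> R P W n"
      unfolding ensemble_entropy_def
      by (intro expectation_pmf_mono integrable_mult_right expectation_posterior_loss_bounds le)
    then show "c * measure_pmf.expectation ?p (\<lambda>d. posterior_loss (code_joint_pmf n (code_size b R n) W d)) \<le> ensemble_entropy b \<alpha> R P W n"
      by simp
  next
    fix n
    have "0 \<le> arimoto_renyi b \<alpha> (code_joint_pmf n (code_size b R n) W d)" for d
      using le[of n d] c(1) posterior_loss_nonneg[of "code_joint_pmf n (code_size b R n) W d"]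
      by (meson mult_nonneg_nonneg less_imp_le order_trans)
    then show "0 \<le> ensemble_entropy b \<alpha> R P W n"
      unfolding ensemble_entropy_def by (intro Bochner_Integration.integral_nonneg)
  qed
qed

text \<open>The affine bound with contact point T is averaged over the codebook. Since T bounds the
  scaled mean loss, the tangent at T evaluates to at most T powr \<alpha>, and the linear term to at
  most T.\<close>

lemma ensemble_entropy_le:
  fixes T :: real
  assumes b: "1 < b" and \<alpha>: "0 < \<alpha>" "\<alpha> < 1" and T: "0 < T"
    and loss: "code_size b R n powr ((1 - \<alpha>) / \<alpha>) * measure_pmf.expectation (codebook_pmf n (code_size b R n) P)
      (\<lambda>c. posterior_loss (code_joint_pmf n (code_size b R n) W c)) \<le> T"
  shows "ensemble_entropy b \<alpha> R P W n \<le> 2 powr (1 / \<alpha>) / ((1 - \<alpha>) * ln b) * (T powr \<alpha> + T)"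
proof -
  let ?p = "codebook_pmf n (code_size b R n) P" and ?J = "code_joint_pmf n (code_size b R n) W"
  let ?K = "2 powr (1 / \<alpha>) / ((1 - \<alpha>) * ln b)" and ?m = "code_size b R n powr ((1 - \<alpha>) / \<alpha>)"
  have K: "0 \<le> ?K" using b \<alpha> by simp
  let ?U = "\<lambda>c. ?K * ((1 - \<alpha>) * T powr \<alpha> + (\<alpha> * T powr (\<alpha> - 1) + 1) * (?m * posterior_loss (?J c)))"
  have M: "0 < code_size b R n" by (rule code_size_pos[OF b])
  have le: "arimoto_renyi b \<alpha> (?J c) \<le> ?U c" for c
    by (rule arimoto_renyi_le_posterior_loss[OF b \<alpha> finite_fst_code_joint_pmf(1)[OF M] _ T])
       (use finite_fst_code_joint_pmf(2)[OF M] in simp)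
  obtain d where d: "0 < d"
    "\<And>J :: ((nat \<Rightarrow> 'a) \<times> (nat \<Rightarrow> 'b)) pmf. finite (fst ` set_pmf J) \<Longrightarrow> d * posterior_loss J \<le> arimoto_renyi b \<alpha> J"
    using posterior_loss_le_arimoto_renyi[OF b \<alpha>(1)] by blast
  have nonneg: "0 \<le> arimoto_renyi b \<alpha> (?J c)" for c
    using d(2)[OF finite_fst_code_joint_pmf(1)[OF M]] d(1) posterior_loss_nonneg[of "?J c"]
    by (meson mult_nonneg_nonneg less_imp_le order_trans)
  have intU: "integrable (measure_pmf ?p) ?U"
    by (intro integrable_mult_right Bochner_Integration.integrable_add measure_pmf.integrable_const expectation_posterior_loss_bounds)
  have intA: "integrable (measure_pmf ?p) (\<lambda>c. arimoto_renyi b \<alpha> (?J c))"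
  proof (rule Bochner_Integration.integrable_bound[OF intU])
    show "AE c in measure_pmf ?p. norm (arimoto_renyi b \<alpha> (?J c)) \<le> norm (?U c)"
    proof (rule AE_pmfI)
      fix c
      show "norm (arimoto_renyi b \<alpha> (?J c)) \<le> norm (?U c)"
        unfolding real_norm_def using le[of c] nonneg[of c] by linarith
    qed
  qed simp
  let ?L = "measure_pmf.expectation ?p (\<lambda>c. posterior_loss (?J c))"
  have lin: "measure_pmf.expectation ?p (\<lambda>c. x * (y + z * (w * posterior_loss (?J c)))) = x * (y + z * (w * ?L))" for x y z w
    using expectation_posterior_loss_bounds(1)[of ?p ?J] by simp
  have "ensemble_entropy b \<alpha> R P W n \<le> measure_pmf.expectation ?p ?U"
    unfolding ensemble_entropy_def by (intro expectation_pmf_mono intA intU le)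
  also have "\<dots> = ?K * ((1 - \<alpha>) * T powr \<alpha> + (\<alpha> * T powr (\<alpha> - 1) + 1) * (?m * ?L))" by (rule lin)
  also have "\<dots> \<le> ?K * ((1 - \<alpha>) * T powr \<alpha> + (\<alpha> * T powr (\<alpha> - 1) + 1) * T)"
    using loss K \<alpha> by (intro mult_left_mono add_left_mono) auto
  also have "(1 - \<alpha>) * T powr \<alpha> + (\<alpha> * T powr (\<alpha> - 1) + 1) * T = T powr \<alpha> + T"
    using T by (simp add: powr_diff algebra_simps)
  finally show ?thesis .
qed

text \<open>Gallager's bound makes the scaled loss T of order b powr (- n v), where the scaling
  costs (1 / \<alpha> - 1) R in the exponent. Hypothesis \<open>e\<close> says v \<ge> 0, so T powr
  \<alpha> dominates T and the entropy decays with exponent \<alpha> v.\<close>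

lemma ensemble_entropy_achievable:
  assumes b: "1 < b" and \<alpha>: "0 < \<alpha>" "\<alpha> < 1" and R: "0 \<le> R" and \<rho>: "0 \<le> \<rho>" "\<rho> \<le> 1"
    and e: "0 \<le> gallager_E0 b \<rho> P W - \<rho> * R - (1 / \<alpha> - 1) * R"
  shows "ereal (\<alpha> * (gallager_E0 b \<rho> P W - \<rho> * R) - (1 - \<alpha>) * R) \<le> liminf (entropy_exponent b \<alpha> R P W)"
proof -
  define \<kappa> where "\<kappa> = (1 - \<alpha>) / \<alpha>"
  have \<kappa>: "0 \<le> \<kappa>" "\<kappa> = 1 / \<alpha> - 1" using \<alpha> by (auto simp: \<kappa>_def field_simps)
  define v where "v = gallager_E0 b \<rho> P W - \<rho> * R - \<kappa> * R"
  have v: "0 \<le> v" using e by (simp add: v_def \<kappa>)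
  \<comment> \<open>Absorbs the factor 2 by which rounding up may enlarge the number of
    codewords.\<close>
  define D where "D = (2::real) powr (\<kappa> + \<rho>)"
  have D: "0 < D" by (simp add: D_def)
  define K where "K = 2 powr (1 / \<alpha>) / ((1 - \<alpha>) * ln b)"
  have K: "0 < K" using b \<alpha> by (simp add: K_def)
  have f: "gallager_sum P W \<rho> = b powr (- gallager_E0 b \<rho> P W)"
    using gallager_sum_pos[OF \<rho>(1), of P W] b by (simp add: gallager_E0_eq \<rho>)
  have H: "ensemble_entropy b \<alpha> R P W n \<le> K * (D powr \<alpha> + D) * b powr (- (n * (\<alpha> * v)))" for n :: nat
  proof -
    let ?M = "code_size b R n"
    let ?T = "D * b powr (- (n * v))"
    have M: "0 < ?M" by (rule code_size_pos[OF b])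
    have "?M powr \<kappa> * measure_pmf.expectation (codebook_pmf n ?M P) (\<lambda>c. posterior_loss (code_joint_pmf n ?M W c)) \<le>
        ?M powr \<kappa> * (?M powr \<rho> * gallager_sum P W \<rho> ^ n)"
      by (intro mult_left_mono expected_loss_codebook_le M \<rho>) simp
    also have "\<dots> = ?M powr (\<kappa> + \<rho>) * gallager_sum P W \<rho> ^ n" by (simp add: powr_add)
    also have "\<dots> \<le> (2 * b powr (n * R)) powr (\<kappa> + \<rho>) * gallager_sum P W \<rho> ^ n"
      using code_size_le[OF b R, of n] \<kappa> \<rho> gallager_sum_pos[OF \<rho>(1), of P W]
      by (intro mult_right_mono powr_mono2) auto
    also have "\<dots> = ?T"
    proof -
      have "gallager_sum P W \<rho> ^ n = b powr (- (n * gallager_E0 b \<rho> P W))"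
        unfolding f using b by (simp add: powr_realpow[symmetric] powr_powr mult.commute)
      moreover have "(2 * b powr (n * R)) powr (\<kappa> + \<rho>) = D * b powr (n * R * (\<kappa> + \<rho>))"
        by (simp add: powr_mult powr_powr D_def)
      ultimately have "(2 * b powr (n * R)) powr (\<kappa> + \<rho>) * gallager_sum P W \<rho> ^ n =
          D * b powr (n * R * (\<kappa> + \<rho>) + - (n * gallager_E0 b \<rho> P W))" by (simp only: powr_add mult.assoc)
      also have "n * R * (\<kappa> + \<rho>) + - (n * gallager_E0 b \<rho> P W) = - (n * v)"
        by (simp add: v_def algebra_simps)
      finally show ?thesis .
    qed
    finally have "ensemble_entropy b \<alpha> R P W n \<le> K * (?T powr \<alpha> + ?T)"
      unfolding K_def \<kappa>_def using D b by (intro ensemble_entropy_le b \<alpha>) auto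
    also have "\<dots> \<le> K * (D powr \<alpha> * b powr (- (n * (\<alpha> * v))) + D * b powr (- (n * (\<alpha> * v))))"
    proof (rule mult_left_mono, rule add_mono)
      show "?T powr \<alpha> \<le> D powr \<alpha> * b powr (- (n * (\<alpha> * v)))"
        by (simp add: powr_mult powr_powr mult_ac)
      have "n * (\<alpha> * v) \<le> n * (1 * v)" using \<alpha> v by (intro mult_left_mono mult_right_mono) auto
      then show "?T \<le> D * b powr (- (n * (\<alpha> * v)))"
        using b D by (intro mult_left_mono powr_mono) auto
    qed (use K in auto)
    finally show ?thesis by (simp add: distrib_right distrib_left mult.assoc)
  qed
  obtain c where "\<And>n. 0 \<le> ensemble_entropy b \<alpha> R P W n" using ensemble_entropy_ge[OF b \<alpha>(1)] by blast
  then have "ereal (\<alpha> * v) \<le> liminf (entropy_exponent b \<alpha> R P W)"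
    by (intro liminf_entropy_exponent_ge[OF b _ _ H]) (use K D in \<open>auto intro!: mult_pos_pos add_nonneg_pos\<close>)
  moreover have "\<alpha> * v = \<alpha> * (gallager_E0 b \<rho> P W - \<rho> * R) - (1 - \<alpha>) * R"
  proof -
    have "\<alpha> * \<kappa> = 1 - \<alpha>" using \<alpha> by (simp add: \<kappa>_def)
    moreover have "\<alpha> * v = \<alpha> * (gallager_E0 b \<rho> P W - \<rho> * R) - (\<alpha> * \<kappa>) * R"
      by (simp add: v_def algebra_simps)
    ultimately show ?thesis by simp
  qed
  ultimately show ?thesis by simp
qed

section \<open>The random coding exponent as a function of the rate\<close>

text \<open>A real-valued form of \<open>random_coding_exponent\<close>, on which continuity and
  intermediate value arguments can be carried out.\<close>

definition gallager_exponent :: "real \<Rightarrow> 'a pmf \<Rightarrow> ('a \<Rightarrow> 'b pmf) \<Rightarrow> real \<Rightarrow> real" where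
  "gallager_exponent b P W r = (SUP \<rho>\<in>{0..1}. gallager_E0 b \<rho> P W - \<rho> * r)"

context
  fixes b :: real and P :: "'a pmf" and W :: "'a \<Rightarrow> 'b pmf"
  assumes b: "1 < b"
begin

lemma gallager_exponent_bdd: "bdd_above ((\<lambda>\<rho>. gallager_E0 b \<rho> P W - \<rho> * r) ` {0..1})"
proof (rule bdd_aboveI2)
  fix \<rho> :: real assume \<rho>: "\<rho> \<in> {0..1}"
  have "gallager_E0 b \<rho> P W \<le> gallager_E0 b 1 P W" using \<rho> by (intro gallager_E0_mono b) auto
  moreover have "\<bar>\<rho> * r\<bar> \<le> \<bar>r\<bar>" using \<rho> by (auto simp: abs_mult mult_left_le_one_le)
  ultimately show "gallager_E0 b \<rho> P W - \<rho> * r \<le> gallager_E0 b 1 P W + \<bar>r\<bar>" by linarith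
qed

lemma gallager_exponent_ge: "\<rho> \<in> {0..1} \<Longrightarrow> gallager_E0 b \<rho> P W - \<rho> * r \<le> gallager_exponent b P W r"
  unfolding gallager_exponent_def by (rule cSUP_upper[OF _ gallager_exponent_bdd])

lemma gallager_exponent_le: "(\<And>\<rho>. \<rho> \<in> {0..1} \<Longrightarrow> gallager_E0 b \<rho> P W - \<rho> * r \<le> c) \<Longrightarrow> gallager_exponent b P W r \<le> c"
  unfolding gallager_exponent_def by (rule cSUP_least) auto

lemma gallager_exponent_less: "c < gallager_exponent b P W r \<Longrightarrow> \<exists>\<rho>\<in>{0..1}. c < gallager_E0 b \<rho> P W - \<rho> * r"
  using gallager_exponent_le[of r c] by force

lemma gallager_exponent_nonneg: "0 \<le> gallager_exponent b P W r"
  using gallager_exponent_ge[of 0 r] by (simp add: gallager_E0_0)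

lemma gallager_exponent_antimono: "r \<le> r' \<Longrightarrow> gallager_exponent b P W r' \<le> gallager_exponent b P W r"
  by (rule gallager_exponent_le, rule order_trans[OF _ gallager_exponent_ge]) (auto intro: mult_left_mono)

text \<open>The exponent is a supremum of affine functions of r with slopes - \<rho> in [-1, 0];
  hence it decreases, and no faster than with slope -1.\<close>

lemma gallager_exponent_lipschitz: "r \<le> r' \<Longrightarrow> gallager_exponent b P W r \<le> gallager_exponent b P W r' + (r' - r)"
proof (rule gallager_exponent_le)
  fix \<rho> :: real assume \<rho>: "\<rho> \<in> {0..1}" and r: "r \<le> r'"
  have "\<rho> * (r' - r) \<le> 1 * (r' - r)" using \<rho> r by (intro mult_right_mono) auto
  then show "gallager_E0 b \<rho> P W - \<rho> * r \<le> gallager_exponent b P W r' + (r' - r)"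
    using gallager_exponent_ge[OF \<rho>, of r'] by (simp add: algebra_simps)
qed

lemma continuous_gallager_exponent: "continuous_on S (gallager_exponent b P W)"
proof (rule continuous_on_subset[of UNIV])
  have "\<bar>gallager_exponent b P W r - gallager_exponent b P W r'\<bar> \<le> \<bar>r - r'\<bar>" for r r'
    using gallager_exponent_antimono[of r r'] gallager_exponent_antimono[of r' r] gallager_exponent_lipschitz[of r r'] gallager_exponent_lipschitz[of r' r]
    by linarith
  then show "continuous_on UNIV (gallager_exponent b P W)"
    unfolding continuous_on_iff dist_real_def by (meson le_less_trans)
qed simp

lemma random_coding_term:
  assumes "\<rho> \<in> {0..1}"
  shows "ereal \<rho> * (alpha_mutual_info b (1 / (1 + \<rho>)) P W - ereal r) = ereal (gallager_E0 b \<rho> P W - \<rho> * r)"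
proof (cases "\<rho> = 0")
  case True
  then show ?thesis by (simp add: gallager_E0_0 zero_ereal_def[symmetric])
next
  case False
  then have "1 / (1 + \<rho>) \<noteq> 1" using assms by (simp add: field_simps)
  then show ?thesis using False by (simp add: alpha_mutual_info_def right_diff_distrib)
qed

lemma random_coding_exponent_eq: "random_coding_exponent b r P W = ereal (gallager_exponent b P W r)"
proof -
  have "random_coding_exponent b r P W = (SUP \<rho>\<in>{0..1}. ereal (gallager_E0 b \<rho> P W - \<rho> * r))"
    unfolding random_coding_exponent_def by (intro SUP_cong refl random_coding_term)
  also have "\<dots> = ereal (gallager_exponent b P W r)"
  proof (rule antisym)
    show "(SUP \<rho>\<in>{0..1}. ereal (gallager_E0 b \<rho> P W - \<rho> * r)) \<le> ereal (gallager_exponent b P W r)"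
      by (rule SUP_least) (use gallager_exponent_ge in auto)
    show "ereal (gallager_exponent b P W r) \<le> (SUP \<rho>\<in>{0..1}. ereal (gallager_E0 b \<rho> P W - \<rho> * r))"
    proof (rule ereal_le_real)
      fix z assume "(SUP \<rho>\<in>{0..1}. ereal (gallager_E0 b \<rho> P W - \<rho> * r)) \<le> ereal z"
      then have "gallager_E0 b \<rho> P W - \<rho> * r \<le> z" if "\<rho> \<in> {0..1}" for \<rho>
        using that by (auto simp: SUP_le_iff)
      then show "ereal (gallager_exponent b P W r) \<le> ereal z" using gallager_exponent_le by simp
    qed
  qed
  finally show ?thesis .
qed

lemma random_coding_le_sphere_packing: "random_coding_exponent b r P W \<le> sphere_packing_exponent b r W"
  unfolding random_coding_exponent_def sphere_packing_exponent_def
proof (rule SUP_mono)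
  fix \<rho> :: real assume "\<rho> \<in> {0..1}"
  then show "\<exists>m\<in>{0..}. ereal \<rho> * (alpha_mutual_info b (1 / (1 + \<rho>)) P W - ereal r) \<le>
      ereal m * ((SUP Q. alpha_mutual_info b (1 / (1 + m)) Q W) - ereal r)"
    by (intro bexI[of _ \<rho>] ereal_mult_left_mono ereal_minus_mono SUP_upper) auto
qed

text \<open>Both directions express that I is the slope of E_0 at 0 and also the supremum of
  E_0(\<rho>) / \<rho>: some \<rho> has E_0(\<rho>) > \<rho> r exactly if r < I.\<close>

lemma gallager_exponent_pos_iff: "0 < gallager_exponent b P W r \<longleftrightarrow> ereal r < mutual_info b P W"
proof
  assume "0 < gallager_exponent b P W r"
  then obtain \<rho> where \<rho>: "\<rho> \<in> {0..1}" "\<rho> * r < gallager_E0 b \<rho> P W" using gallager_exponent_less[of 0 r] by auto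
  then have \<rho>0: "0 < \<rho>" by (cases "\<rho> = 0") (auto simp: gallager_E0_0)
  have "ereal (\<rho> * r) < ereal \<rho> * mutual_info b P W"
    using less_le_trans[OF _ gallager_E0_le[OF b \<rho>0, of P W]] \<rho>(2) by simp
  then show "ereal r < mutual_info b P W"
    using \<rho>0 by (cases "mutual_info b P W") auto
next
  assume "ereal r < mutual_info b P W"
  then obtain \<rho> where "0 < \<rho>" "\<rho> \<le> 1" "\<rho> * r < gallager_E0 b \<rho> P W"
    using ex_gallager_E0_gt[OF b] by blast
  then show "0 < gallager_exponent b P W r" using gallager_exponent_ge[of \<rho> r] by auto
qed

lemma limsup_entropy_exponent:
  assumes \<alpha>: "0 < \<alpha>" and R: "0 \<le> R"
    and ne: "\<forall>\<^sub>F n in sequentially. ensemble_entropy b \<alpha> R P W n \<noteq> 0"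
  shows "limsup (entropy_exponent b \<alpha> R P W) \<le> random_coding_exponent b R P W"
  unfolding random_coding_exponent_eq
proof (rule ereal_le_epsilon2)
  fix \<epsilon> :: real assume \<epsilon>: "0 < \<epsilon>"
  have lnb: "0 < ln b" using b by simp
  \<comment> \<open>One blocklength with nonzero entropy suffices to extract R > 0 and the
    overlapping letters.\<close>
  obtain n0 where n0: "ensemble_entropy b \<alpha> R P W n0 \<noteq> 0"
    using eventually_happens[OF ne] by auto
  have Rpos: "0 < R"
    using ensemble_entropy_0_rate_0[OF \<alpha> b, of P W n0] n0 R by (cases "R = 0") auto
  obtain x0 x1 y0 where overlap: "x0 \<in> set_pmf P" "x1 \<in> set_pmf P" "x0 \<noteq> x1" "y0 \<in> set_pmf (W x0)" "y0 \<in> set_pmf (W x1)"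
    using ensemble_entropy_0_disjoint[OF \<alpha> b, of P W R n0] n0 by metis
  let ?E = "gallager_exponent b P W R * ln b"
  have E: "- ln (gallager_sum P W \<rho>) - \<rho> * (R * ln b) \<le> ?E" if "\<rho> \<in> {0..1}" for \<rho>
  proof -
    have "(gallager_E0 b \<rho> P W - \<rho> * R) * ln b \<le> ?E"
      using gallager_exponent_ge[OF that, of R] lnb by (intro mult_right_mono) auto
    moreover have "gallager_E0 b \<rho> P W * ln b = - ln (gallager_sum P W \<rho>)"
      using that lnb by (simp add: gallager_E0_eq log_def)
    ultimately show ?thesis by (simp add: left_diff_distrib mult.assoc)
  qed
  have expR: "exp (real n * (R * ln b)) = b powr (n * R)" for n
    using b by (simp add: powr_def mult.assoc)
  have "filterlim (\<lambda>n. exp (real n * (R * ln b))) at_top sequentially"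
    by (intro filterlim_compose[OF exp_at_top] filterlim_at_top_mult_tendsto_pos[OF tendsto_const _ filterlim_real_sequentially])
       (use Rpos lnb in simp)
  then have "\<forall>\<^sub>F n in sequentially. 2 \<le> exp (real n * (R * ln b))"
    by (simp add: filterlim_at_top)
  \<comment> \<open>As R > 0, b powr (n R) eventually reaches 2, and from then on removing the
    transmitted word leaves at least half of it.\<close>
  then have M: "\<forall>\<^sub>F n in sequentially. exp (real n * (R * ln b)) / 2 \<le> real (code_size b R n) - 1"
  proof eventually_elim
    case (elim n)
    then show ?case using code_size_ge[of b n R] unfolding expR by linarith
  qed
  obtain c where c: "0 < c"
    "\<And>n. ensemble_entropy b \<alpha> R P W n \<noteq> 0 \<Longrightarrow>
      c * measure_pmf.expectation (codebook_pmf n (code_size b R n) P)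
        (\<lambda>d. posterior_loss (code_joint_pmf n (code_size b R n) W d)) \<le> ensemble_entropy b \<alpha> R P W n"
    using ensemble_entropy_ge[OF b \<alpha>] by blast
  have "\<forall>\<^sub>F n in sequentially. exp (- (n * (?E + \<epsilon> * ln b))) / 64 \<le>
    measure_pmf.expectation (codebook_pmf n (code_size b R n) P) (\<lambda>d. posterior_loss (code_joint_pmf n (code_size b R n) W d))"
    by (rule expected_loss_lower_exponent[OF overlap E _ _ M]) (use R lnb \<epsilon> in auto)
  then have "\<forall>\<^sub>F n in sequentially. c / 64 * b powr (- (real n * (gallager_exponent b P W R + \<epsilon>))) \<le> ensemble_entropy b \<alpha> R P W n"
    using ne
  proof eventually_elim
    case (elim n)
    have "exp (- (n * (?E + \<epsilon> * ln b))) = b powr (- (real n * (gallager_exponent b P W R + \<epsilon>)))"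
      using b by (simp add: powr_def algebra_simps)
    then have "c / 64 * b powr (- (real n * (gallager_exponent b P W R + \<epsilon>))) = c * (exp (- (n * (?E + \<epsilon> * ln b))) / 64)" by simp
    also have "\<dots> \<le> c * measure_pmf.expectation (codebook_pmf n (code_size b R n) P) (\<lambda>d. posterior_loss (code_joint_pmf n (code_size b R n) W d))"
      using elim(1) c(1) by (intro mult_left_mono) auto
    also have "\<dots> \<le> ensemble_entropy b \<alpha> R P W n" by (rule c(2)[OF elim(2)])
    finally show ?case .
  qed
  then have "limsup (entropy_exponent b \<alpha> R P W) \<le> ereal (gallager_exponent b P W R + \<epsilon>)"
    by (rule limsup_entropy_exponent_le[OF b, rotated]) (use c(1) in simp)
  then show "limsup (entropy_exponent b \<alpha> R P W) \<le> ereal (gallager_exponent b P W R) + ereal \<epsilon>" by simp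
qed

lemma liminf_entropy_exponent:
  assumes \<alpha>: "0 < \<alpha>" "\<alpha> < 1" and R: "0 \<le> R" and crit: "(1 / \<alpha> - 1) * R < gallager_exponent b P W R"
  shows "ereal (\<alpha> * gallager_exponent b P W R - (1 - \<alpha>) * R) \<le> liminf (entropy_exponent b \<alpha> R P W)"
proof (rule ereal_le_epsilon2)
  fix \<epsilon> :: real assume \<epsilon>: "0 < \<epsilon>"
  \<comment> \<open>Because the hypothesis on the rate is strict, a single near-optimal \<rho> can
    also satisfy the positivity condition of the achievability bound.\<close>
  have "max (gallager_exponent b P W R - \<epsilon> / \<alpha>) ((1 / \<alpha> - 1) * R) < gallager_exponent b P W R"
    using crit \<epsilon> \<alpha> by simp
  then obtain \<rho> where \<rho>: "\<rho> \<in> {0..1}" "gallager_exponent b P W R - \<epsilon> / \<alpha> < gallager_E0 b \<rho> P W - \<rho> * R"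
    "(1 / \<alpha> - 1) * R < gallager_E0 b \<rho> P W - \<rho> * R"
    using gallager_exponent_less[of _ R] by (metis max_less_iff_conj)
  have "\<alpha> * (gallager_exponent b P W R - \<epsilon> / \<alpha>) \<le> \<alpha> * (gallager_E0 b \<rho> P W - \<rho> * R)"
    using \<rho>(2) \<alpha> by (intro mult_left_mono) auto
  then have "\<alpha> * gallager_exponent b P W R - (1 - \<alpha>) * R \<le> \<alpha> * (gallager_E0 b \<rho> P W - \<rho> * R) - (1 - \<alpha>) * R + \<epsilon>"
    using \<alpha> by (simp add: right_diff_distrib)
  then have "ereal (\<alpha> * gallager_exponent b P W R - (1 - \<alpha>) * R) \<le>
      ereal (\<alpha> * (gallager_E0 b \<rho> P W - \<rho> * R) - (1 - \<alpha>) * R) + ereal \<epsilon>" by simp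
  also have "\<dots> \<le> liminf (entropy_exponent b \<alpha> R P W) + ereal \<epsilon>"
    using \<rho> by (intro add_right_mono ensemble_entropy_achievable[OF b \<alpha> R]) auto
  finally show "ereal (\<alpha> * gallager_exponent b P W R - (1 - \<alpha>) * R) \<le> liminf (entropy_exponent b \<alpha> R P W) + ereal \<epsilon>" .
qed

section \<open>The critical rate\<close>

context
  assumes I: "0 < mutual_info b P W"
begin

lemma gallager_exponent_0_pos: "0 < gallager_exponent b P W 0"
  using I by (simp add: gallager_exponent_pos_iff zero_ereal_def[symmetric])

text \<open>On the line (1 / \<alpha> - 1) r with r > 0 the exponent is positive, and positivity
  already forces r < I.\<close>

lemma is_critical_rate_iff:
  assumes "0 < \<alpha>" "\<alpha> < 1"
  shows "is_critical_rate b \<alpha> P W r \<longleftrightarrow> 0 < r \<and> gallager_exponent b P W r = (1 / \<alpha> - 1) * r"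
proof -
  have "0 < (1 / \<alpha> - 1) * r" if "0 < r" using assms that by (intro mult_pos_pos) (auto simp: field_simps)
  then show ?thesis
    unfolding is_critical_rate_def random_coding_exponent_eq using gallager_exponent_pos_iff[of r] by auto
qed

lemma gallager_exponent_minus_line_strict_antimono:
  assumes "0 < \<kappa>" "r < r'"
  shows "gallager_exponent b P W r' - \<kappa> * r' < gallager_exponent b P W r - \<kappa> * r"
  using gallager_exponent_antimono[of r r'] mult_strict_left_mono[OF assms(2,1)] assms(2) by linarith

lemma ex1_critical_rate:
  assumes \<alpha>: "0 < \<alpha>" "\<alpha> < 1"
  shows "\<exists>!r. is_critical_rate b \<alpha> P W r"
proof -
  let ?\<kappa> = "1 / \<alpha> - 1" and ?h = "\<lambda>r. gallager_exponent b P W r - (1 / \<alpha> - 1) * r"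
  have \<kappa>: "0 < ?\<kappa>" using \<alpha> by (simp add: field_simps)
  \<comment> \<open>At this point the line has reached the value of the exponent at 0 plus its
    slope, so it lies above the decreasing exponent.\<close>
  let ?t = "gallager_exponent b P W 0 / ?\<kappa> + 1"
  have t: "0 < ?t" using \<kappa> gallager_exponent_0_pos by (intro add_pos_pos divide_pos_pos) auto
  have "k * (e / k + 1) = e + k" if "0 < k" for e k :: real using that by (simp add: distrib_left)
  from this[OF \<kappa>] have "?\<kappa> * ?t = gallager_exponent b P W 0 + ?\<kappa>" .
  then have "?h ?t \<le> 0" using gallager_exponent_antimono[of 0 ?t] t \<kappa> by linarith
  moreover have "0 \<le> ?h 0" using gallager_exponent_0_pos by simp
  moreover have "continuous_on {0..?t} ?h" by (intro continuous_intros continuous_gallager_exponent)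
  ultimately obtain r where r: "0 \<le> r" "?h r = 0" using IVT2'[of ?h ?t 0 0] t by auto
  then have "0 < r" using gallager_exponent_0_pos by (cases "r = 0") auto
  then have "is_critical_rate b \<alpha> P W r" using r by (simp add: is_critical_rate_iff[OF \<alpha>])
  moreover have "r1 = r2" if "is_critical_rate b \<alpha> P W r1" "is_critical_rate b \<alpha> P W r2" for r1 r2
    using that gallager_exponent_minus_line_strict_antimono[OF \<kappa>, of r1 r2] gallager_exponent_minus_line_strict_antimono[OF \<kappa>, of r2 r1]
    by (cases r1 r2 rule: linorder_cases) (auto simp: is_critical_rate_iff[OF \<alpha>])
  ultimately show ?thesis by blast
qed

text \<open>The exponent minus the line is strictly decreasing with its zero at the critical rate,
  so comparing r with that rate means looking at a sign at r. In the two equivalences \<alpha>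
  occurs only in the slope of the line, which reduces monotonicity, continuity and both limits to
  statements about 1 / \<alpha> - 1 at a fixed r.\<close>

lemma critical_rate:
  assumes \<alpha>: "0 < \<alpha>" "\<alpha> < 1"
  shows "0 < critical_rate b \<alpha> P W" "ereal (critical_rate b \<alpha> P W) < mutual_info b P W"
    and less_critical_rate_iff: "r < critical_rate b \<alpha> P W \<longleftrightarrow> (1 / \<alpha> - 1) * r < gallager_exponent b P W r"
    and critical_rate_less_iff: "critical_rate b \<alpha> P W < r \<longleftrightarrow> gallager_exponent b P W r < (1 / \<alpha> - 1) * r"
proof -
  let ?c = "critical_rate b \<alpha> P W"
  have c: "is_critical_rate b \<alpha> P W ?c"
    unfolding critical_rate_def by (rule theI'[OF ex1_critical_rate[OF \<alpha>]])
  then show "0 < ?c" "ereal ?c < mutual_info b P W" by (auto simp: is_critical_rate_def)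
  have \<kappa>: "0 < 1 / \<alpha> - 1" using \<alpha> by (simp add: field_simps)
  have eq: "gallager_exponent b P W ?c = (1 / \<alpha> - 1) * ?c" using c by (simp add: is_critical_rate_iff[OF \<alpha>])
  note mono = gallager_exponent_minus_line_strict_antimono[OF \<kappa>, of r ?c] gallager_exponent_minus_line_strict_antimono[OF \<kappa>, of ?c r]
  show "r < ?c \<longleftrightarrow> (1 / \<alpha> - 1) * r < gallager_exponent b P W r" "?c < r \<longleftrightarrow> gallager_exponent b P W r < (1 / \<alpha> - 1) * r"
    using mono eq by (cases r ?c rule: linorder_cases; force)+
qed

lemma critical_rate_strict_mono: "strict_mono_on {0<..<1} (\<lambda>\<alpha>. critical_rate b \<alpha> P W)"
proof (rule strict_mono_onI)
  fix \<alpha> \<beta> :: real assume "\<alpha> \<in> {0<..<1}" "\<beta> \<in> {0<..<1}" and less: "\<alpha> < \<beta>"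
  then have \<alpha>: "0 < \<alpha>" "\<alpha> < 1" and \<beta>: "0 < \<beta>" "\<beta> < 1" by auto
  let ?c = "critical_rate b \<alpha> P W"
  have "1 / \<beta> < 1 / \<alpha>" using \<alpha> less by (simp add: frac_less2)
  then have "(1 / \<beta> - 1) * ?c < (1 / \<alpha> - 1) * ?c"
    using critical_rate(1)[OF \<alpha>] by (intro mult_strict_right_mono) auto
  also have "\<dots> = gallager_exponent b P W ?c"
    using less_critical_rate_iff[OF \<alpha>, of ?c] critical_rate_less_iff[OF \<alpha>, of ?c] by force
  finally show "?c < critical_rate b \<beta> P W" unfolding less_critical_rate_iff[OF \<beta>] .
qed

lemma critical_rate_continuous: "continuous_on {0<..<1} (\<lambda>\<alpha>. critical_rate b \<alpha> P W)"
  unfolding continuous_on_def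
proof (intro ballI)
  fix \<alpha> :: real assume "\<alpha> \<in> {0<..<1}"
  then have \<alpha>: "0 < \<alpha>" "\<alpha> < 1" by auto
  let ?F = "at \<alpha> within {0<..<1}"
  have in01: "\<forall>\<^sub>F \<beta> in ?F. 0 < \<beta> \<and> \<beta> < 1"
    by (auto simp: eventually_at_topological)
  have lim: "((\<lambda>\<beta>. (1 / \<beta> - 1) * r) \<longlongrightarrow> (1 / \<alpha> - 1) * r) ?F" for r
    using \<alpha> by (intro tendsto_intros) auto
  show "((\<lambda>\<alpha>. critical_rate b \<alpha> P W) \<longlongrightarrow> critical_rate b \<alpha> P W) ?F"
  proof (rule order_tendstoI)
    fix r assume "r < critical_rate b \<alpha> P W"
    then have "\<forall>\<^sub>F \<beta> in ?F. (1 / \<beta> - 1) * r < gallager_exponent b P W r"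
      unfolding less_critical_rate_iff[OF \<alpha>] by (rule order_tendstoD(2)[OF lim])
    then show "\<forall>\<^sub>F \<beta> in ?F. r < critical_rate b \<beta> P W"
      using in01 by eventually_elim (use less_critical_rate_iff in blast)
  next
    fix r assume "critical_rate b \<alpha> P W < r"
    then have "\<forall>\<^sub>F \<beta> in ?F. gallager_exponent b P W r < (1 / \<beta> - 1) * r"
      unfolding critical_rate_less_iff[OF \<alpha>] by (rule order_tendstoD(1)[OF lim])
    then show "\<forall>\<^sub>F \<beta> in ?F. critical_rate b \<beta> P W < r"
      using in01 by eventually_elim (use critical_rate_less_iff in blast)
  qed
qed

lemma critical_rate_at_0: "((\<lambda>\<alpha>. critical_rate b \<alpha> P W) \<longlongrightarrow> 0) (at_right 0)"
proof (rule order_tendstoI)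
  fix r :: real assume "r < 0"
  have "\<forall>\<^sub>F \<alpha> in at_right 0. \<alpha> \<in> {0<..<1::real}" by (rule eventually_at_right_real) simp
  then show "\<forall>\<^sub>F \<alpha> in at_right 0. r < critical_rate b \<alpha> P W"
  proof eventually_elim
    case (elim \<alpha>)
    then show ?case using critical_rate(1)[of \<alpha>] \<open>r < 0\<close> by auto
  qed
next
  fix r :: real assume r: "0 < r"
  \<comment> \<open>Solving E < (1 / \<alpha> - 1) r for \<alpha> gives \<alpha> < r / (E + r),
    where E is the exponent at r.\<close>
  let ?t = "min 1 (r / (gallager_exponent b P W r + r))"
  have pos: "0 < gallager_exponent b P W r + r" using gallager_exponent_nonneg[of r] r by simp
  have "\<forall>\<^sub>F \<alpha> in at_right 0. \<alpha> \<in> {0<..<?t}" using pos r by (intro eventually_at_right_real) simp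
  then show "\<forall>\<^sub>F \<alpha> in at_right 0. critical_rate b \<alpha> P W < r"
  proof eventually_elim
    case (elim \<alpha>)
    then have \<alpha>: "0 < \<alpha>" "\<alpha> < 1" "\<alpha> < r / (gallager_exponent b P W r + r)" by auto
    have "\<alpha> * (gallager_exponent b P W r + r) < r" using \<alpha>(3) pos by (simp add: pos_less_divide_eq)
    then have "gallager_exponent b P W r < (1 / \<alpha> - 1) * r" using \<alpha> by (simp add: field_simps)
    then show ?case unfolding critical_rate_less_iff[OF \<alpha>(1,2)] .
  qed
qed

text \<open>For each r in (0, I) the exponent at r is positive while the line at r tends to 0, so
  the critical rate eventually exceeds r; it never reaches I. Working in the extended reals covers I
  = \<infinity> as well.\<close>

lemma critical_rate_at_1: "((\<lambda>\<alpha>. ereal (critical_rate b \<alpha> P W)) \<longlongrightarrow> mutual_info b P W) (at_left 1)"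
proof (rule order_tendstoI)
  have in01: "\<forall>\<^sub>F \<alpha> in at_left 1. \<alpha> \<in> {0<..<1::real}" by (rule eventually_at_left_real) simp
  {
    fix x assume "x < mutual_info b P W"
    then have "max x 0 < mutual_info b P W" using I by simp
    then obtain r where r: "max x 0 < ereal r" "ereal r < mutual_info b P W"
      using ereal_dense2 by blast
    have "((\<lambda>\<alpha>. (1 / \<alpha> - 1) * r) \<longlongrightarrow> (1 / 1 - 1) * r) (at_left 1)"
      by (intro tendsto_intros) auto
    then have "((\<lambda>\<alpha>. (1 / \<alpha> - 1) * r) \<longlongrightarrow> 0) (at_left 1)" by simp
    moreover have "0 < gallager_exponent b P W r" using r(2) by (simp add: gallager_exponent_pos_iff)
    ultimately have "\<forall>\<^sub>F \<alpha> in at_left 1. (1 / \<alpha> - 1) * r < gallager_exponent b P W r" by (rule order_tendstoD(2))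
    then show "\<forall>\<^sub>F \<alpha> in at_left 1. x < ereal (critical_rate b \<alpha> P W)"
      using in01
    proof eventually_elim
      case (elim \<alpha>)
      then have "r < critical_rate b \<alpha> P W" using less_critical_rate_iff[of \<alpha> r] by auto
      then have "ereal r < ereal (critical_rate b \<alpha> P W)" by simp
      then show ?case using r(1) by (metis less_trans max_less_iff_conj)
    qed
  next
    fix x assume x: "mutual_info b P W < x"
    show "\<forall>\<^sub>F \<alpha> in at_left 1. ereal (critical_rate b \<alpha> P W) < x"
      using in01
    proof eventually_elim
      case (elim \<alpha>)
      then show ?case using critical_rate(2)[of \<alpha>] x by (auto intro: less_trans)
    qed
  }
qed

end

end

theorem theorem17:
  fixes b :: real
    and P :: "'a::countable pmf"
    and W :: "'a \<Rightarrow> 'b::countable pmf"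
  assumes "b > 1"
    and "mutual_info b P W > 0"
  shows
    "(\<forall>\<alpha> R. 0 < \<alpha> \<longrightarrow> 0 \<le> R \<longrightarrow> ereal R < capacity b W \<longrightarrow>
        (\<forall>\<^sub>F n in sequentially. ensemble_entropy b \<alpha> R P W n \<noteq> 0) \<longrightarrow>
        limsup (entropy_exponent b \<alpha> R P W) \<le> sphere_packing_exponent b R W)
     \<and>
     (\<forall>\<alpha>\<in>{0<..<1}. \<exists>!r. is_critical_rate b \<alpha> P W r)
     \<and>
     (\<forall>\<alpha>\<in>{0<..<1}. \<forall>R. 0 \<le> R \<longrightarrow> R < critical_rate b \<alpha> P W \<longrightarrow>
        liminf (entropy_exponent b \<alpha> R P W)
          \<ge> ereal \<alpha> * random_coding_exponent b R P W - ereal ((1 - \<alpha>) * R))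
     \<and>
     strict_mono_on {0<..<1} (\<lambda>\<alpha>. critical_rate b \<alpha> P W)
     \<and>
     continuous_on {0<..<1} (\<lambda>\<alpha>. critical_rate b \<alpha> P W)
     \<and>
     ((\<lambda>\<alpha>. critical_rate b \<alpha> P W) \<longlongrightarrow> 0) (at_right 0)
     \<and>
     ((\<lambda>\<alpha>. ereal (critical_rate b \<alpha> P W)) \<longlongrightarrow> mutual_info b P W) (at_left 1)"
proof (intro conjI allI ballI impI)
  fix \<alpha> R :: real
  assume "0 < \<alpha>" "0 \<le> R" "\<forall>\<^sub>F n in sequentially. ensemble_entropy b \<alpha> R P W n \<noteq> 0"
  then show "limsup (entropy_exponent b \<alpha> R P W) \<le> sphere_packing_exponent b R W"
    by (rule order_trans[OF limsup_entropy_exponent[OF assms(1)] random_coding_le_sphere_packing[OF assms(1)]])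
next
  fix \<alpha> :: real assume "\<alpha> \<in> {0<..<1}"
  then show "\<exists>!r. is_critical_rate b \<alpha> P W r" by (intro ex1_critical_rate assms) auto
next
  fix \<alpha> R :: real
  assume \<alpha>: "\<alpha> \<in> {0<..<1}" and R: "0 \<le> R" and crit: "R < critical_rate b \<alpha> P W"
  have "(1 / \<alpha> - 1) * R < gallager_exponent b P W R"
    using less_critical_rate_iff[OF assms, of \<alpha> R] \<alpha> crit by simp
  then have "ereal (\<alpha> * gallager_exponent b P W R - (1 - \<alpha>) * R) \<le> liminf (entropy_exponent b \<alpha> R P W)"
    using \<alpha> R by (intro liminf_entropy_exponent assms) auto
  then show "ereal \<alpha> * random_coding_exponent b R P W - ereal ((1 - \<alpha>) * R) \<le> liminf (entropy_exponent b \<alpha> R P W)"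
    by (simp add: random_coding_exponent_eq[OF assms(1)])
qed (intro critical_rate_strict_mono critical_rate_continuous critical_rate_at_0 critical_rate_at_1 assms)+

end
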